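(* Let $\mathcal{S}$ be a symmetric free domain in $\mathbb{M}^2$, let $\mathfrak{G}_{oo}(\mathcal{S})$ be the associated Zariski-free manifold and let $\pi:\mathcal{S}_{oo}\to\mathfrak{G}_{oo}(\mathcal{S})$ be the covering map $$\pi(w)=\left(\tfrac12(w^1+w^2),\ \tfrac14(w^1-w^2)^2,\ \tfrac18(w^1-w^2)(w^1+w^2)(w^1-w^2)\right).$$ If $F_{oo}$ is a holomorphic function on $\mathfrak{G}_{oo}(\mathcal{S})$, then $f_{oo}=F_{oo}\circ\pi$ is a symmetric Zariski-freely holomorphic function on $\mathcal{S}_{oo}$. Conversely, if $f_{oo}$ is a symmetric Zariski-freely holomorphic function on $\mathcal{S}_{oo}$, then there exists a unique holomorphic function $F_{oo}$ on $\mathfrak{G}_{oo}(\mathcal{S})$ such that $f_{oo}=F_{oo}\circ\pi$.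
   Context: **Basics.** $\mathbb{M}_n$ is the algebra of $n\times n$ complex matrices, $\mathbb{M}^d=\bigcup_{n\ge1}\mathbb{M}_n^d$ (disjoint union), with points $x=(x^1,\dots,x^d)$. Direct sums and similarities $s^{-1}xs$ are taken componentwise. An *nc-set* is a subset of $\mathbb{M}^d$ closed under direct sums. A function $f:D\to\mathbb{M}^1$ is *graded* if $f(x)\in\mathbb{M}_n$ whenever $x\in D\cap\mathbb{M}_n^d$. An *nc-function* is a graded function $f$ on an nc-set $D$ such that $f(x\oplus y)=f(x)\oplus f(y)$ for $x,y\in D$, and $f(s^{-1}xs)=s^{-1}f(x)s$ whenever $x\in D\cap\mathbb{M}_n^d$, $s\in\mathbb{M}_n$ is invertible and $s^{-1}xs\in D$. For $w=(w^1,w^2)$, $w^f=(w^2,w^1)$; a set is *symmetric* if it is invariant under $w\mapsto w^f$, and a function $f$ on a symmetric set is *symmetric* if $f(w^f)=f(w)$. **Topologies.** A set $D\subseteq\mathbb{M}^d$ is finitely open if $D\cap\mathbb{M}_n^d$ is open in $\mathbb{M}_n^d$ for every $n$. A topology on $\mathbb{M}^d$ is *admissible* if it has a basis of finitely open nc-sets. The *free topology* has as base the sets $B_\delta=\{x:\|[\delta_{ij}(x)]\|<1\}$, $\delta$ a (rectangular) matrix of free polynomials (polynomials over $\mathbb{C}$ in non-commuting variables); freely open sets are free domains. For an admissible topology $\tau$, a graded function $f$ on $D$ is *$\tau$-holomorphic* if $D\in\tau$, every $x\in D$ has a neighborhood $U\in\tau$, $U\subseteq D$, that is an nc-set on which $f$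 is an nc-function, and every $x\in D$ has a $\tau$-neighborhood on which $f$ is bounded. One says freely (resp. Zariski-freely) holomorphic when $\tau$ is the free (resp. Zariski-free) topology. A *free variety* in a free domain $D$ is a set $\{x\in D: g(x)=0\ \forall g\in E\}$, $E$ a set of freely holomorphic functions on $D$. The *Zariski-free topology* has as base the sets $D\setminus T$, $D$ a free domain and $T$ a finite union of free varieties in $D$; it is admissible. **Constructions.** Let $\Gamma$ be the set of finite subsets of $\mathbb{C}\setminus\{0\}$. For each $\gamma\in\Gamma$ fix $r_\gamma>0$ with $r_\gamma<\min\{\min_{c\in\gamma}|c|,\ \tfrac14\min_{c\ne d\in\gamma}|c-d|\}$, let $\Delta_\gamma=\bigcup_{c\in\gamma}\{z:|z-c|<r_\gamma\}$, and fix a holomorphic branch $s_\gamma$ of $\sqrt z$ on $\Delta_\gamma$. For $\tau\in\{-1,1\}^\gamma$ let $\iota_{\gamma\tau}(z)=\tau(c)$ if $|z-c|<r_\gamma$, $c\in\gamma$. Let $D_\gamma=\{x\in\mathbb{M}^1:\sigma(x)\subseteq\Delta_\gamma\}$ and, via the holomorphic functional calculus, $I_{\gamma\tau}(x)=\iota_{\gamma\tau}(x)$ and $S_{\gamma\tau}(x)=s_\gamma(x)\iota_{\gamma\tau}(x)$ for $x\in D_\gamma$. Let $\mathcal{U}_\gamma=\{(u,x)\in\mathbb{M}^2: x\in D_\gamma,\ uI_{\gamma\tau}(x)\ne I_{\gamma\tau}(x)u$ for every nonconstant $\tau\in\{-1,1\}^\gamma\}$. Put $\omega_{\gamma\tau}(u,x)=(u+S_{\gamma\tau}(x),u-S_{\gamma\tau}(x))$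 and $\Phi_{\gamma\tau}(u,x)=(u,x,S_{\gamma\tau}(x)uS_{\gamma\tau}(x))$ on $\mathcal{U}_\gamma$. Over all $\gamma\in\Gamma$, $\tau\in\{-1,1\}^\gamma$: $\mathcal{S}_{oo}=\bigcup_{\gamma,\tau}(\omega_{\gamma\tau}(\mathcal{U}_\gamma)\cap\mathcal{S})$ (a Zariski-freely open set); $\mathcal{U}_{\gamma\tau}(\mathcal{S})=\{(u,x)\in\mathcal{U}_\gamma:\omega_{\gamma\tau}(u,x)\in\mathcal{S}\}$ (Zariski-freely open); $\mathfrak{G}_{oo}(\mathcal{S})=\bigcup_{\gamma,\tau}\Phi_{\gamma\tau}(\mathcal{U}_{\gamma\tau}(\mathcal{S}))\subseteq\mathbb{M}^3$, with the topology having as base the sets $\Phi_{\gamma\tau}(U)$, $U\subseteq\mathcal{U}_{\gamma\tau}(\mathcal{S})$ Zariski-freely open, and with charts $\Phi_{\gamma\tau}^{-1}:\Phi_{\gamma\tau}(\mathcal{U}_{\gamma\tau}(\mathcal{S}))\to\mathcal{U}_{\gamma\tau}(\mathcal{S})$. A function $F:\mathfrak{G}_{oo}(\mathcal{S})\to\mathbb{M}^1$ is *holomorphic* if $F\circ\Phi_{\gamma\tau}$ is Zariski-freely holomorphic on $\mathcal{U}_{\gamma\tau}(\mathcal{S})$ for all $\gamma,\tau$. *)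

theory Defs
  imports
    "HOL-Complex_Analysis.Complex_Analysis"
    "HOL-Library.FuncSet"
    "HOL-Library.Poly_Mapping"
    "Jordan_Normal_Form.Gauss_Jordan_Elimination"
    "Jordan_Normal_Form.Spectral_Radius"
begin

section \<open>Points, nc-sets and nc-functions\<close>

text \<open>A point of \<open>\<bbbM>\<^sup>d\<close> (always with \<open>d \<ge> 1\<close>) is a list of \<open>d\<close> square complex matrices of one common
  size \<open>n \<ge> 1\<close>; the component \<open>x\<^sup>i\<close> is \<open>x ! (i - 1)\<close>. For \<open>\<bbbM>\<^sup>1\<close> as the target of a function, and for
  the domain of the functional calculus, a matrix is used instead of a one-element list.\<close>

definition nc_level :: "nat \<Rightarrow> nat \<Rightarrow> complex mat list set" where
  "nc_level d n = {x. length x = d \<and> (\<forall>i<d. x ! i \<in> carrier_mat n n)}"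

definition nc_space :: "nat \<Rightarrow> complex mat list set" where
  "nc_space d = (\<Union>n\<in>{1..}. nc_level d n)"

definition direct_sum :: "complex mat \<Rightarrow> complex mat \<Rightarrow> complex mat" where
  "direct_sum A B =
     four_block_mat A (0\<^sub>m (dim_row A) (dim_col B)) (0\<^sub>m (dim_row B) (dim_col A)) B"

definition nc_set :: "nat \<Rightarrow> complex mat list set \<Rightarrow> bool" where
  "nc_set d D \<longleftrightarrow> D \<subseteq> nc_space d \<and> (\<forall>x\<in>D. \<forall>y\<in>D. map2 direct_sum x y \<in> D)"

definition graded :: "nat \<Rightarrow> complex mat list set \<Rightarrow> (complex mat list \<Rightarrow> complex mat) \<Rightarrow> bool" where
  "graded d D f \<longleftrightarrow> (\<forall>n\<ge>1. \<forall>x \<in> D \<inter> nc_level d n. f x \<in> carrier_mat n n)"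

text \<open>In the similarity clause \<open>t\<close> is the inverse of \<open>s\<close>.\<close>

definition nc_function ::
    "nat \<Rightarrow> complex mat list set \<Rightarrow> (complex mat list \<Rightarrow> complex mat) \<Rightarrow> bool" where
  "nc_function d D f \<longleftrightarrow>
     nc_set d D \<and> graded d D f \<and>
     (\<forall>x\<in>D. \<forall>y\<in>D. f (map2 direct_sum x y) = direct_sum (f x) (f y)) \<and>
     (\<forall>n\<ge>1. \<forall>x \<in> D \<inter> nc_level d n. \<forall>s \<in> carrier_mat n n. \<forall>t \<in> carrier_mat n n.
        inverts_mat s t \<longrightarrow> inverts_mat t s \<longrightarrow> map (\<lambda>A. t * A * s) x \<in> D \<longrightarrow>
        f (map (\<lambda>A. t * A * s) x) = t * f x * s)"

definition flip :: "complex mat list \<Rightarrow> complex mat list" where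
  "flip w = [w ! 1, w ! 0]"

definition symmetric_set :: "complex mat list set \<Rightarrow> bool" where
  "symmetric_set D \<longleftrightarrow> flip ` D = D"

definition symmetric_function ::
    "complex mat list set \<Rightarrow> (complex mat list \<Rightarrow> complex mat) \<Rightarrow> bool" where
  "symmetric_function D f \<longleftrightarrow> symmetric_set D \<and> (\<forall>w\<in>D. f (flip w) = f w)"


section \<open>Operator norm and free polynomials\<close>

definition op_norm :: "complex mat \<Rightarrow> real" where
  "op_norm A =
     (SUP v \<in> {v \<in> carrier_vec (dim_col A). L2_set (\<lambda>i. cmod (vec_index v i)) {..<dim_col A} \<le> 1}.
        L2_set (\<lambda>i. cmod (vec_index (mult_mat_vec A v) i)) {..<dim_row A})"

text \<open>A free polynomial is a finitely supported family of coefficients indexed by words; the letter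
  \<open>i < d\<close> stands for the variable \<open>x ! i\<close>.\<close>

type_synonym free_poly = "nat list \<Rightarrow>\<^sub>0 complex"

definition free_polys :: "nat \<Rightarrow> free_poly set" where
  "free_polys d = {p. \<forall>w \<in> Poly_Mapping.keys p. set w \<subseteq> {..<d}}"

definition word_eval :: "nat \<Rightarrow> complex mat list \<Rightarrow> nat list \<Rightarrow> complex mat" where
  "word_eval n x w = foldr (\<lambda>i A. (x ! i) * A) w (1\<^sub>m n)"

definition free_poly_eval :: "nat \<Rightarrow> complex mat list \<Rightarrow> free_poly \<Rightarrow> complex mat" where
  "free_poly_eval n x p =
     Matrix.mat n n (\<lambda>ij. \<Sum>w \<in> Poly_Mapping.keys p. Poly_Mapping.lookup p w * (word_eval n x w $$ ij))"

text \<open>The block matrix \<open>[\<delta>\<^sub>i\<^sub>j(x)]\<close>, whose \<open>n \<times> n\<close> blocks are the values of the entries of \<open>\<delta>\<close>.\<close>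

definition free_poly_mat_eval :: "nat \<Rightarrow> complex mat list \<Rightarrow> free_poly mat \<Rightarrow> complex mat" where
  "free_poly_mat_eval n x \<delta> =
     Matrix.mat (dim_row \<delta> * n) (dim_col \<delta> * n)
       (\<lambda>(i, j). free_poly_eval n x (\<delta> $$ (i div n, j div n)) $$ (i mod n, j mod n))"


section \<open>The free and the Zariski-free topology\<close>

text \<open>A topology is represented by the family of its open sets, and a topology given by a base by the
  family of all unions of base sets.\<close>

definition opens_of_base :: "'a set set \<Rightarrow> 'a set set" where
  "opens_of_base \<B> = {W. (arbitrary union_of (\<lambda>B. B \<in> \<B>)) W}"

definition free_basic :: "nat \<Rightarrow> free_poly mat \<Rightarrow> complex mat list set" where
  "free_basic d \<delta> = {x. \<exists>n\<ge>1. x \<in> nc_level d n \<and> op_norm (free_poly_mat_eval n x \<delta>) < 1}"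

definition free_opens :: "nat \<Rightarrow> complex mat list set set" where
  "free_opens d = opens_of_base {free_basic d \<delta> | \<delta>. elements_mat \<delta> \<subseteq> free_polys d}"

definition tau_holomorphic ::
    "nat \<Rightarrow> complex mat list set set \<Rightarrow> complex mat list set \<Rightarrow>
      (complex mat list \<Rightarrow> complex mat) \<Rightarrow> bool" where
  "tau_holomorphic d \<T> D f \<longleftrightarrow>
     D \<in> \<T> \<and> graded d D f \<and>
     (\<forall>x\<in>D. \<exists>U\<in>\<T>. x \<in> U \<and> U \<subseteq> D \<and> nc_function d U f) \<and>
     (\<forall>x\<in>D. \<exists>U\<in>\<T>. x \<in> U \<and> U \<subseteq> D \<and> (\<exists>M. \<forall>y\<in>U. op_norm (f y) \<le> M))"

definition free_varieties :: "nat \<Rightarrow> complex mat list set \<Rightarrow> complex mat list set set" where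
  "free_varieties d D =
     {{x \<in> D. \<forall>g\<in>E. g x = 0\<^sub>m (dim_row (g x)) (dim_col (g x))} | E.
        \<forall>g\<in>E. tau_holomorphic d (free_opens d) D g}"

definition zariski_free_opens :: "nat \<Rightarrow> complex mat list set set" where
  "zariski_free_opens d =
     opens_of_base {D - \<Union>\<V> | D \<V>. D \<in> free_opens d \<and> finite \<V> \<and> \<V> \<subseteq> free_varieties d D}"


section \<open>Holomorphic functional calculus\<close>

text \<open>The Riesz--Dunford integral \<open>(2\<pi>\<i>)\<^bsup>-1\<^esup> \<integral> f(z) (z - A)\<^bsup>-1\<^esup> dz\<close>, taken entrywise over a cycle
  consisting of one small circle around each eigenvalue of \<open>A\<close>; in the library, \<open>residue\<close> is by
  definition the integral over such a circle divided by \<open>2\<pi>\<i>\<close>.\<close>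

definition resolvent :: "complex mat \<Rightarrow> complex \<Rightarrow> complex mat" where
  "resolvent A z = the (mat_inverse (z \<cdot>\<^sub>m 1\<^sub>m (dim_row A) - A))"

definition hol_calculus :: "(complex \<Rightarrow> complex) \<Rightarrow> complex mat \<Rightarrow> complex mat" where
  "hol_calculus f A =
     Matrix.mat (dim_row A) (dim_row A)
       (\<lambda>ij. \<Sum>\<mu> \<in> spectrum A. residue (\<lambda>z. f z * (resolvent A z $$ ij)) \<mu>)"


section \<open>Branches of the square root\<close>

text \<open>Everything below depends on the choice of the radii \<open>r \<gamma>\<close> and of the branches \<open>s \<gamma>\<close> of the
  square root, which is made once for all \<open>\<gamma>\<close>.\<close>

definition Gam :: "complex set set" where
  "Gam = {\<gamma>. finite \<gamma> \<and> \<gamma> \<subseteq> - {0}}"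

definition Disc :: "(complex set \<Rightarrow> real) \<Rightarrow> complex set \<Rightarrow> complex set" where
  "Disc r \<gamma> = (\<Union>c\<in>\<gamma>. {z. cmod (z - c) < r \<gamma>})"

definition branch_choice ::
    "(complex set \<Rightarrow> real) \<Rightarrow> (complex set \<Rightarrow> complex \<Rightarrow> complex) \<Rightarrow> bool" where
  "branch_choice r s \<longleftrightarrow>
     (\<forall>\<gamma>\<in>Gam. 0 < r \<gamma> \<and> (\<forall>c\<in>\<gamma>. r \<gamma> < cmod c) \<and>
        (\<forall>c\<in>\<gamma>. \<forall>d\<in>\<gamma>. c \<noteq> d \<longrightarrow> r \<gamma> < cmod (c - d) / 4) \<and>
        s \<gamma> holomorphic_on Disc r \<gamma> \<and> (\<forall>z \<in> Disc r \<gamma>. (s \<gamma> z)\<^sup>2 = z))"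

definition signs :: "complex set \<Rightarrow> (complex \<Rightarrow> complex) set" where
  "signs \<gamma> = (\<gamma> \<rightarrow>\<^sub>E {-1, 1})"

text \<open>For \<open>\<gamma> \<in> Gam\<close> the discs making up \<open>Disc r \<gamma>\<close> are disjoint, so the centre below is unique for
  \<open>z \<in> Disc r \<gamma>\<close>. Values elsewhere are irrelevant.\<close>

definition iota :: "(complex set \<Rightarrow> real) \<Rightarrow> complex set \<Rightarrow> (complex \<Rightarrow> complex) \<Rightarrow> complex \<Rightarrow> complex"
  where "iota r \<gamma> \<tau> z = \<tau> (THE c. c \<in> \<gamma> \<and> cmod (z - c) < r \<gamma>)"

definition Dom :: "(complex set \<Rightarrow> real) \<Rightarrow> complex set \<Rightarrow> complex mat set" where
  "Dom r \<gamma> = {x. \<exists>n\<ge>1. x \<in> carrier_mat n n \<and> spectrum x \<subseteq> Disc r \<gamma>}"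

definition I_mat ::
    "(complex set \<Rightarrow> real) \<Rightarrow> complex set \<Rightarrow> (complex \<Rightarrow> complex) \<Rightarrow> complex mat \<Rightarrow> complex mat" where
  "I_mat r \<gamma> \<tau> x = hol_calculus (iota r \<gamma> \<tau>) x"

definition S_mat ::
    "(complex set \<Rightarrow> real) \<Rightarrow> (complex set \<Rightarrow> complex \<Rightarrow> complex) \<Rightarrow>
      complex set \<Rightarrow> (complex \<Rightarrow> complex) \<Rightarrow> complex mat \<Rightarrow> complex mat" where
  "S_mat r s \<gamma> \<tau> x = hol_calculus (\<lambda>z. s \<gamma> z * iota r \<gamma> \<tau> z) x"

definition U_gam :: "(complex set \<Rightarrow> real) \<Rightarrow> complex set \<Rightarrow> complex mat list set" where
  "U_gam r \<gamma> =
     {p \<in> nc_space 2. p ! 1 \<in> Dom r \<gamma> \<and>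
        (\<forall>\<tau> \<in> signs \<gamma>. \<not> \<tau> constant_on \<gamma> \<longrightarrow>
           p ! 0 * I_mat r \<gamma> \<tau> (p ! 1) \<noteq> I_mat r \<gamma> \<tau> (p ! 1) * p ! 0)}"


section \<open>The manifold and the covering map\<close>

definition omega ::
    "(complex set \<Rightarrow> real) \<Rightarrow> (complex set \<Rightarrow> complex \<Rightarrow> complex) \<Rightarrow>
      complex set \<Rightarrow> (complex \<Rightarrow> complex) \<Rightarrow> complex mat list \<Rightarrow> complex mat list" where
  "omega r s \<gamma> \<tau> p =
     [p ! 0 + S_mat r s \<gamma> \<tau> (p ! 1), p ! 0 - S_mat r s \<gamma> \<tau> (p ! 1)]"

definition Phi ::
    "(complex set \<Rightarrow> real) \<Rightarrow> (complex set \<Rightarrow> complex \<Rightarrow> complex) \<Rightarrow>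
      complex set \<Rightarrow> (complex \<Rightarrow> complex) \<Rightarrow> complex mat list \<Rightarrow> complex mat list" where
  "Phi r s \<gamma> \<tau> p =
     [p ! 0, p ! 1, S_mat r s \<gamma> \<tau> (p ! 1) * p ! 0 * S_mat r s \<gamma> \<tau> (p ! 1)]"

definition S_oo ::
    "(complex set \<Rightarrow> real) \<Rightarrow> (complex set \<Rightarrow> complex \<Rightarrow> complex) \<Rightarrow>
      complex mat list set \<Rightarrow> complex mat list set" where
  "S_oo r s S = (\<Union>\<gamma>\<in>Gam. \<Union>\<tau>\<in>signs \<gamma>. omega r s \<gamma> \<tau> ` U_gam r \<gamma> \<inter> S)"

definition U_chart ::
    "(complex set \<Rightarrow> real) \<Rightarrow> (complex set \<Rightarrow> complex \<Rightarrow> complex) \<Rightarrow>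
      complex mat list set \<Rightarrow> complex set \<Rightarrow> (complex \<Rightarrow> complex) \<Rightarrow> complex mat list set" where
  "U_chart r s S \<gamma> \<tau> = {p \<in> U_gam r \<gamma>. omega r s \<gamma> \<tau> p \<in> S}"

definition G_oo ::
    "(complex set \<Rightarrow> real) \<Rightarrow> (complex set \<Rightarrow> complex \<Rightarrow> complex) \<Rightarrow>
      complex mat list set \<Rightarrow> complex mat list set" where
  "G_oo r s S = (\<Union>\<gamma>\<in>Gam. \<Union>\<tau>\<in>signs \<gamma>. Phi r s \<gamma> \<tau> ` U_chart r s S \<gamma> \<tau>)"

definition holomorphic_on_G_oo ::
    "(complex set \<Rightarrow> real) \<Rightarrow> (complex set \<Rightarrow> complex \<Rightarrow> complex) \<Rightarrow>
      complex mat list set \<Rightarrow> (complex mat list \<Rightarrow> complex mat) \<Rightarrow> bool" where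
  "holomorphic_on_G_oo r s S F \<longleftrightarrow>
     (\<forall>\<gamma>\<in>Gam. \<forall>\<tau>\<in>signs \<gamma>.
        tau_holomorphic 2 (zariski_free_opens 2) (U_chart r s S \<gamma> \<tau>) (F \<circ> Phi r s \<gamma> \<tau>))"

definition cover :: "complex mat list \<Rightarrow> complex mat list" where
  "cover w =
     [(1/2) \<cdot>\<^sub>m (w ! 0 + w ! 1),
      (1/4) \<cdot>\<^sub>m ((w ! 0 - w ! 1) ^\<^sub>m 2),
      (1/8) \<cdot>\<^sub>m ((w ! 0 - w ! 1) * (w ! 0 + w ! 1) * (w ! 0 - w ! 1))]"

end

theory Submission
  imports Defs
begin

text \<open>Write \<open>u = (w\<^sup>1 + w\<^sup>2) / 2\<close> and \<open>v = (w\<^sup>1 - w\<^sup>2) / 2\<close>. On the sheet for \<open>(\<gamma>, \<tau>)\<close> the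
  map \<open>\<omega>\<^bsub>\<gamma>\<tau>\<^esub>\<close> is inverse to the polynomial map \<open>w \<mapsto> (u, v\<^sup>2)\<close>, and \<open>\<pi> \<circ> \<omega>\<^bsub>\<gamma>\<tau>\<^esub> = \<Phi>\<^bsub>\<gamma>\<tau>\<^esub>\<close>. So
  both directions reduce to pulling back Zariski-freely holomorphic functions, once \<open>\<omega>\<^bsub>\<gamma>\<tau>\<^esub>\<close> is known
  to be a homeomorphism for the Zariski-free topologies. Continuity comes from polynomial approximation:
  if \<open>p\<close> annihilates \<open>x\<^sub>0\<close> and \<open>h\<close> interpolates \<open>f\<close> at the roots of \<open>p\<close>, then
  \<open>f(x) - h(x) = p(x) g(x)\<close>, where a contour integral bounds \<open>g(x)\<close> uniformly over all matrices \<open>x\<close>,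
  of any size, with \<open>x\<close> bounded and \<open>p(x)\<close> small.

  The descended function is well defined because \<open>\<pi>(w) = \<pi>(w')\<close> forces \<open>w' = w\<close> or \<open>w' = w\<^sup>f\<close>: two
  square roots of \<open>x\<close> with \<open>S u S = S' u S'\<close> differ by an involution \<open>I\<^bsub>\<gamma>\<kappa>\<^esub>(x)\<close> that commutes with
  \<open>u\<close>, and the definition of \<open>\<U>\<^sub>\<gamma>\<close> then makes \<open>\<kappa>\<close> constant.\<close>

section \<open>Operator norms and block matrices\<close>

unbundle no vec_syntax
no_notation fps_nth (infixl "$" 75)

text \<open>The obstacle is uniformity in the matrix size. A free neighbourhood of a point contains
  every direct sum of the point with itself, so no constant may depend on \<open>n\<close>. The
  calculus is defined entry by entry, and adding up bounds on entries would cost powers of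
  \<open>n\<close>. The estimate therefore pairs the calculus with two vectors and applies the
  residue theorem to one scalar function, with as many circles as \<open>p\<close> has distinct
  roots. The algebra of the calculus rests on one fact: matrices with a common annihilating
  polynomial share an interpolating polynomial, whatever their sizes. Direct sums, similarities and
  the recovery of \<open>v\<close> from its square then reduce to identities between polynomials.
  The sheets must be freely open before an inverse of \<open>omega\<close> can be continuous on
  them. This holds because the range of a branch, though described by an equation, is open. The
  Zariski part is formal: a free map that is continuous for the free topologies pulls varieties back
  to varieties.\<close>

definition vnorm :: "complex vec \<Rightarrow> real" where
  "vnorm v = L2_set (\<lambda>i. cmod (v $ i)) {..<dim_vec v}"

lemma vnorm_nonneg [simp]: "0 \<le> vnorm v"
  by (simp add: vnorm_def L2_set_nonneg)

lemma vnorm_sq: "(vnorm v)\<^sup>2 = (\<Sum>i<dim_vec v. (cmod (v $ i))\<^sup>2)"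
  by (simp add: vnorm_def L2_set_def sum_nonneg)

lemma vnorm_add:
  assumes "v \<in> carrier_vec n" "w \<in> carrier_vec n"
  shows "vnorm (v + w) \<le> vnorm v + vnorm w"
proof -
  have "vnorm (v + w) = L2_set (\<lambda>i. cmod (v $ i + w $ i)) {..<n}"
    unfolding vnorm_def using assms by (intro L2_set_cong) auto
  also have "\<dots> \<le> L2_set (\<lambda>i. cmod (v $ i) + cmod (w $ i)) {..<n}"
    by (intro L2_set_mono) (auto simp: norm_triangle_ineq)
  also have "\<dots> \<le> L2_set (\<lambda>i. cmod (v $ i)) {..<n} + L2_set (\<lambda>i. cmod (w $ i)) {..<n}"
    by (rule L2_set_triangle_ineq)
  finally show ?thesis using assms by (simp add: vnorm_def)
qed

lemma vnorm_smult [simp]: "vnorm (c \<cdot>\<^sub>v v) = cmod c * vnorm v"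
proof -
  have "vnorm (c \<cdot>\<^sub>v v) = L2_set (\<lambda>i. cmod c * cmod (v $ i)) {..<dim_vec v}"
    unfolding vnorm_def by (intro L2_set_cong) (auto simp: norm_mult)
  then show ?thesis by (simp add: vnorm_def L2_set_right_distrib)
qed

lemma vnorm_eq_0_iff: "v \<in> carrier_vec n \<Longrightarrow> vnorm v = 0 \<longleftrightarrow> v = 0\<^sub>v n"
  by (auto simp: vnorm_def L2_set_eq_0_iff)

lemma vnorm_zero [simp]: "vnorm (0\<^sub>v n) = 0"
  using vnorm_eq_0_iff[of "0\<^sub>v n" n] by simp

lemma vnorm_comp_le: "i < dim_vec v \<Longrightarrow> cmod (v $ i) \<le> vnorm v"
  unfolding vnorm_def by (rule member_le_L2_set[where f="\<lambda>i. cmod (v $ i)"]) auto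

lemma op_norm_alt:
  "op_norm A = (SUP v \<in> {v \<in> carrier_vec (dim_col A). vnorm v \<le> 1}. vnorm (A *\<^sub>v v))"
  unfolding op_norm_def vnorm_def by (rule arg_cong[where f=Sup]) (auto intro!: image_cong)

lemma vnorm_le_sum: "vnorm v \<le> (\<Sum>i<dim_vec v. cmod (v $ i))"
  unfolding vnorm_def by (rule L2_set_le_sum) auto

text \<open>A real \<open>SUP\<close> is meaningful only over a bounded set. The sum of the moduli
  of all entries is a crude bound, but it suffices for that.\<close>

lemma op_norm_bdd:
  "bdd_above ((\<lambda>v. vnorm (A *\<^sub>v v)) ` {v \<in> carrier_vec (dim_col A). vnorm v \<le> 1})"
proof (rule bdd_aboveI2)
  fix v :: "complex vec" assume v: "v \<in> {v \<in> carrier_vec (dim_col A). vnorm v \<le> 1}"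
  have "vnorm (A *\<^sub>v v) \<le> (\<Sum>i<dim_row A. cmod ((A *\<^sub>v v) $ i))"
    using vnorm_le_sum[of "A *\<^sub>v v"] by simp
  also have "\<dots> \<le> (\<Sum>i<dim_row A. \<Sum>j<dim_col A. cmod (A $$ (i,j)))"
  proof (intro sum_mono)
    fix i assume i: "i \<in> {..<dim_row A}"
    have "(A *\<^sub>v v) $ i = (\<Sum>j<dim_col A. A $$ (i,j) * v $ j)"
      using i v by (auto simp: scalar_prod_def atLeast0LessThan intro!: sum.cong)
    also have "cmod \<dots> \<le> (\<Sum>j<dim_col A. cmod (A $$ (i,j) * v $ j))" by (rule norm_sum)
    also have "\<dots> \<le> (\<Sum>j<dim_col A. cmod (A $$ (i,j)))"
    proof (intro sum_mono)
      fix j assume "j \<in> {..<dim_col A}"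
      then have "cmod (v $ j) \<le> 1" using v vnorm_comp_le[of j v] by auto
      then show "cmod (A $$ (i,j) * v $ j) \<le> cmod (A $$ (i,j))"
        by (simp add: norm_mult mult_left_le)
    qed
    finally show "cmod ((A *\<^sub>v v) $ i) \<le> (\<Sum>j<dim_col A. cmod (A $$ (i,j)))" .
  qed
  finally show "vnorm (A *\<^sub>v v) \<le> (\<Sum>i<dim_row A. \<Sum>j<dim_col A. cmod (A $$ (i,j)))" .
qed

lemma op_norm_mult_vec:
  assumes "v \<in> carrier_vec (dim_col A)"
  shows "vnorm (A *\<^sub>v v) \<le> op_norm A * vnorm v"
proof (cases "vnorm v = 0")
  case True
  then have "v = 0\<^sub>v (dim_col A)" using assms vnorm_eq_0_iff by blast
  then have "A *\<^sub>v v = 0\<^sub>v (dim_row A)" by auto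
  then show ?thesis using True by simp
next
  case False
  let ?c = "complex_of_real (1 / vnorm v)"
  have pos: "vnorm v > 0" using False by (simp add: order_less_le)
  have "?c \<cdot>\<^sub>v v \<in> {v \<in> carrier_vec (dim_col A). vnorm v \<le> 1}"
    using assms False by (auto simp: norm_divide)
  then have "vnorm (A *\<^sub>v (?c \<cdot>\<^sub>v v)) \<le> op_norm A"
    unfolding op_norm_alt by (rule cSUP_upper[OF _ op_norm_bdd])
  also have "A *\<^sub>v (?c \<cdot>\<^sub>v v) = ?c \<cdot>\<^sub>v (A *\<^sub>v v)"
    using assms by (intro mult_mat_vec) auto
  finally show ?thesis using pos by (simp add: norm_divide field_simps)
qed

lemma op_norm_leI:
  assumes "\<And>v. v \<in> carrier_vec (dim_col A) \<Longrightarrow> vnorm (A *\<^sub>v v) \<le> c * vnorm v" "0 \<le> c"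
  shows "op_norm A \<le> c"
  unfolding op_norm_alt
proof (rule cSUP_least)
  show "{v \<in> carrier_vec (dim_col A). vnorm v \<le> 1} \<noteq> {}"
    by (auto intro!: exI[of _ "0\<^sub>v (dim_col A)"])
  fix v :: "complex vec" assume v: "v \<in> {v \<in> carrier_vec (dim_col A). vnorm v \<le> 1}"
  then have "vnorm (A *\<^sub>v v) \<le> c * vnorm v" using assms(1) by simp
  also have "\<dots> \<le> c * 1" using v assms(2) by (intro mult_left_mono) auto
  finally show "vnorm (A *\<^sub>v v) \<le> c" by simp
qed

lemma op_norm_nonneg [simp]: "0 \<le> op_norm A"
proof -
  have "vnorm (A *\<^sub>v 0\<^sub>v (dim_col A)) \<le> op_norm A"
    unfolding op_norm_alt by (rule cSUP_upper[OF _ op_norm_bdd]) simp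
  then show ?thesis using vnorm_nonneg order_trans by blast
qed

lemma op_norm_mult_vec_le:
  assumes "A \<in> carrier_mat m n" "v \<in> carrier_vec n" "op_norm A \<le> c"
  shows "vnorm (A *\<^sub>v v) \<le> c * vnorm v"
proof -
  have "vnorm (A *\<^sub>v v) \<le> op_norm A * vnorm v"
    using assms by (intro op_norm_mult_vec) auto
  also have "\<dots> \<le> c * vnorm v" using assms by (intro mult_right_mono) auto
  finally show ?thesis .
qed

lemma op_norm_add:
  assumes "A \<in> carrier_mat m n" "B \<in> carrier_mat m n"
  shows "op_norm (A + B) \<le> op_norm A + op_norm B"
proof (rule op_norm_leI)
  fix v :: "complex vec" assume "v \<in> carrier_vec (dim_col (A + B))"
  then have v: "v \<in> carrier_vec n" using assms by simp
  have "vnorm ((A + B) *\<^sub>v v) = vnorm (A *\<^sub>v v + B *\<^sub>v v)"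
    using add_mult_distrib_mat_vec[OF assms v] by simp
  also have "\<dots> \<le> vnorm (A *\<^sub>v v) + vnorm (B *\<^sub>v v)"
    using assms v by (intro vnorm_add[of _ m]) auto
  also have "\<dots> \<le> op_norm A * vnorm v + op_norm B * vnorm v"
    using assms v by (intro add_mono op_norm_mult_vec) auto
  finally show "vnorm ((A + B) *\<^sub>v v) \<le> (op_norm A + op_norm B) * vnorm v"
    by (simp add: distrib_right)
qed simp

lemma op_norm_mult:
  assumes "A \<in> carrier_mat m n" "B \<in> carrier_mat n k"
  shows "op_norm (A * B) \<le> op_norm A * op_norm B"
proof (rule op_norm_leI)
  fix v :: "complex vec" assume "v \<in> carrier_vec (dim_col (A * B))"
  then have v: "v \<in> carrier_vec k" using assms by simp
  have "vnorm ((A * B) *\<^sub>v v) = vnorm (A *\<^sub>v (B *\<^sub>v v))"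
    using assoc_mult_mat_vec[OF assms v] by simp
  also have "\<dots> \<le> op_norm A * vnorm (B *\<^sub>v v)"
    using assms v by (intro op_norm_mult_vec) auto
  also have "\<dots> \<le> op_norm A * (op_norm B * vnorm v)"
    using assms v by (intro mult_left_mono op_norm_mult_vec) auto
  finally show "vnorm ((A * B) *\<^sub>v v) \<le> (op_norm A * op_norm B) * vnorm v"
    by (simp add: mult.assoc)
qed simp

lemma op_norm_smult_le: "op_norm (c \<cdot>\<^sub>m A) \<le> cmod c * op_norm A"
proof (rule op_norm_leI)
  fix v :: "complex vec" assume v: "v \<in> carrier_vec (dim_col (c \<cdot>\<^sub>m A))"
  then have "(c \<cdot>\<^sub>m A) *\<^sub>v v = c \<cdot>\<^sub>v (A *\<^sub>v v)"
    by (intro eq_vecI) (auto simp: scalar_prod_def sum_distrib_left mult.assoc)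
  then have "vnorm ((c \<cdot>\<^sub>m A) *\<^sub>v v) = cmod c * vnorm (A *\<^sub>v v)" by simp
  also have "\<dots> \<le> cmod c * (op_norm A * vnorm v)"
    using v by (intro mult_left_mono op_norm_mult_vec) auto
  finally show "vnorm ((c \<cdot>\<^sub>m A) *\<^sub>v v) \<le> cmod c * op_norm A * vnorm v"
    by (simp add: mult.assoc)
qed simp

lemma op_norm_zero [simp]: "op_norm (0\<^sub>m m n) = 0"
proof -
  have "op_norm (0\<^sub>m m n) \<le> 0"
  proof (rule op_norm_leI)
    fix v :: "complex vec" assume "v \<in> carrier_vec (dim_col (0\<^sub>m m n :: complex mat))"
    then have "0\<^sub>m m n *\<^sub>v v = 0\<^sub>v m" by (intro eq_vecI) (auto simp: scalar_prod_def)
    then show "vnorm (0\<^sub>m m n *\<^sub>v v) \<le> 0 * vnorm v" by simp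
  qed simp
  then show ?thesis using op_norm_nonneg[of "0\<^sub>m m n"] by simp
qed

lemma op_norm_one_le: "op_norm (1\<^sub>m n) \<le> 1"
  by (rule op_norm_leI) auto

text \<open>A column is the image of a unit vector.\<close>

lemma entry_le_op_norm:
  assumes "A \<in> carrier_mat m n" "i < m" "j < n"
  shows "cmod (A $$ (i, j)) \<le> op_norm A"
proof -
  have "A *\<^sub>v unit_vec n j = col A j"
    using assms by (intro eq_vecI) simp_all
  then have "cmod (A $$ (i, j)) \<le> vnorm (A *\<^sub>v unit_vec n j)"
    using vnorm_comp_le[of i "A *\<^sub>v unit_vec n j"] assms by simp
  also have "\<dots> \<le> op_norm A * vnorm (unit_vec n j :: complex vec)"
    using assms by (intro op_norm_mult_vec) auto
  also have "vnorm (unit_vec n j :: complex vec) = 1"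
  proof -
    have "(vnorm (unit_vec n j :: complex vec))\<^sup>2 = (\<Sum>i<n. (if i = j then 1 else 0))"
      unfolding vnorm_sq by (rule sum.cong) (auto simp: unit_vec_def)
    also have "\<dots> = 1\<^sup>2" using assms by simp
    finally show ?thesis by (rule power2_eq_imp_eq) auto
  qed
  finally show ?thesis by simp
qed

text \<open>A block matrix is naturally indexed by pairs of a block number and a position inside the
  block, hence the arbitrary index sets. Squaring both sides avoids roots; the inequality expresses
  an operator norm bound when \<open>c\<close> is nonnegative.\<close>

definition kernel_bound ::
  "'a set \<Rightarrow> 'b set \<Rightarrow> ('a \<Rightarrow> 'b \<Rightarrow> complex) \<Rightarrow> real \<Rightarrow> bool" where
  "kernel_bound R C K c \<longleftrightarrow>
     (\<forall>v. (\<Sum>i\<in>R. (cmod (\<Sum>j\<in>C. K i j * v j))\<^sup>2) \<le> c\<^sup>2 * (\<Sum>j\<in>C. (cmod (v j))\<^sup>2))"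

lemma op_norm_le_iff_kernel_bound:
  assumes "0 \<le> c"
  shows "op_norm A \<le> c \<longleftrightarrow>
    kernel_bound {..<dim_row A} {..<dim_col A} (\<lambda>i j. A $$ (i, j)) c"
proof -
  have key: "(\<Sum>i<dim_row A. (cmod (\<Sum>j<dim_col A. A $$ (i, j) * w j))\<^sup>2) =
       (vnorm (A *\<^sub>v vec (dim_col A) w))\<^sup>2"
       "(\<Sum>j<dim_col A. (cmod (w j))\<^sup>2) = (vnorm (vec (dim_col A) w))\<^sup>2" for w
    unfolding vnorm_sq by (auto simp: scalar_prod_def atLeast0LessThan intro!: sum.cong)
  show ?thesis
  proof
    assume "op_norm A \<le> c"
    then show "kernel_bound {..<dim_row A} {..<dim_col A} (\<lambda>i j. A $$ (i, j)) c"
      unfolding kernel_bound_def key power_mult_distrib[symmetric]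
      by (auto intro!: power_mono op_norm_mult_vec_le)
  next
    assume L: "kernel_bound {..<dim_row A} {..<dim_col A} (\<lambda>i j. A $$ (i, j)) c"
    show "op_norm A \<le> c"
    proof (rule op_norm_leI[OF _ assms])
      fix v :: "complex vec" assume v: "v \<in> carrier_vec (dim_col A)"
      have eq: "vec (dim_col A) (\<lambda>i. v $ i) = v" using v by (intro eq_vecI) auto
      have "(\<Sum>i<dim_row A. (cmod (\<Sum>j<dim_col A. A $$ (i, j) * v $ j))\<^sup>2) \<le>
          c\<^sup>2 * (\<Sum>j<dim_col A. (cmod (v $ j))\<^sup>2)"
        by (rule L[unfolded kernel_bound_def, rule_format])
      then have "(vnorm (A *\<^sub>v v))\<^sup>2 \<le> (c * vnorm v)\<^sup>2"
        unfolding key[of "\<lambda>i. v $ i"] eq power_mult_distrib .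
      then show "vnorm (A *\<^sub>v v) \<le> c * vnorm v"
        by (rule power2_le_imp_le) (use assms in auto)
    qed
  qed
qed

lemma kernel_bound_cong:
  assumes "\<And>i j. i \<in> R \<Longrightarrow> j \<in> C \<Longrightarrow> K i j = K' i j"
  shows "kernel_bound R C K c \<longleftrightarrow> kernel_bound R C K' c"
  unfolding kernel_bound_def using assms by (simp cong: sum.cong)

text \<open>Renaming rows and columns permutes coordinates and leaves Euclidean norms alone. Every
  shuffle of blocks below goes through this.\<close>

lemma kernel_bound_reindex:
  assumes f: "bij_betw f R' R" and g: "bij_betw g C' C"
  shows "kernel_bound R C K c \<longleftrightarrow> kernel_bound R' C' (\<lambda>i j. K (f i) (g j)) c"
proof
  assume L: "kernel_bound R C K c"
  show "kernel_bound R' C' (\<lambda>i j. K (f i) (g j)) c"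
    unfolding kernel_bound_def
  proof
    fix v :: "_ \<Rightarrow> complex"
    define w where "w = (\<lambda>j. v (the_inv_into C' g j))"
    have w: "w (g j) = v j" if "j \<in> C'" for j
      using that g by (simp add: w_def the_inv_into_f_f bij_betw_def)
    have "(\<Sum>j\<in>C'. K (f i) (g j) * v j) = (\<Sum>j\<in>C. K (f i) j * w j)" for i
      using sum.reindex_bij_betw[OF g, of "\<lambda>j. K (f i) j * w j"] w by (simp cong: sum.cong)
    moreover have "(\<Sum>j\<in>C'. (cmod (v j))\<^sup>2) = (\<Sum>j\<in>C. (cmod (w j))\<^sup>2)"
      using sum.reindex_bij_betw[OF g, of "\<lambda>j. (cmod (w j))\<^sup>2"] w by (simp cong: sum.cong)
    ultimately show "(\<Sum>i\<in>R'. (cmod (\<Sum>j\<in>C'. K (f i) (g j) * v j))\<^sup>2)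
        \<le> c\<^sup>2 * (\<Sum>j\<in>C'. (cmod (v j))\<^sup>2)"
      using L[unfolded kernel_bound_def, rule_format, of w]
        sum.reindex_bij_betw[OF f, of "\<lambda>i. (cmod (\<Sum>j\<in>C. K i j * w j))\<^sup>2"] by simp
  qed
next
  assume L: "kernel_bound R' C' (\<lambda>i j. K (f i) (g j)) c"
  show "kernel_bound R C K c"
    unfolding kernel_bound_def
  proof
    fix v :: "_ \<Rightarrow> complex"
    have 1: "(\<Sum>j\<in>C'. K i (g j) * v (g j)) = (\<Sum>j\<in>C. K i j * v j)" for i
      by (rule sum.reindex_bij_betw[OF g])
    have 2: "(\<Sum>j\<in>C'. (cmod (v (g j)))\<^sup>2) = (\<Sum>j\<in>C. (cmod (v j))\<^sup>2)"
      by (rule sum.reindex_bij_betw[OF g])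
    have 3: "(\<Sum>i\<in>R'. (cmod (\<Sum>j\<in>C. K (f i) j * v j))\<^sup>2) = (\<Sum>i\<in>R. (cmod (\<Sum>j\<in>C. K i j * v j))\<^sup>2)"
      by (rule sum.reindex_bij_betw[OF f])
    show "(\<Sum>i\<in>R. (cmod (\<Sum>j\<in>C. K i j * v j))\<^sup>2) \<le> c\<^sup>2 * (\<Sum>j\<in>C. (cmod (v j))\<^sup>2)"
      using L[unfolded kernel_bound_def, rule_format, of "\<lambda>j. v (g j)"] unfolding 1 2 3 .
  qed
qed

text \<open>Rows in \<open>R1\<close> see only coordinates in \<open>C1\<close>, and likewise for
  the second block, so both sides split into sums of squares. To recover the bound on one block, the
  test vector is extended by zero.\<close>

lemma kernel_bound_block_diag:
  assumes fin: "finite R1" "finite R2" "finite C1" "finite C2"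
    and disj: "R1 \<inter> R2 = {}" "C1 \<inter> C2 = {}"
    and off: "\<And>i j. i \<in> R1 \<Longrightarrow> j \<in> C2 \<Longrightarrow> K i j = 0"
      "\<And>i j. i \<in> R2 \<Longrightarrow> j \<in> C1 \<Longrightarrow> K i j = 0"
  shows "kernel_bound (R1 \<union> R2) (C1 \<union> C2) K c \<longleftrightarrow>
    kernel_bound R1 C1 K c \<and> kernel_bound R2 C2 K c"
proof -
  have s1: "(\<Sum>j\<in>C1 \<union> C2. K i j * v j) = (\<Sum>j\<in>C1. K i j * v j)" if "i \<in> R1" for i v
    using fin disj off that by (subst sum.union_disjoint) (auto intro!: sum.neutral)
  have s2: "(\<Sum>j\<in>C1 \<union> C2. K i j * v j) = (\<Sum>j\<in>C2. K i j * v j)" if "i \<in> R2" for i v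
    using fin disj off that by (subst sum.union_disjoint) (auto intro!: sum.neutral)
  have eqs: "(\<Sum>i\<in>R1 \<union> R2. (cmod (\<Sum>j\<in>C1 \<union> C2. K i j * v j))\<^sup>2) =
      (\<Sum>i\<in>R1. (cmod (\<Sum>j\<in>C1. K i j * v j))\<^sup>2) + (\<Sum>i\<in>R2. (cmod (\<Sum>j\<in>C2. K i j * v j))\<^sup>2)"
    "(\<Sum>j\<in>C1 \<union> C2. (cmod (v j))\<^sup>2) = (\<Sum>j\<in>C1. (cmod (v j))\<^sup>2) + (\<Sum>j\<in>C2. (cmod (v j))\<^sup>2)" for v
    using fin disj s1 s2 by (simp_all add: sum.union_disjoint)
  show ?thesis
  proof safe
    assume L: "kernel_bound (R1 \<union> R2) (C1 \<union> C2) K c"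
    note L' = L[unfolded kernel_bound_def eqs, rule_format]
    show "kernel_bound R1 C1 K c" unfolding kernel_bound_def
    proof
      fix v :: "_ \<Rightarrow> complex"
      define w where "w = (\<lambda>j. if j \<in> C1 then v j else 0)"
      have "(\<Sum>j\<in>C2. (cmod (w j))\<^sup>2) = 0" "(\<Sum>j\<in>C1. (cmod (w j))\<^sup>2) = (\<Sum>j\<in>C1. (cmod (v j))\<^sup>2)"
        "(\<Sum>i\<in>R1. (cmod (\<Sum>j\<in>C1. K i j * w j))\<^sup>2) = (\<Sum>i\<in>R1. (cmod (\<Sum>j\<in>C1. K i j * v j))\<^sup>2)"
        using disj by (auto simp: w_def intro!: sum.neutral)
      then show "(\<Sum>i\<in>R1. (cmod (\<Sum>j\<in>C1. K i j * v j))\<^sup>2) \<le> c\<^sup>2 * (\<Sum>j\<in>C1. (cmod (v j))\<^sup>2)"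
        using L'[of w] sum_nonneg[of R2 "\<lambda>i. (cmod (\<Sum>j\<in>C2. K i j * w j))\<^sup>2"] by simp
    qed
    show "kernel_bound R2 C2 K c" unfolding kernel_bound_def
    proof
      fix v :: "_ \<Rightarrow> complex"
      define w where "w = (\<lambda>j. if j \<in> C2 then v j else 0)"
      have "(\<Sum>j\<in>C1. (cmod (w j))\<^sup>2) = 0" "(\<Sum>j\<in>C2. (cmod (w j))\<^sup>2) = (\<Sum>j\<in>C2. (cmod (v j))\<^sup>2)"
        "(\<Sum>i\<in>R2. (cmod (\<Sum>j\<in>C2. K i j * w j))\<^sup>2) = (\<Sum>i\<in>R2. (cmod (\<Sum>j\<in>C2. K i j * v j))\<^sup>2)"
        using disj by (auto simp: w_def intro!: sum.neutral)
      then show "(\<Sum>i\<in>R2. (cmod (\<Sum>j\<in>C2. K i j * v j))\<^sup>2) \<le> c\<^sup>2 * (\<Sum>j\<in>C2. (cmod (v j))\<^sup>2)"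
        using L'[of w] sum_nonneg[of R1 "\<lambda>i. (cmod (\<Sum>j\<in>C1. K i j * w j))\<^sup>2"] by simp
    qed
  next
    assume "kernel_bound R1 C1 K c" "kernel_bound R2 C2 K c"
    then show "kernel_bound (R1 \<union> R2) (C1 \<union> C2) K c"
      unfolding kernel_bound_def eqs by (simp add: distrib_left add_mono)
  qed
qed

section \<open>Norms of block matrices and of direct sums\<close>

definition block_mat :: "nat \<Rightarrow> nat \<Rightarrow> nat \<Rightarrow> (nat \<Rightarrow> nat \<Rightarrow> complex mat) \<Rightarrow> complex mat" where
  "block_mat r c n B =
     Matrix.mat (r * n) (c * n) (\<lambda>(i, j). B (i div n) (j div n) $$ (i mod n, j mod n))"

lemma block_mat_carrier [simp]: "block_mat r c n B \<in> carrier_mat (r * n) (c * n)"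
  by (simp add: block_mat_def)

lemma mult_add_less: "(i::nat) < r \<Longrightarrow> a < n \<Longrightarrow> i * n + a < r * n"
proof -
  assume "i < r" "a < n"
  then have "i * n + a < Suc i * n" "Suc i * n \<le> r * n"
    by (simp, intro mult_le_mono1, simp)
  then show ?thesis by linarith
qed

lemma bij_betw_block_index:
  assumes "0 < (n::nat)"
  shows "bij_betw (\<lambda>p. fst p * n + snd p) ({..<r} \<times> {..<n}) {..<r * n}"
proof (rule bij_betw_byWitness[where f' = "\<lambda>k. (k div n, k mod n)"])
  show "\<forall>p\<in>{..<r} \<times> {..<n}. ((fst p * n + snd p) div n, (fst p * n + snd p) mod n) = p"
    using assms by auto
  show "\<forall>k\<in>{..<r * n}. fst (k div n, k mod n) * n + snd (k div n, k mod n) = k"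
    by simp
  show "(\<lambda>p. fst p * n + snd p) ` ({..<r} \<times> {..<n}) \<subseteq> {..<r * n}"
    using mult_add_less by auto
  show "(\<lambda>k. (k div n, k mod n)) ` {..<r * n} \<subseteq> {..<r} \<times> {..<n}"
    using assms by (auto simp: less_mult_imp_div_less)
qed

lemma op_norm_block_mat_le_iff:
  assumes "0 < n" "0 \<le> k"
  shows "op_norm (block_mat r c n B) \<le> k \<longleftrightarrow>
    kernel_bound ({..<r} \<times> {..<n}) ({..<c} \<times> {..<n})
      (\<lambda>p q. B (fst p) (fst q) $$ (snd p, snd q)) k"
proof -
  have "op_norm (block_mat r c n B) \<le> k \<longleftrightarrow>
      kernel_bound {..<r * n} {..<c * n} (\<lambda>i j. block_mat r c n B $$ (i, j)) k"
    using op_norm_le_iff_kernel_bound[OF assms(2), of "block_mat r c n B"]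
    by (simp add: block_mat_def)
  also have "\<dots> \<longleftrightarrow> kernel_bound ({..<r} \<times> {..<n}) ({..<c} \<times> {..<n})
      (\<lambda>p q. block_mat r c n B $$ (fst p * n + snd p, fst q * n + snd q)) k"
    by (rule kernel_bound_reindex[OF bij_betw_block_index bij_betw_block_index]) (use assms in auto)
  also have "\<dots> \<longleftrightarrow> kernel_bound ({..<r} \<times> {..<n}) ({..<c} \<times> {..<n})
      (\<lambda>p q. B (fst p) (fst q) $$ (snd p, snd q)) k"
    by (rule kernel_bound_cong) (auto simp: block_mat_def mult_add_less)
  finally show ?thesis .
qed

lemma direct_sum_carrier [simp]:
  "A \<in> carrier_mat n n \<Longrightarrow> B \<in> carrier_mat m m \<Longrightarrow> direct_sum A B \<in> carrier_mat (n + m) (n + m)"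
  by (auto simp: direct_sum_def)

lemma direct_sum_index:
  assumes "A \<in> carrier_mat n n" "B \<in> carrier_mat m m" "i < n + m" "j < n + m"
  shows "direct_sum A B $$ (i, j) =
    (if i < n then if j < n then A $$ (i, j) else 0
     else if j < n then 0 else B $$ (i - n, j - n))"
  using assms by (auto simp: direct_sum_def index_mat_four_block)

text \<open>Splitting the inner index shows that, up to a permutation of rows and columns, the
  matrix of direct sums is the direct sum of the two block matrices. As an equivalence for every
  \<open>k\<close>, this says that its norm is the maximum of the two.\<close>

lemma op_norm_block_mat_direct_sum_le_iff:
  assumes nm: "0 < n" "0 < m" and k: "0 \<le> k"
    and B: "\<And>i j. i < r \<Longrightarrow> j < c \<Longrightarrow> B i j \<in> carrier_mat n n"
    and B': "\<And>i j. i < r \<Longrightarrow> j < c \<Longrightarrow> B' i j \<in> carrier_mat m m"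
  shows "op_norm (block_mat r c (n + m) (\<lambda>i j. direct_sum (B i j) (B' i j))) \<le> k \<longleftrightarrow>
    op_norm (block_mat r c n B) \<le> k \<and> op_norm (block_mat r c m B') \<le> k"
proof -
  let ?K = "\<lambda>p q. direct_sum (B (fst p) (fst q)) (B' (fst p) (fst q)) $$ (snd p, snd q)"
  let ?R1 = "{..<r} \<times> {..<n}" and ?R2 = "{..<r} \<times> {n..<n + m}"
  let ?C1 = "{..<c} \<times> {..<n}" and ?C2 = "{..<c} \<times> {n..<n + m}"
  have un: "{..<r} \<times> {..<n + m} = ?R1 \<union> ?R2" "{..<c} \<times> {..<n + m} = ?C1 \<union> ?C2" by auto
  have bij: "bij_betw (\<lambda>p. (fst p, snd p + n)) ({..<l} \<times> {..<m}) ({..<l} \<times> {n..<n + m})" for l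
    by (rule bij_betw_byWitness[where f' = "\<lambda>p. (fst p, snd p - n)"]) auto
  have "op_norm (block_mat r c (n + m) (\<lambda>i j. direct_sum (B i j) (B' i j))) \<le> k \<longleftrightarrow>
      kernel_bound (?R1 \<union> ?R2) (?C1 \<union> ?C2) ?K k"
    using nm k by (subst op_norm_block_mat_le_iff) (simp_all add: un)
  also have "\<dots> \<longleftrightarrow> kernel_bound ?R1 ?C1 ?K k \<and> kernel_bound ?R2 ?C2 ?K k"
    by (rule kernel_bound_block_diag) (auto simp: direct_sum_index[OF B B'])
  also have "kernel_bound ?R1 ?C1 ?K k \<longleftrightarrow> op_norm (block_mat r c n B) \<le> k"
    unfolding op_norm_block_mat_le_iff[OF nm(1) k]
    by (rule kernel_bound_cong) (auto simp: direct_sum_index[OF B B'])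
  also have "kernel_bound ?R2 ?C2 ?K k \<longleftrightarrow> op_norm (block_mat r c m B') \<le> k"
    unfolding op_norm_block_mat_le_iff[OF nm(2) k] kernel_bound_reindex[OF bij bij]
    by (rule kernel_bound_cong) (auto simp: direct_sum_index[OF B B'])
  finally show ?thesis .
qed

text \<open>Here the outer index is split instead of the inner one. This is what makes an
  intersection of two basic free sets basic.\<close>

lemma op_norm_block_mat_diag_le_iff:
  assumes n: "0 < n" and k: "0 \<le> k"
    and B1: "\<And>i j. i < r1 \<Longrightarrow> j < c1 \<Longrightarrow> B i j = B1 i j"
    and B2: "\<And>i j. i < r2 \<Longrightarrow> j < c2 \<Longrightarrow> B (i + r1) (j + c1) = B2 i j"
    and z1: "\<And>i j. i < r1 \<Longrightarrow> j < c2 \<Longrightarrow> B i (j + c1) = 0\<^sub>m n n"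
    and z2: "\<And>i j. i < r2 \<Longrightarrow> j < c1 \<Longrightarrow> B (i + r1) j = 0\<^sub>m n n"
  shows "op_norm (block_mat (r1 + r2) (c1 + c2) n B) \<le> k \<longleftrightarrow>
    op_norm (block_mat r1 c1 n B1) \<le> k \<and> op_norm (block_mat r2 c2 n B2) \<le> k"
proof -
  let ?K = "\<lambda>p q. B (fst p) (fst q) $$ (snd p, snd q)"
  let ?R1 = "{..<r1} \<times> {..<n}" and ?R2 = "{r1..<r1 + r2} \<times> {..<n}"
  let ?C1 = "{..<c1} \<times> {..<n}" and ?C2 = "{c1..<c1 + c2} \<times> {..<n}"
  have un: "{..<r1 + r2} \<times> {..<n} = ?R1 \<union> ?R2" "{..<c1 + c2} \<times> {..<n} = ?C1 \<union> ?C2" by auto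
  have bij: "bij_betw (\<lambda>p. (fst p + l1, snd p)) ({..<l2} \<times> {..<n}) ({l1..<l1 + l2} \<times> {..<n})"
    for l1 l2 :: nat
    by (rule bij_betw_byWitness[where f' = "\<lambda>p. (fst p - l1, snd p)"]) auto
  have z1': "B i j = 0\<^sub>m n n" if "i < r1" "c1 \<le> j" "j < c1 + c2" for i j
    using z1[of i "j - c1"] that by simp
  have z2': "B i j = 0\<^sub>m n n" if "j < c1" "r1 \<le> i" "i < r1 + r2" for i j
    using z2[of "i - r1" j] that by simp
  have "op_norm (block_mat (r1 + r2) (c1 + c2) n B) \<le> k \<longleftrightarrow>
      kernel_bound (?R1 \<union> ?R2) (?C1 \<union> ?C2) ?K k"
    using n k by (subst op_norm_block_mat_le_iff) (simp_all add: un)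
  also have "\<dots> \<longleftrightarrow> kernel_bound ?R1 ?C1 ?K k \<and> kernel_bound ?R2 ?C2 ?K k"
    by (rule kernel_bound_block_diag) (auto simp: z1' z2')
  also have "kernel_bound ?R1 ?C1 ?K k \<longleftrightarrow> op_norm (block_mat r1 c1 n B1) \<le> k"
    unfolding op_norm_block_mat_le_iff[OF n k]
    by (rule kernel_bound_cong) (auto simp: B1)
  also have "kernel_bound ?R2 ?C2 ?K k \<longleftrightarrow> op_norm (block_mat r2 c2 n B2) \<le> k"
    unfolding op_norm_block_mat_le_iff[OF n k] kernel_bound_reindex[OF bij bij]
    by (rule kernel_bound_cong) (auto simp: B2)
  finally show ?thesis .
qed

lemma L2_set_sum_le:
  "finite J \<Longrightarrow> L2_set (\<lambda>a. \<Sum>j\<in>J. f j a) A \<le> (\<Sum>j\<in>J. L2_set (f j) A)"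
proof (induction J rule: finite_induct)
  case empty
  then show ?case by (simp add: L2_set_def)
next
  case (insert x F)
  then have "L2_set (\<lambda>a. \<Sum>j\<in>insert x F. f j a) A = L2_set (\<lambda>a. f x a + (\<Sum>j\<in>F. f j a)) A"
    by simp
  also have "\<dots> \<le> L2_set (f x) A + L2_set (\<lambda>a. \<Sum>j\<in>F. f j a) A"
    by (rule L2_set_triangle_ineq)
  finally show ?case using insert by simp
qed

text \<open>The bound has one term per block and no factor \<open>n\<close>. Approximating the
  blocks one by one therefore approximates the whole matrix uniformly over all sizes.\<close>

lemma op_norm_block_mat_le_sum:
  assumes n: "0 < n" and B: "\<And>i j. i < r \<Longrightarrow> j < c \<Longrightarrow> B i j \<in> carrier_mat n n"
  shows "op_norm (block_mat r c n B) \<le> (\<Sum>i<r. \<Sum>j<c. op_norm (B i j))"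
proof -
  let ?S = "\<Sum>i<r. \<Sum>j<c. op_norm (B i j)"
  have S: "0 \<le> ?S" by (intro sum_nonneg) auto
  show ?thesis unfolding op_norm_block_mat_le_iff[OF n S] kernel_bound_def
  proof
    fix v :: "nat \<times> nat \<Rightarrow> complex"
    let ?w = "\<lambda>i a. \<Sum>q\<in>{..<c} \<times> {..<n}. B i (fst q) $$ (a, snd q) * v q"
    define N where "N = L2_set (\<lambda>q. cmod (v q)) ({..<c} \<times> {..<n})"
    have N2: "N\<^sup>2 = (\<Sum>q\<in>{..<c} \<times> {..<n}. (cmod (v q))\<^sup>2)"
      by (simp add: N_def L2_set_def sum_nonneg)
    have Nj: "vnorm (vec n (\<lambda>b. v (j, b))) \<le> N" if "j < c" for j
    proof (rule power2_le_imp_le)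
      have "(vnorm (vec n (\<lambda>b. v (j, b))))\<^sup>2 = (\<Sum>q\<in>{j} \<times> {..<n}. (cmod (v q))\<^sup>2)"
        unfolding vnorm_sq by (simp add: sum.cartesian_product')
      also have "\<dots> \<le> N\<^sup>2" unfolding N2 using that by (intro sum_mono2) auto
      finally show "(vnorm (vec n (\<lambda>b. v (j, b))))\<^sup>2 \<le> N\<^sup>2" .
    qed (simp add: N_def L2_set_nonneg)
    have X: "L2_set (\<lambda>a. cmod (?w i a)) {..<n} \<le> (\<Sum>j<c. op_norm (B i j)) * N" if i: "i < r" for i
    proof -
      have "L2_set (\<lambda>a. cmod (?w i a)) {..<n} \<le>
          L2_set (\<lambda>a. \<Sum>j<c. cmod ((B i j *\<^sub>v vec n (\<lambda>b. v (j, b))) $ a)) {..<n}"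
      proof (rule L2_set_mono)
        fix a assume a: "a \<in> {..<n}"
        have "?w i a = (\<Sum>j<c. \<Sum>b<n. B i j $$ (a, b) * v (j, b))"
          by (simp add: sum.cartesian_product')
        also have "\<dots> = (\<Sum>j<c. (B i j *\<^sub>v vec n (\<lambda>b. v (j, b))) $ a)"
        proof (rule sum.cong[OF refl])
          fix j assume "j \<in> {..<c}"
          then have "B i j \<in> carrier_mat n n" using B i by simp
          then show "(\<Sum>b<n. B i j $$ (a, b) * v (j, b)) = (B i j *\<^sub>v vec n (\<lambda>b. v (j, b))) $ a"
            using a by (auto simp: scalar_prod_def atLeast0LessThan intro!: sum.cong)
        qed
        finally show "cmod (?w i a) \<le> (\<Sum>j<c. cmod ((B i j *\<^sub>v vec n (\<lambda>b. v (j, b))) $ a))"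
          by (simp add: norm_sum)
      qed simp
      also have "\<dots> \<le> (\<Sum>j<c. L2_set (\<lambda>a. cmod ((B i j *\<^sub>v vec n (\<lambda>b. v (j, b))) $ a)) {..<n})"
        by (rule L2_set_sum_le) simp
      also have "\<dots> \<le> (\<Sum>j<c. op_norm (B i j) * N)"
      proof (rule sum_mono)
        fix j assume j: "j \<in> {..<c}"
        then have Bc: "B i j \<in> carrier_mat n n" using B i by simp
        then have "L2_set (\<lambda>a. cmod ((B i j *\<^sub>v vec n (\<lambda>b. v (j, b))) $ a)) {..<n} =
            vnorm (B i j *\<^sub>v vec n (\<lambda>b. v (j, b)))" by (simp add: vnorm_def)
        also have "\<dots> \<le> op_norm (B i j) * vnorm (vec n (\<lambda>b. v (j, b)))"
          using Bc by (intro op_norm_mult_vec) auto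
        also have "\<dots> \<le> op_norm (B i j) * N" using Nj j by (intro mult_left_mono) auto
        finally show "L2_set (\<lambda>a. cmod ((B i j *\<^sub>v vec n (\<lambda>b. v (j, b))) $ a)) {..<n} \<le>
            op_norm (B i j) * N" .
      qed
      finally show ?thesis by (simp add: sum_distrib_right)
    qed
    have "(\<Sum>p\<in>{..<r} \<times> {..<n}. (cmod (?w (fst p) (snd p)))\<^sup>2) =
        (L2_set (\<lambda>i. L2_set (\<lambda>a. cmod (?w i a)) {..<n}) {..<r})\<^sup>2"
      by (simp add: L2_set_def sum_nonneg sum.cartesian_product' sum.swap[of _ _ "{..<n}"])
    also have "\<dots> \<le> (\<Sum>i<r. L2_set (\<lambda>a. cmod (?w i a)) {..<n})\<^sup>2"
      by (intro power_mono L2_set_le_sum L2_set_nonneg)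
    also have "\<dots> \<le> (\<Sum>i<r. (\<Sum>j<c. op_norm (B i j)) * N)\<^sup>2"
      using X by (intro power_mono sum_mono sum_nonneg L2_set_nonneg) auto
    also have "\<dots> = ?S\<^sup>2 * N\<^sup>2" by (simp add: sum_distrib_right[symmetric] power_mult_distrib)
    finally show "(\<Sum>p\<in>{..<r} \<times> {..<n}. (cmod (\<Sum>q\<in>{..<c} \<times> {..<n}.
        B (fst p) (fst q) $$ (snd p, snd q) * v q))\<^sup>2) \<le> ?S\<^sup>2 * (\<Sum>q\<in>{..<c} \<times> {..<n}. (cmod (v q))\<^sup>2)"
      unfolding N2 .
  qed
qed

lemma direct_sum_mult:
  assumes "A \<in> carrier_mat n n" "B \<in> carrier_mat n n" "C \<in> carrier_mat m m" "D \<in> carrier_mat m m"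
  shows "direct_sum (A * B) (C * D) = direct_sum A C * direct_sum B D"
  using assms unfolding direct_sum_def
  by (subst mult_four_block_mat[of _ n n _ m _ m]) (auto simp: left_add_zero_mat[of _ n n] left_add_zero_mat[of _ m m])

lemma direct_sum_add:
  assumes "A \<in> carrier_mat n n" "B \<in> carrier_mat n n" "C \<in> carrier_mat m m" "D \<in> carrier_mat m m"
  shows "direct_sum (A + B) (C + D) = direct_sum A C + direct_sum B D"
  using assms by (intro eq_matI)
    (auto simp: direct_sum_index[of _ n _ m] carrier_matD[OF direct_sum_carrier[of _ n _ m]])

lemma direct_sum_smult:
  assumes "A \<in> carrier_mat n n" "C \<in> carrier_mat m m"
  shows "direct_sum (k \<cdot>\<^sub>m A) (k \<cdot>\<^sub>m C) = k \<cdot>\<^sub>m direct_sum A C"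
  using assms by (intro eq_matI)
    (auto simp: direct_sum_index[of _ n _ m] carrier_matD[OF direct_sum_carrier[of _ n _ m]])

lemma direct_sum_one: "direct_sum (1\<^sub>m n) (1\<^sub>m m) = 1\<^sub>m (n + m)"
  by (intro eq_matI)
    (auto simp: direct_sum_index[of _ n _ m] carrier_matD[OF direct_sum_carrier[of _ n _ m]])

lemma direct_sum_zero: "direct_sum (0\<^sub>m n n) (0\<^sub>m m m) = 0\<^sub>m (n + m) (n + m)"
  by (intro eq_matI)
    (auto simp: direct_sum_index[of _ n _ m] carrier_matD[OF direct_sum_carrier[of _ n _ m]])

lemma direct_sum_inject:
  assumes "A \<in> carrier_mat n n" "A' \<in> carrier_mat n n" "B \<in> carrier_mat m m" "B' \<in> carrier_mat m m"
    and eq: "direct_sum A B = direct_sum A' B'"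
  shows "A = A'" "B = B'"
proof -
  have "A $$ (i, j) = A' $$ (i, j)" if "i < n" "j < n" for i j
    using arg_cong[OF eq, of "\<lambda>M. M $$ (i, j)"] assms(1-4) that
    by (simp add: direct_sum_index[of _ n _ m])
  then show "A = A'" using assms by (intro eq_matI) auto
  have "B $$ (i, j) = B' $$ (i, j)" if "i < m" "j < m" for i j
    using arg_cong[OF eq, of "\<lambda>M. M $$ (i + n, j + n)"] assms(1-4) that
    by (simp add: direct_sum_index[of _ n _ m])
  then show "B = B'" using assms by (intro eq_matI) auto
qed

section \<open>Free polynomials\<close>

lemma nc_level_nth: "x \<in> nc_level d n \<Longrightarrow> i < d \<Longrightarrow> x ! i \<in> carrier_mat n n"
  by (simp add: nc_level_def)

lemma nc_level_direct_sum:
  "x \<in> nc_level d n \<Longrightarrow> y \<in> nc_level d m \<Longrightarrow> map2 direct_sum x y \<in> nc_level d (n + m)"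
  by (simp add: nc_level_def)

lemma word_eval_carrier [simp]:
  assumes "x \<in> nc_level d n" "set w \<subseteq> {..<d}"
  shows "word_eval n x w \<in> carrier_mat n n"
  using assms(2)
proof (induction w)
  case (Cons i w)
  then have "x ! i \<in> carrier_mat n n" using assms(1) by (intro nc_level_nth) auto
  with Cons show ?case by (auto simp: word_eval_def)
qed (simp add: word_eval_def)

lemma word_eval_append:
  assumes x: "x \<in> nc_level d n" and "set w \<subseteq> {..<d}" and w': "set w' \<subseteq> {..<d}"
  shows "word_eval n x (w @ w') = word_eval n x w * word_eval n x w'"
  using assms(2)
proof (induction w)
  case Nil
  then show ?case using word_eval_carrier[OF x w'] by (simp add: word_eval_def)
next
  case (Cons i w)
  then have "x ! i \<in> carrier_mat n n" using x by (intro nc_level_nth) auto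
  moreover have "word_eval n x w \<in> carrier_mat n n" using Cons.prems x by (intro word_eval_carrier) auto
  moreover have "word_eval n x (i # v) = x ! i * word_eval n x v" for v by (simp add: word_eval_def)
  ultimately show ?case
    using Cons word_eval_carrier[OF x w'] by (simp add: assoc_mult_mat[of _ n n _ n _ n])
qed

lemma word_eval_direct_sum:
  assumes x: "x \<in> nc_level d n" and y: "y \<in> nc_level d m" and "set w \<subseteq> {..<d}"
  shows "word_eval (n + m) (map2 direct_sum x y) w = direct_sum (word_eval n x w) (word_eval m y w)"
  using assms(3)
proof (induction w)
  case Nil
  then show ?case by (simp add: word_eval_def direct_sum_one)
next
  case (Cons i w)
  then have i: "i < d" and w: "set w \<subseteq> {..<d}" by auto
  have e: "map2 direct_sum x y ! i = direct_sum (x ! i) (y ! i)"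
    using x y i by (simp add: nc_level_def)
  have "word_eval k z (i # w) = z ! i * word_eval k z w" for k z by (simp add: word_eval_def)
  then show ?case
    using Cons.IH[OF w] direct_sum_mult[of "x ! i" n "word_eval n x w" "y ! i" m "word_eval m y w"]
      nc_level_nth[OF x i] nc_level_nth[OF y i] word_eval_carrier[OF x w] word_eval_carrier[OF y w]
    by (simp add: e)
qed

lemma free_poly_eval_carrier [simp]: "free_poly_eval n x p \<in> carrier_mat n n"
  by (simp add: free_poly_eval_def)

lemma free_poly_eval_direct_sum:
  assumes x: "x \<in> nc_level d n" and y: "y \<in> nc_level d m" and p: "p \<in> free_polys d"
  shows "free_poly_eval (n + m) (map2 direct_sum x y) p =
    direct_sum (free_poly_eval n x p) (free_poly_eval m y p)"
proof -
  have eq: "word_eval (n + m) (map2 direct_sum x y) w $$ (i, j) =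
      (if i < n then if j < n then word_eval n x w $$ (i, j) else 0
       else if j < n then 0 else word_eval m y w $$ (i - n, j - n))"
    if "w \<in> Poly_Mapping.keys p" "i < n + m" "j < n + m" for w i j
  proof -
    have w: "set w \<subseteq> {..<d}" using p that by (auto simp: free_polys_def)
    show ?thesis unfolding word_eval_direct_sum[OF x y w]
      by (rule direct_sum_index) (use x y w that in auto)
  qed
  show ?thesis
    by (rule eq_matI)
      (auto simp: direct_sum_index[of _ n _ m] carrier_matD[OF direct_sum_carrier[of _ n _ m]]
        free_poly_eval_def eq)
qed

text \<open>A single polynomial has to serve all levels at once. Working with the functions rather
  than with coefficient families makes sums and products pointwise.\<close>

definition is_free_poly :: "nat \<Rightarrow> (complex mat list \<Rightarrow> complex mat) \<Rightarrow> bool" where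
  "is_free_poly d g \<longleftrightarrow> (\<exists>p\<in>free_polys d. \<forall>n. \<forall>x\<in>nc_level d n. g x = free_poly_eval n x p)"

text \<open>The words \<open>W k\<close> may repeat; coefficients of equal words are then collected.
  So a sum can be indexed by the disjoint union of two supports, and a product by pairs of words
  with concatenation, without watching for cancellation.\<close>

lemma is_free_poly_sumI:
  assumes fin: "finite I" and W: "\<And>k. k \<in> I \<Longrightarrow> set (W k) \<subseteq> {..<d}"
    and g: "\<And>n x. x \<in> nc_level d n \<Longrightarrow>
      g x = Matrix.mat n n (\<lambda>ij. \<Sum>k\<in>I. c k * word_eval n x (W k) $$ ij)"
  shows "is_free_poly d g"
proof -
  define p where "p = (\<Sum>k\<in>I. Poly_Mapping.single (W k) (c k))"
  have lp: "Poly_Mapping.lookup p w = (\<Sum>k\<in>I. if W k = w then c k else 0)" for w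
    by (simp add: p_def lookup_sum lookup_single when_def)
  have keys: "Poly_Mapping.keys p \<subseteq> W ` I"
  proof
    fix w assume "w \<in> Poly_Mapping.keys p"
    then have "(\<Sum>k\<in>I. if W k = w then c k else 0) \<noteq> 0" by (simp add: in_keys_iff lp)
    then obtain k where "k \<in> I" "(if W k = w then c k else 0) \<noteq> 0"
      by (rule sum.not_neutral_contains_not_neutral)
    then show "w \<in> W ` I" by (auto split: if_splits)
  qed
  have sum_eq: "(\<Sum>w\<in>Poly_Mapping.keys p. Poly_Mapping.lookup p w * F w) = (\<Sum>k\<in>I. c k * F (W k))"
    for F :: "nat list \<Rightarrow> complex"
  proof -
    have "(\<Sum>w\<in>Poly_Mapping.keys p. Poly_Mapping.lookup p w * F w) =
        (\<Sum>w\<in>W ` I. Poly_Mapping.lookup p w * F w)"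
      using fin keys by (intro sum.mono_neutral_left) (auto simp: in_keys_iff)
    also have "\<dots> = (\<Sum>w\<in>W ` I. \<Sum>k\<in>I. if W k = w then c k * F w else 0)"
      by (simp add: lp sum_distrib_right if_distrib[of "\<lambda>a. a * _"] cong: if_cong)
    also have "\<dots> = (\<Sum>k\<in>I. \<Sum>w\<in>W ` I. if W k = w then c k * F w else 0)"
      by (rule sum.swap)
    also have "\<dots> = (\<Sum>k\<in>I. c k * F (W k))"
      using fin by (intro sum.cong) auto
    finally show ?thesis .
  qed
  have "p \<in> free_polys d" using keys W by (fastforce simp: free_polys_def)
  moreover have "g x = free_poly_eval n x p" if "x \<in> nc_level d n" for n x
    unfolding g[OF that] free_poly_eval_def sum_eq ..
  ultimately show ?thesis unfolding is_free_poly_def by blast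
qed

text \<open>The size of the identity matrix is read off the first coordinate, so there has to be
  one.\<close>

lemma is_free_poly_const: "0 < d \<Longrightarrow> is_free_poly d (\<lambda>x. c \<cdot>\<^sub>m 1\<^sub>m (dim_row (x ! 0)))"
  by (rule is_free_poly_sumI[of "{()}" "\<lambda>_. []" _ _ "\<lambda>_. c"])
    (auto simp: word_eval_def nc_level_def intro!: eq_matI)

lemma is_free_poly_coord: "i < d \<Longrightarrow> is_free_poly d (\<lambda>x. x ! i)"
proof (rule is_free_poly_sumI[of "{()}" "\<lambda>_. [i]" _ _ "\<lambda>_. 1"])
  fix n x assume "i < d" "x \<in> nc_level d n"
  then have "x ! i \<in> carrier_mat n n" by (simp add: nc_level_nth)
  then show "x ! i = Matrix.mat n n (\<lambda>ij. \<Sum>k\<in>{()}. 1 * word_eval n x [i] $$ ij)"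
    by (intro eq_matI) (auto simp: word_eval_def)
qed auto

lemma is_free_poly_add:
  assumes "is_free_poly d g" "is_free_poly d h"
  shows "is_free_poly d (\<lambda>x. g x + h x)"
proof -
  obtain p q where p: "p \<in> free_polys d" "\<And>n x. x \<in> nc_level d n \<Longrightarrow> g x = free_poly_eval n x p"
    and q: "q \<in> free_polys d" "\<And>n x. x \<in> nc_level d n \<Longrightarrow> h x = free_poly_eval n x q"
    using assms unfolding is_free_poly_def by blast
  show ?thesis
    by (rule is_free_poly_sumI[of "Poly_Mapping.keys p <+> Poly_Mapping.keys q" "case_sum id id" _ _
          "case_sum (Poly_Mapping.lookup p) (Poly_Mapping.lookup q)"])
      (use p q in \<open>auto simp: free_polys_def sum.Plus free_poly_eval_def intro!: eq_matI\<close>)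
qed

lemma is_free_poly_mult:
  assumes "is_free_poly d g" "is_free_poly d h"
  shows "is_free_poly d (\<lambda>x. g x * h x)"
proof -
  obtain p q where p: "p \<in> free_polys d" "\<And>n x. x \<in> nc_level d n \<Longrightarrow> g x = free_poly_eval n x p"
    and q: "q \<in> free_polys d" "\<And>n x. x \<in> nc_level d n \<Longrightarrow> h x = free_poly_eval n x q"
    using assms unfolding is_free_poly_def by blast
  let ?I = "Poly_Mapping.keys p \<times> Poly_Mapping.keys q"
  let ?c = "\<lambda>k. Poly_Mapping.lookup p (fst k) * Poly_Mapping.lookup q (snd k)"
  let ?W = "\<lambda>k. fst k @ snd k"
  show ?thesis
  proof (rule is_free_poly_sumI[of ?I ?W _ _ ?c])
    show "finite ?I" by simp
    show "set (?W k) \<subseteq> {..<d}" if "k \<in> ?I" for k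
      using that p q by (auto simp: free_polys_def)
    fix n x assume x: "x \<in> nc_level d n"
    show "g x * h x = Matrix.mat n n (\<lambda>ij. \<Sum>k\<in>?I. ?c k * word_eval n x (?W k) $$ ij)"
    proof (rule eq_matI)
      fix i j
      assume "i < dim_row (Matrix.mat n n (\<lambda>ij. \<Sum>k\<in>?I. ?c k * word_eval n x (?W k) $$ ij))"
        and "j < dim_col (Matrix.mat n n (\<lambda>ij. \<Sum>k\<in>?I. ?c k * word_eval n x (?W k) $$ ij))"
      then have ij: "i < n" "j < n" by auto
      have w: "word_eval n x (?W k) $$ (i, j) =
          (\<Sum>l<n. word_eval n x (fst k) $$ (i, l) * word_eval n x (snd k) $$ (l, j))" if "k \<in> ?I" for k
      proof -
        have s: "set (fst k) \<subseteq> {..<d}" "set (snd k) \<subseteq> {..<d}"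
          using that p q by (auto simp: free_polys_def)
        note c = word_eval_carrier[OF x s(1)] word_eval_carrier[OF x s(2)]
        show ?thesis unfolding word_eval_append[OF x s] using c ij
          by (auto simp: scalar_prod_def atLeast0LessThan intro!: sum.cong)
      qed
      have "(g x * h x) $$ (i, j) =
          (\<Sum>l<n. free_poly_eval n x p $$ (i, l) * free_poly_eval n x q $$ (l, j))"
        unfolding p(2)[OF x] q(2)[OF x] using ij
        by (auto simp: scalar_prod_def atLeast0LessThan free_poly_eval_def intro!: sum.cong)
      also have "\<dots> = (\<Sum>l<n. \<Sum>k\<in>?I. ?c k *
          (word_eval n x (fst k) $$ (i, l) * word_eval n x (snd k) $$ (l, j)))"
        using ij by (intro sum.cong)
          (auto simp: free_poly_eval_def sum_product sum.cartesian_product' mult_ac)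
      also have "\<dots> = (\<Sum>k\<in>?I. \<Sum>l<n. ?c k *
          (word_eval n x (fst k) $$ (i, l) * word_eval n x (snd k) $$ (l, j)))"
        by (rule sum.swap)
      also have "\<dots> = (\<Sum>k\<in>?I. ?c k * word_eval n x (?W k) $$ (i, j))"
        by (rule sum.cong) (simp_all only: w sum_distrib_left)
      finally show "(g x * h x) $$ (i, j) =
          Matrix.mat n n (\<lambda>ij. \<Sum>k\<in>?I. ?c k * word_eval n x (?W k) $$ ij) $$ (i, j)"
        using ij by simp
    qed (simp_all add: p(2)[OF x] q(2)[OF x] free_poly_eval_def)
  qed
qed

lemma is_free_poly_cong:
  assumes "is_free_poly d g" "\<And>n x. x \<in> nc_level d n \<Longrightarrow> h x = g x"
  shows "is_free_poly d h"
  using assms unfolding is_free_poly_def by metis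

lemma is_free_poly_carrier:
  "is_free_poly d g \<Longrightarrow> x \<in> nc_level d n \<Longrightarrow> g x \<in> carrier_mat n n"
  unfolding is_free_poly_def by (metis free_poly_eval_carrier)

lemma is_free_poly_smult:
  assumes "0 < d" "is_free_poly d g"
  shows "is_free_poly d (\<lambda>x. c \<cdot>\<^sub>m g x)"
proof (rule is_free_poly_cong[OF is_free_poly_mult[OF is_free_poly_const[OF assms(1), of c] assms(2)]])
  fix n x assume x: "x \<in> nc_level d n"
  then have "x ! 0 \<in> carrier_mat n n" "g x \<in> carrier_mat n n"
    using assms is_free_poly_carrier nc_level_nth by blast+
  then show "c \<cdot>\<^sub>m g x = c \<cdot>\<^sub>m 1\<^sub>m (dim_row (x ! 0)) * g x"
    by (simp add: mult_smult_assoc_mat[of _ n n _ n])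
qed

lemma is_free_poly_minus:
  assumes "0 < d" "is_free_poly d g" "is_free_poly d h"
  shows "is_free_poly d (\<lambda>x. g x - h x)"
proof (rule is_free_poly_cong[OF is_free_poly_add[OF assms(2) is_free_poly_smult[OF assms(1,3), of "-1"]]])
  fix n x assume x: "x \<in> nc_level d n"
  then have "h x \<in> carrier_mat n n" "g x \<in> carrier_mat n n"
    using assms is_free_poly_carrier by auto
  then show "g x - h x = g x + -1 \<cdot>\<^sub>m h x" by (intro eq_matI) auto
qed

section \<open>The free and the Zariski-free topology\<close>

lemma opens_of_base_iff:
  "W \<in> opens_of_base \<B> \<longleftrightarrow> (\<forall>x\<in>W. \<exists>B\<in>\<B>. x \<in> B \<and> B \<subseteq> W)"
proof
  assume "W \<in> opens_of_base \<B>"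
  then show "\<forall>x\<in>W. \<exists>B\<in>\<B>. x \<in> B \<and> B \<subseteq> W"
    by (auto simp: opens_of_base_def union_of_def)
next
  assume "\<forall>x\<in>W. \<exists>B\<in>\<B>. x \<in> B \<and> B \<subseteq> W"
  then have "\<Union>{B \<in> \<B>. B \<subseteq> W} = W" by blast
  then show "W \<in> opens_of_base \<B>"
    by (auto simp: opens_of_base_def union_of_def arbitrary_def intro!: exI[of _ "{B \<in> \<B>. B \<subseteq> W}"])
qed

lemma opens_of_baseI: "B \<in> \<B> \<Longrightarrow> B \<in> opens_of_base \<B>"
  unfolding opens_of_base_iff by auto

lemma opens_of_base_Union: "\<K> \<subseteq> opens_of_base \<B> \<Longrightarrow> \<Union>\<K> \<in> opens_of_base \<B>"
  unfolding opens_of_base_iff subset_eq by (metis Union_iff)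

lemma opens_of_base_Int:
  assumes "\<And>A B. A \<in> \<B> \<Longrightarrow> B \<in> \<B> \<Longrightarrow> A \<inter> B \<in> \<B>"
    and "V \<in> opens_of_base \<B>" "W \<in> opens_of_base \<B>"
  shows "V \<inter> W \<in> opens_of_base \<B>"
  unfolding opens_of_base_iff
proof
  fix x assume "x \<in> V \<inter> W"
  then obtain A B where "A \<in> \<B>" "x \<in> A" "A \<subseteq> V" "B \<in> \<B>" "x \<in> B" "B \<subseteq> W"
    using assms(2,3) unfolding opens_of_base_iff by blast
  then show "\<exists>B\<in>\<B>. x \<in> B \<and> B \<subseteq> V \<inter> W"
    using assms(1)[of A B] by (intro bexI[of _ "A \<inter> B"]) auto
qed

section \<open>Levels, nc-functions and the locality of holomorphy\<close>

lemma nc_space_iff: "x \<in> nc_space d \<longleftrightarrow> (\<exists>n\<ge>1. x \<in> nc_level d n)"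
  by (auto simp: nc_space_def)

text \<open>For \<open>d = 0\<close> the empty list would lie on every level.\<close>

lemma nc_level_unique: "0 < d \<Longrightarrow> x \<in> nc_level d n \<Longrightarrow> x \<in> nc_level d m \<Longrightarrow> n = m"
  unfolding nc_level_def by fastforce

lemma nc_set_Int: "nc_set d U \<Longrightarrow> nc_set d V \<Longrightarrow> nc_set d (U \<inter> V)"
  by (auto simp: nc_set_def)

lemma nc_function_subset:
  assumes "nc_function d U f" "nc_set d V" "V \<subseteq> U"
  shows "nc_function d V f"
  using assms unfolding nc_function_def graded_def by (meson IntD1 IntD2 IntI subset_eq)

lemma nc_function_cong:
  assumes "nc_function d U f" "\<And>x. x \<in> U \<Longrightarrow> g x = f x"
  shows "nc_function d U g"
proof -
  have "map2 direct_sum x y \<in> U" if "x \<in> U" "y \<in> U" for x y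
    using assms(1) that by (auto simp: nc_function_def nc_set_def)
  then show ?thesis using assms unfolding nc_function_def graded_def by simp
qed

lemma tau_holomorphic_cong:
  assumes "tau_holomorphic d \<T> D f" "\<And>x. x \<in> D \<Longrightarrow> g x = f x"
  shows "tau_holomorphic d \<T> D g"
  unfolding tau_holomorphic_def
proof (intro conjI ballI)
  show "D \<in> \<T>" "graded d D g"
    using assms by (auto simp: tau_holomorphic_def graded_def)
  fix x assume x: "x \<in> D"
  show "\<exists>U\<in>\<T>. x \<in> U \<and> U \<subseteq> D \<and> nc_function d U g"
    using assms x unfolding tau_holomorphic_def by (meson nc_function_cong subset_eq)
  show "\<exists>U\<in>\<T>. x \<in> U \<and> U \<subseteq> D \<and> (\<exists>M. \<forall>y\<in>U. op_norm (g y) \<le> M)"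
    using assms x unfolding tau_holomorphic_def by (metis subset_eq)
qed

text \<open>The nc-condition is only asked on small neighbourhoods, so holomorphy glues even though
  a union of nc-sets need not be an nc-set.\<close>

lemma tau_holomorphic_Union:
  assumes "\<And>i. i \<in> I \<Longrightarrow> tau_holomorphic d \<T> (D i) f" "(\<Union>i\<in>I. D i) \<in> \<T>"
  shows "tau_holomorphic d \<T> (\<Union>i\<in>I. D i) f"
  unfolding tau_holomorphic_def
proof (intro conjI ballI)
  show "graded d (\<Union>i\<in>I. D i) f"
    using assms(1) unfolding tau_holomorphic_def graded_def by blast
  fix x assume "x \<in> (\<Union>i\<in>I. D i)"
  then obtain i where i: "i \<in> I" "x \<in> D i" by blast
  then show "\<exists>U\<in>\<T>. x \<in> U \<and> U \<subseteq> (\<Union>i\<in>I. D i) \<and> nc_function d U f"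
    "\<exists>U\<in>\<T>. x \<in> U \<and> U \<subseteq> (\<Union>i\<in>I. D i) \<and> (\<exists>M. \<forall>y\<in>U. op_norm (f y) \<le> M)"
    using assms(1)[OF i(1)] unfolding tau_holomorphic_def by (meson SUP_upper2)+
qed (rule assms(2))

section \<open>Nc-maps and pullbacks of holomorphic functions\<close>

definition nc_map ::
    "nat \<Rightarrow> nat \<Rightarrow> complex mat list set \<Rightarrow> (complex mat list \<Rightarrow> complex mat list) \<Rightarrow> bool" where
  "nc_map d e W \<theta> \<longleftrightarrow>
     nc_set d W \<and> (\<forall>n\<ge>1. \<forall>x \<in> W \<inter> nc_level d n. \<theta> x \<in> nc_level e n) \<and>
     (\<forall>x\<in>W. \<forall>y\<in>W. \<theta> (map2 direct_sum x y) = map2 direct_sum (\<theta> x) (\<theta> y)) \<and>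
     (\<forall>n\<ge>1. \<forall>x \<in> W \<inter> nc_level d n. \<forall>s \<in> carrier_mat n n. \<forall>t \<in> carrier_mat n n.
        inverts_mat s t \<longrightarrow> inverts_mat t s \<longrightarrow> map (\<lambda>A. t * A * s) x \<in> W \<longrightarrow>
        \<theta> (map (\<lambda>A. t * A * s) x) = map (\<lambda>A. t * A * s) (\<theta> x))"

lemma nc_map_pair:
  assumes "nc_function d W g" "nc_function d W h"
  shows "nc_map d 2 W (\<lambda>x. [g x, h x])"
  using assms unfolding nc_map_def nc_function_def graded_def
  by (auto simp: nc_level_def less_2_cases_iff)

lemma nc_map_subset:
  assumes "nc_map d e W \<theta>" "nc_set d V" "V \<subseteq> W"
  shows "nc_map d e V \<theta>"
  using assms unfolding nc_map_def by (meson IntD1 IntD2 IntI subset_eq)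

text \<open>The preimage of \<open>U\<close> is again an nc-set because \<open>\<theta>\<close>
  commutes with direct sums.\<close>

lemma nc_function_comp:
  assumes \<theta>: "nc_map d e W \<theta>" and g: "nc_function e U g"
  shows "nc_function d {x \<in> W. \<theta> x \<in> U} (g \<circ> \<theta>)"
proof -
  note \<theta>' = \<theta>[unfolded nc_map_def] and g' = g[unfolded nc_function_def]
  have W: "nc_set d W" and U: "nc_set e U" using \<theta>' g' by blast+
  have "nc_set d {x \<in> W. \<theta> x \<in> U}"
  proof -
    have "map2 direct_sum x y \<in> W" "\<theta> (map2 direct_sum x y) \<in> U"
      if "x \<in> W" "\<theta> x \<in> U" "y \<in> W" "\<theta> y \<in> U" for x y
      using that W U \<theta>' by (simp_all add: nc_set_def)
    moreover have "W \<subseteq> nc_space d" using W by (simp add: nc_set_def)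
    ultimately show ?thesis unfolding nc_set_def by blast
  qed
  moreover have "graded d {x \<in> W. \<theta> x \<in> U} (g \<circ> \<theta>)"
    using \<theta>' g' unfolding graded_def by auto
  moreover have "(g \<circ> \<theta>) (map2 direct_sum x y) = direct_sum ((g \<circ> \<theta>) x) ((g \<circ> \<theta>) y)"
    if "x \<in> {x \<in> W. \<theta> x \<in> U}" "y \<in> {x \<in> W. \<theta> x \<in> U}" for x y
    using that \<theta>' g' by auto
  moreover have "(g \<circ> \<theta>) (map (\<lambda>A. t * A * s) x) = t * (g \<circ> \<theta>) x * s"
    if "1 \<le> n" "x \<in> {x \<in> W. \<theta> x \<in> U} \<inter> nc_level d n" "s \<in> carrier_mat n n" "t \<in> carrier_mat n n"
      "inverts_mat s t" "inverts_mat t s" "map (\<lambda>A. t * A * s) x \<in> {x \<in> W. \<theta> x \<in> U}" for n x s t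
  proof -
    have eq: "\<theta> (map (\<lambda>A. t * A * s) x) = map (\<lambda>A. t * A * s) (\<theta> x)" and l: "\<theta> x \<in> nc_level e n"
      using \<theta>' that by blast+
    then have "g (map (\<lambda>A. t * A * s) (\<theta> x)) = t * g (\<theta> x) * s"
      using that g' by auto
    then show ?thesis using eq by simp
  qed
  ultimately show ?thesis unfolding nc_function_def by blast
qed

text \<open>The two topologies are parameters because the lemma serves twice: for the free topology,
  to pull back the functions that define varieties, and for the Zariski-free topology, in the
  descent.\<close>

lemma tau_holomorphic_pullback:
  assumes \<theta>: "nc_map d e W \<theta>" and cont: "\<And>V. V \<in> \<T>' \<Longrightarrow> {x \<in> W. \<theta> x \<in> V} \<in> \<T>"
    and g: "tau_holomorphic e \<T>' D g"
  shows "tau_holomorphic d \<T> {x \<in> W. \<theta> x \<in> D} (g \<circ> \<theta>)"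
  unfolding tau_holomorphic_def
proof (intro conjI ballI)
  show "{x \<in> W. \<theta> x \<in> D} \<in> \<T>" using cont g by (simp add: tau_holomorphic_def)
  show "graded d {x \<in> W. \<theta> x \<in> D} (g \<circ> \<theta>)"
    using \<theta> g unfolding tau_holomorphic_def graded_def nc_map_def by auto
  fix x assume x: "x \<in> {x \<in> W. \<theta> x \<in> D}"
  then obtain U where "U \<in> \<T>'" "\<theta> x \<in> U" "U \<subseteq> D" "nc_function e U g"
    using g unfolding tau_holomorphic_def by blast
  then show "\<exists>U\<in>\<T>. x \<in> U \<and> U \<subseteq> {x \<in> W. \<theta> x \<in> D} \<and> nc_function d U (g \<circ> \<theta>)"
    using cont nc_function_comp[OF \<theta>] x by (intro bexI[of _ "{x \<in> W. \<theta> x \<in> U}"]) auto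
  obtain U M where "U \<in> \<T>'" "\<theta> x \<in> U" "U \<subseteq> D" "\<forall>y\<in>U. op_norm (g y) \<le> M"
    using g x unfolding tau_holomorphic_def by blast
  then show "\<exists>U\<in>\<T>. x \<in> U \<and> U \<subseteq> {x \<in> W. \<theta> x \<in> D} \<and> (\<exists>M. \<forall>y\<in>U. op_norm ((g \<circ> \<theta>) y) \<le> M)"
    using cont x by (intro bexI[of _ "{x \<in> W. \<theta> x \<in> U}"]) auto
qed

section \<open>Basic sets of the free topology\<close>

lemma free_poly_mat_eval_eq_block_mat:
  "free_poly_mat_eval n x \<delta> =
    block_mat (dim_row \<delta>) (dim_col \<delta>) n (\<lambda>i j. free_poly_eval n x (\<delta> $$ (i, j)))"
  by (simp add: free_poly_mat_eval_def block_mat_def)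

lemma elements_mat_nth:
  "i < dim_row A \<Longrightarrow> j < dim_col A \<Longrightarrow> A $$ (i, j) \<in> elements_mat A"
  unfolding elements_mat_def by force

lemma nc_set_free_basic:
  assumes "elements_mat \<delta> \<subseteq> free_polys d"
  shows "nc_set d (free_basic d \<delta>)"
  unfolding nc_set_def
proof (intro conjI ballI)
  show "free_basic d \<delta> \<subseteq> nc_space d" by (auto simp: free_basic_def nc_space_iff)
  fix x y assume "x \<in> free_basic d \<delta>" "y \<in> free_basic d \<delta>"
  then obtain n m where n: "1 \<le> n" "x \<in> nc_level d n" "op_norm (free_poly_mat_eval n x \<delta>) < 1"
    and m: "1 \<le> m" "y \<in> nc_level d m" "op_norm (free_poly_mat_eval m y \<delta>) < 1"
    by (auto simp: free_basic_def)
  \<comment> \<open>The norm equivalences speak of \<open>\<le>\<close>, the basic sets of a strict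
    inequality; the larger of the two norms, still below 1, bridges the gap.\<close>
  let ?k = "max (op_norm (free_poly_mat_eval n x \<delta>)) (op_norm (free_poly_mat_eval m y \<delta>))"
  let ?B = "\<lambda>n x i j. free_poly_eval n x (\<delta> $$ (i, j))"
  have "free_poly_mat_eval (n + m) (map2 direct_sum x y) \<delta> =
      block_mat (dim_row \<delta>) (dim_col \<delta>) (n + m) (\<lambda>i j. direct_sum (?B n x i j) (?B m y i j))"
  proof -
    have "?B (n + m) (map2 direct_sum x y) i j = direct_sum (?B n x i j) (?B m y i j)"
      if "i < dim_row \<delta>" "j < dim_col \<delta>" for i j
      using n m assms elements_mat_nth[OF that] by (intro free_poly_eval_direct_sum) auto
    then show ?thesis unfolding free_poly_mat_eval_eq_block_mat block_mat_def
      by (intro eq_matI) (auto simp: less_mult_imp_div_less)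
  qed
  moreover have "op_norm (block_mat (dim_row \<delta>) (dim_col \<delta>) (n + m)
      (\<lambda>i j. direct_sum (?B n x i j) (?B m y i j))) \<le> ?k"
    using n m by (subst op_norm_block_mat_direct_sum_le_iff)
      (auto simp: free_poly_mat_eval_eq_block_mat[symmetric] le_max_iff_disj)
  moreover have "?k < 1" using n m by simp
  ultimately have "op_norm (free_poly_mat_eval (n + m) (map2 direct_sum x y) \<delta>) < 1"
    by (metis le_less_trans)
  then show "map2 direct_sum x y \<in> free_basic d \<delta>"
    using n m nc_level_direct_sum[OF n(2) m(2)] unfolding free_basic_def
    by (auto intro!: exI[of _ "n + m"])
qed

lemma zero_in_free_polys [simp]: "0 \<in> free_polys d"
  by (simp add: free_polys_def)

lemma free_poly_eval_zero [simp]: "free_poly_eval n x 0 = 0\<^sub>m n n"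
  by (auto simp: free_poly_eval_def intro!: eq_matI)

text \<open>The block diagonal matrix built from \<open>\<delta>\<close> and
  \<open>\<epsilon>\<close>, whatever their shapes, has as its norm the maximum of the two
  norms.\<close>

lemma free_basic_Int:
  assumes d: "0 < d" and \<delta>: "elements_mat \<delta> \<subseteq> free_polys d" and \<epsilon>: "elements_mat \<epsilon> \<subseteq> free_polys d"
  obtains \<zeta> where "elements_mat \<zeta> \<subseteq> free_polys d"
    "free_basic d \<zeta> = free_basic d \<delta> \<inter> free_basic d \<epsilon>"
proof -
  define \<zeta> where "\<zeta> = four_block_mat \<delta> (0\<^sub>m (dim_row \<delta>) (dim_col \<epsilon>)) (0\<^sub>m (dim_row \<epsilon>) (dim_col \<delta>)) \<epsilon>"
  have dim: "dim_row \<zeta> = dim_row \<delta> + dim_row \<epsilon>" "dim_col \<zeta> = dim_col \<delta> + dim_col \<epsilon>"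
    by (auto simp: \<zeta>_def)
  have idx: "\<zeta> $$ (i, j) = (if i < dim_row \<delta> then if j < dim_col \<delta> then \<delta> $$ (i, j) else 0
      else if j < dim_col \<delta> then 0 else \<epsilon> $$ (i - dim_row \<delta>, j - dim_col \<delta>))"
    if "i < dim_row \<zeta>" "j < dim_col \<zeta>" for i j
    using that dim unfolding \<zeta>_def by (auto simp: index_mat_four_block)
  have "elements_mat \<zeta> \<subseteq> free_polys d"
  proof
    fix p assume "p \<in> elements_mat \<zeta>"
    then obtain i j where ij: "i < dim_row \<zeta>" "j < dim_col \<zeta>" "p = \<zeta> $$ (i, j)"
      by (auto simp: elements_mat_def)
    show "p \<in> free_polys d"
      using ij dim \<delta> \<epsilon> elements_mat_nth[of i \<delta> j]
        elements_mat_nth[of "i - dim_row \<delta>" \<epsilon> "j - dim_col \<delta>"]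
      unfolding ij(3) idx[OF ij(1,2)] by auto
  qed
  moreover have lvl: "op_norm (free_poly_mat_eval n x \<zeta>) < 1 \<longleftrightarrow>
      op_norm (free_poly_mat_eval n x \<delta>) < 1 \<and> op_norm (free_poly_mat_eval n x \<epsilon>) < 1"
    if n: "1 \<le> n" for n x
  proof -
    have le: "op_norm (free_poly_mat_eval n x \<zeta>) \<le> k \<longleftrightarrow>
      op_norm (free_poly_mat_eval n x \<delta>) \<le> k \<and> op_norm (free_poly_mat_eval n x \<epsilon>) \<le> k"
      if "0 \<le> k" for k
      unfolding free_poly_mat_eval_eq_block_mat dim
      by (rule op_norm_block_mat_diag_le_iff) (use n that dim in \<open>auto simp: idx\<close>)
    show ?thesis
    proof
      assume "op_norm (free_poly_mat_eval n x \<zeta>) < 1"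
      then show "op_norm (free_poly_mat_eval n x \<delta>) < 1 \<and> op_norm (free_poly_mat_eval n x \<epsilon>) < 1"
        using le[of "op_norm (free_poly_mat_eval n x \<zeta>)"] by auto
    next
      let ?k = "max (op_norm (free_poly_mat_eval n x \<delta>)) (op_norm (free_poly_mat_eval n x \<epsilon>))"
      assume "op_norm (free_poly_mat_eval n x \<delta>) < 1 \<and> op_norm (free_poly_mat_eval n x \<epsilon>) < 1"
      then have "?k < 1" by simp
      moreover have "op_norm (free_poly_mat_eval n x \<zeta>) \<le> ?k"
        using le[of ?k] by (simp add: le_max_iff_disj)
      ultimately show "op_norm (free_poly_mat_eval n x \<zeta>) < 1" by linarith
    qed
  qed
  have "free_basic d \<zeta> = free_basic d \<delta> \<inter> free_basic d \<epsilon>"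
  proof (intro equalityI subsetI)
    fix x assume "x \<in> free_basic d \<zeta>"
    then show "x \<in> free_basic d \<delta> \<inter> free_basic d \<epsilon>"
      using lvl unfolding free_basic_def by blast
  next
    fix x assume "x \<in> free_basic d \<delta> \<inter> free_basic d \<epsilon>"
    then obtain n m where "1 \<le> n" "x \<in> nc_level d n" "op_norm (free_poly_mat_eval n x \<delta>) < 1"
      "x \<in> nc_level d m" "op_norm (free_poly_mat_eval m x \<epsilon>) < 1"
      unfolding free_basic_def by blast
    moreover from this have "m = n" using nc_level_unique[OF d] by blast
    ultimately show "x \<in> free_basic d \<zeta>"
      using lvl unfolding free_basic_def by blast
  qed
  ultimately show thesis using that by blast
qed

lemma free_opens_Int:
  assumes "0 < d" "V \<in> free_opens d" "W \<in> free_opens d"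
  shows "V \<inter> W \<in> free_opens d"
  using assms(2,3) unfolding free_opens_def
proof (rule opens_of_base_Int[rotated])
  fix A B assume "A \<in> {free_basic d \<delta> |\<delta>. elements_mat \<delta> \<subseteq> free_polys d}"
    "B \<in> {free_basic d \<delta> |\<delta>. elements_mat \<delta> \<subseteq> free_polys d}"
  then show "A \<inter> B \<in> {free_basic d \<delta> |\<delta>. elements_mat \<delta> \<subseteq> free_polys d}"
    using free_basic_Int[OF assms(1)] by (clarsimp) metis
qed

lemma free_opens_iff:
  "W \<in> free_opens d \<longleftrightarrow>
    (\<forall>x\<in>W. \<exists>\<delta>. elements_mat \<delta> \<subseteq> free_polys d \<and> x \<in> free_basic d \<delta> \<and> free_basic d \<delta> \<subseteq> W)"
  unfolding free_opens_def opens_of_base_iff by (rule ball_cong[OF refl]) auto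

lemma free_basic_open: "elements_mat \<delta> \<subseteq> free_polys d \<Longrightarrow> free_basic d \<delta> \<in> free_opens d"
  unfolding free_opens_iff by blast

lemma free_opensE:
  assumes "W \<in> free_opens d" "x \<in> W"
  obtains \<delta> where "elements_mat \<delta> \<subseteq> free_polys d" "x \<in> free_basic d \<delta>" "free_basic d \<delta> \<subseteq> W"
  using free_opens_iff[of W d] assms by meson

lemma free_opens_subset_nc_space:
  assumes "W \<in> free_opens d"
  shows "W \<subseteq> nc_space d"
proof
  fix x assume "x \<in> W"
  then obtain \<delta> where "x \<in> free_basic d \<delta>" using free_opensE[OF assms] by metis
  then show "x \<in> nc_space d" unfolding free_basic_def nc_space_iff by blast
qed

lemma free_opens_localI:
  assumes "\<And>x. x \<in> W \<Longrightarrow> \<exists>V\<in>free_opens d. x \<in> V \<and> V \<subseteq> W"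
  shows "W \<in> free_opens d"
  unfolding free_opens_iff
proof
  fix x assume "x \<in> W"
  then obtain V where V: "V \<in> free_opens d" "x \<in> V" "V \<subseteq> W" using assms by blast
  then obtain \<delta> where "elements_mat \<delta> \<subseteq> free_polys d" "x \<in> free_basic d \<delta>" "free_basic d \<delta> \<subseteq> V"
    using free_opensE by metis
  then show "\<exists>\<delta>. elements_mat \<delta> \<subseteq> free_polys d \<and> x \<in> free_basic d \<delta> \<and> free_basic d \<delta> \<subseteq> W"
    using V(3) by blast
qed

text \<open>A freely open set need not be closed under direct sums, so intersecting with
  \<open>D'\<close> may destroy the nc-condition. Shrinking to a basic set inside \<open>D'\<close>
  keeps it.\<close>

lemma tau_holomorphic_free_Int:
  assumes d: "0 < d" and g: "tau_holomorphic d (free_opens d) D g" and D': "D' \<in> free_opens d"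
  shows "tau_holomorphic d (free_opens d) (D \<inter> D') g"
  unfolding tau_holomorphic_def
proof (intro conjI ballI)
  show "D \<inter> D' \<in> free_opens d"
    using g D' free_opens_Int[OF d] by (simp add: tau_holomorphic_def)
  show "graded d (D \<inter> D') g" using g by (auto simp: tau_holomorphic_def graded_def)
  fix x assume x: "x \<in> D \<inter> D'"
  obtain \<delta> where \<delta>: "elements_mat \<delta> \<subseteq> free_polys d" "x \<in> free_basic d \<delta>" "free_basic d \<delta> \<subseteq> D'"
    using free_opensE[OF D', of x] x by blast
  obtain U where U: "U \<in> free_opens d" "x \<in> U" "U \<subseteq> D" "nc_function d U g"
    using g x unfolding tau_holomorphic_def by blast
  have "nc_function d (U \<inter> free_basic d \<delta>) g"
    by (rule nc_function_subset[OF U(4)])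
      (use U(4) nc_set_free_basic[OF \<delta>(1)] in \<open>auto simp: nc_function_def intro: nc_set_Int\<close>)
  then show "\<exists>U\<in>free_opens d. x \<in> U \<and> U \<subseteq> D \<inter> D' \<and> nc_function d U g"
    using U \<delta> free_opens_Int[OF d U(1) free_basic_open[OF \<delta>(1)]]
    by (intro bexI[of _ "U \<inter> free_basic d \<delta>"]) auto
  obtain U M where U: "U \<in> free_opens d" "x \<in> U" "U \<subseteq> D" "\<forall>y\<in>U. op_norm (g y) \<le> M"
    using g x unfolding tau_holomorphic_def by blast
  then show "\<exists>U\<in>free_opens d. x \<in> U \<and> U \<subseteq> D \<inter> D' \<and> (\<exists>M. \<forall>y\<in>U. op_norm (g y) \<le> M)"
    using x free_opens_Int[OF d U(1) D'] by (intro bexI[of _ "U \<inter> D'"]) auto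
qed

section \<open>Varieties and the Zariski-free topology\<close>

abbreviation zero_set :: "complex mat list set \<Rightarrow> (complex mat list \<Rightarrow> complex mat) set \<Rightarrow> complex mat list set"
  where "zero_set D E \<equiv> {x \<in> D. \<forall>g\<in>E. g x = 0\<^sub>m (dim_row (g x)) (dim_col (g x))}"

lemma free_varieties_Int:
  assumes "0 < d" "T \<in> free_varieties d D" "D' \<in> free_opens d"
  shows "T \<inter> D' \<in> free_varieties d (D \<inter> D')"
proof -
  obtain E where E: "T = zero_set D E" "\<forall>g\<in>E. tau_holomorphic d (free_opens d) D g"
    using assms(2) unfolding free_varieties_def by blast
  have "T \<inter> D' = zero_set (D \<inter> D') E" unfolding E(1) by blast
  moreover have "\<forall>g\<in>E. tau_holomorphic d (free_opens d) (D \<inter> D') g"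
    using E(2) tau_holomorphic_free_Int[OF assms(1) _ assms(3)] by blast
  ultimately show ?thesis unfolding free_varieties_def by blast
qed

abbreviation zariski_base :: "nat \<Rightarrow> complex mat list set set" where
  "zariski_base d \<equiv> {D - \<Union>\<V> | D \<V>. D \<in> free_opens d \<and> finite \<V> \<and> \<V> \<subseteq> free_varieties d D}"

lemma zariski_baseI:
  "D \<in> free_opens d \<Longrightarrow> finite \<V> \<Longrightarrow> \<V> \<subseteq> free_varieties d D \<Longrightarrow> D - \<Union>\<V> \<in> zariski_base d"
  by (rule CollectI) (intro exI conjI; simp)

lemma zariski_base_open: "B \<in> zariski_base d \<Longrightarrow> B \<in> zariski_free_opens d"
  unfolding zariski_free_opens_def by (rule opens_of_baseI)

lemma free_opens_imp_zariski: "W \<in> free_opens d \<Longrightarrow> W \<in> zariski_free_opens d"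
  using zariski_base_open[OF zariski_baseI[of W d "{}"]] by simp

text \<open>Both finite families of varieties are first restricted to the common domain
  \<open>D1 \<inter> D2\<close>, where they can be joined.\<close>

lemma zariski_free_opens_Int:
  assumes d: "0 < d" and "V \<in> zariski_free_opens d" "W \<in> zariski_free_opens d"
  shows "V \<inter> W \<in> zariski_free_opens d"
  using assms(2,3) unfolding zariski_free_opens_def
proof (rule opens_of_base_Int[rotated])
  fix A B assume "A \<in> zariski_base d" "B \<in> zariski_base d"
  then obtain D1 V1 D2 V2 where
    1: "A = D1 - \<Union>V1" "D1 \<in> free_opens d" "finite V1" "V1 \<subseteq> free_varieties d D1" and
    2: "B = D2 - \<Union>V2" "D2 \<in> free_opens d" "finite V2" "V2 \<subseteq> free_varieties d D2"
    by auto
  let ?V = "(\<lambda>T. T \<inter> D2) ` V1 \<union> (\<lambda>T. T \<inter> D1) ` V2"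
  have "A \<inter> B = (D1 \<inter> D2) - \<Union>?V" using 1 2 by blast
  moreover have "?V \<subseteq> free_varieties d (D1 \<inter> D2)"
    using 1 2 free_varieties_Int[OF d, of _ D1 D2] free_varieties_Int[OF d, of _ D2 D1]
    by (auto simp: Int_commute[of D2 D1])
  moreover have "finite ?V" "D1 \<inter> D2 \<in> free_opens d"
    using 1 2 free_opens_Int[OF d] by auto
  ultimately show "A \<inter> B \<in> zariski_base d" using zariski_baseI[of "D1 \<inter> D2" d ?V] by simp
qed

lemma zariski_free_opens_Union: "\<K> \<subseteq> zariski_free_opens d \<Longrightarrow> \<Union>\<K> \<in> zariski_free_opens d"
  unfolding zariski_free_opens_def by (rule opens_of_base_Union)

text \<open>Composition with \<open>\<theta>\<close> turns the functions that cut out a variety into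
  freely holomorphic functions that cut out its preimage. Hence continuity has to be checked for the
  free topologies only.\<close>

lemma zariski_free_opens_pullback:
  assumes \<theta>: "nc_map d e W \<theta>" and cont: "\<And>V. V \<in> free_opens e \<Longrightarrow> {x \<in> W. \<theta> x \<in> V} \<in> free_opens d"
    and V: "V \<in> zariski_free_opens e"
  shows "{x \<in> W. \<theta> x \<in> V} \<in> zariski_free_opens d"
proof -
  have base: "{x \<in> W. \<theta> x \<in> B} \<in> zariski_free_opens d" if "B \<in> zariski_base e" for B
  proof -
    obtain D \<V> where B: "B = D - \<Union>\<V>" "D \<in> free_opens e" "finite \<V>" "\<V> \<subseteq> free_varieties e D"
      using \<open>B \<in> zariski_base e\<close> by auto
    let ?P = "\<lambda>T. {x \<in> W. \<theta> x \<in> T}"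
    have "?P T \<in> free_varieties d (?P D)" if T: "T \<in> \<V>" for T
    proof -
      obtain E where E: "T = zero_set D E" "\<forall>g\<in>E. tau_holomorphic e (free_opens e) D g"
        using subsetD[OF B(4) T] unfolding free_varieties_def by blast
      have "?P T = zero_set (?P D) ((\<lambda>g. g \<circ> \<theta>) ` E)" unfolding E(1) by auto
      moreover have "\<forall>g\<in>(\<lambda>g. g \<circ> \<theta>) ` E. tau_holomorphic d (free_opens d) (?P D) g"
        using E(2) tau_holomorphic_pullback[OF \<theta> cont] by blast
      ultimately show ?thesis unfolding free_varieties_def by blast
    qed
    then have sub: "?P ` \<V> \<subseteq> free_varieties d (?P D)" by blast
    have eq: "?P B = ?P D - \<Union>(?P ` \<V>)" using B(1) by blast
    have "?P D \<in> free_opens d" "finite (?P ` \<V>)" using B cont by auto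
    then show ?thesis
      unfolding eq by (intro zariski_base_open zariski_baseI sub)
  qed
  define \<K> where "\<K> = {B \<in> zariski_base e. B \<subseteq> V}"
  have "V \<subseteq> \<Union>\<K>"
  proof
    fix x assume "x \<in> V"
    with V show "x \<in> \<Union>\<K>"
      unfolding zariski_free_opens_def opens_of_base_iff \<K>_def by (metis (mono_tags, lifting) UnionI mem_Collect_eq)
  qed
  moreover have "\<Union>\<K> \<subseteq> V" by (auto simp: \<K>_def)
  ultimately have "{x \<in> W. \<theta> x \<in> V} = \<Union>((\<lambda>B. {x \<in> W. \<theta> x \<in> B}) ` \<K>)" by auto
  also have "\<dots> \<in> zariski_free_opens d"
  proof (rule zariski_free_opens_Union, rule image_subsetI)
    fix B assume "B \<in> \<K>"
    then have "B \<in> zariski_base e" using \<K>_def by blast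
    then show "{x \<in> W. \<theta> x \<in> B} \<in> zariski_free_opens d" by (rule base)
  qed
  finally show ?thesis .
qed

section \<open>Open sets cut out by norm inequalities\<close>

lemma op_norm_smult: "op_norm (c \<cdot>\<^sub>m A) = cmod c * op_norm A"
proof (cases "c = 0")
  case True
  then have "c \<cdot>\<^sub>m A = 0\<^sub>m (dim_row A) (dim_col A)" by (intro eq_matI) auto
  then show ?thesis using True by simp
next
  case False
  then have "(1 / c) \<cdot>\<^sub>m (c \<cdot>\<^sub>m A) = A" by (intro eq_matI) auto
  then have "op_norm A \<le> cmod (1 / c) * op_norm (c \<cdot>\<^sub>m A)"
    using op_norm_smult_le[of "1 / c" "c \<cdot>\<^sub>m A"] by simp
  then have "cmod c * op_norm A \<le> op_norm (c \<cdot>\<^sub>m A)"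
    using False by (simp add: norm_divide field_simps)
  then show ?thesis using op_norm_smult_le[of c A] by simp
qed

lemma block_mat_cong:
  "(\<And>i j. i < r \<Longrightarrow> j < c \<Longrightarrow> B i j = B' i j) \<Longrightarrow> block_mat r c n B = block_mat r c n B'"
  unfolding block_mat_def by (intro eq_matI) (auto simp: less_mult_imp_div_less)

lemma block_mat_smult:
  assumes "\<And>i j. i < r \<Longrightarrow> j < c \<Longrightarrow> B i j \<in> carrier_mat n n"
  shows "block_mat r c n (\<lambda>i j. k \<cdot>\<^sub>m B i j) = k \<cdot>\<^sub>m block_mat r c n B"
proof (rule eq_matI)
  fix i j assume "i < dim_row (k \<cdot>\<^sub>m block_mat r c n B)" "j < dim_col (k \<cdot>\<^sub>m block_mat r c n B)"
  then have ij: "i < r * n" "j < c * n" by (auto simp: block_mat_def)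
  then have n: "0 < n" by (cases n) auto
  have "B (i div n) (j div n) \<in> carrier_mat n n"
    using ij by (intro assms) (auto simp: less_mult_imp_div_less)
  then show "block_mat r c n (\<lambda>i j. k \<cdot>\<^sub>m B i j) $$ (i, j) = (k \<cdot>\<^sub>m block_mat r c n B) $$ (i, j)"
    using ij n by (auto simp: block_mat_def)
qed (auto simp: block_mat_def)

text \<open>Dividing the polynomials by \<open>k\<close> turns the bound \<open>k\<close> into the
  bound 1 of a basic set.\<close>

lemma free_open_block_norm_less:
  assumes d: "0 < d" and G: "\<And>i j. i < r \<Longrightarrow> j < c \<Longrightarrow> is_free_poly d (G i j)" and k: "0 < k"
  shows "{x. \<exists>n\<ge>1. x \<in> nc_level d n \<and> op_norm (block_mat r c n (\<lambda>i j. G i j x)) < k} \<in> free_opens d"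
proof -
  have "\<exists>p. p \<in> free_polys d \<and>
      (\<forall>n. \<forall>x\<in>nc_level d n. complex_of_real (1 / k) \<cdot>\<^sub>m G i j x = free_poly_eval n x p)"
    if "i < r" "j < c" for i j
    using is_free_poly_smult[OF d G[OF that]] unfolding is_free_poly_def by blast
  then obtain P where P: "\<And>i j. i < r \<Longrightarrow> j < c \<Longrightarrow> P i j \<in> free_polys d"
    "\<And>i j n x. i < r \<Longrightarrow> j < c \<Longrightarrow> x \<in> nc_level d n \<Longrightarrow>
      complex_of_real (1 / k) \<cdot>\<^sub>m G i j x = free_poly_eval n x (P i j)"
    by metis
  define \<delta> where "\<delta> = Matrix.mat r c (\<lambda>(i, j). P i j)"
  have \<delta>: "elements_mat \<delta> \<subseteq> free_polys d"
    using P(1) by (auto simp: \<delta>_def elements_mat_def)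
  have "op_norm (free_poly_mat_eval n x \<delta>) < 1 \<longleftrightarrow> op_norm (block_mat r c n (\<lambda>i j. G i j x)) < k"
    if x: "x \<in> nc_level d n" for n x
  proof -
    have "free_poly_mat_eval n x \<delta> = block_mat r c n (\<lambda>i j. complex_of_real (1 / k) \<cdot>\<^sub>m G i j x)"
    proof -
      have dim: "dim_row \<delta> = r" "dim_col \<delta> = c" by (simp_all add: \<delta>_def)
      show ?thesis unfolding free_poly_mat_eval_eq_block_mat dim
        by (rule block_mat_cong) (simp add: \<delta>_def P(2)[OF _ _ x, symmetric])
    qed
    also have "\<dots> = complex_of_real (1 / k) \<cdot>\<^sub>m block_mat r c n (\<lambda>i j. G i j x)"
      by (rule block_mat_smult) (use G is_free_poly_carrier x in blast)
    finally show ?thesis using k by (simp add: op_norm_smult norm_divide field_simps)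
  qed
  then have "{x. \<exists>n\<ge>1. x \<in> nc_level d n \<and> op_norm (block_mat r c n (\<lambda>i j. G i j x)) < k} = free_basic d \<delta>"
    unfolding free_basic_def by blast
  then show ?thesis using free_basic_open[OF \<delta>] by simp
qed

lemma free_open_norm_less:
  assumes d: "0 < d" and g: "is_free_poly d g" and k: "0 < k"
  shows "{x \<in> nc_space d. op_norm (g x) < k} \<in> free_opens d"
proof -
  have "block_mat 1 1 n (\<lambda>i j. g x) = g x" if "x \<in> nc_level d n" for n x
    using is_free_poly_carrier[OF g that] by (intro eq_matI) (auto simp: block_mat_def)
  then have "{x \<in> nc_space d. op_norm (g x) < k} =
      {x. \<exists>n\<ge>1. x \<in> nc_level d n \<and> op_norm (block_mat 1 1 n (\<lambda>i j. g x)) < k}"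
    unfolding nc_space_iff by auto
  then show ?thesis using free_open_block_norm_less[OF d, of 1 1 "\<lambda>i j. g" k] g k by simp
qed

section \<open>Polynomials in a matrix\<close>

lemmas square_mat_simps = mult_carrier_mat[of _ n n _ n] left_mult_one_mat[of _ n n]
  right_mult_one_mat[of _ n n] mult_smult_distrib[of _ n n _ n] mult_smult_assoc_mat[of _ n n _ n] for n

text \<open>Horner's scheme, mirroring the definition of \<open>poly\<close>, so that proofs can go
  by induction over \<open>pCons\<close>.\<close>

definition poly_mat :: "complex poly \<Rightarrow> complex mat \<Rightarrow> complex mat" where
  "poly_mat p A = fold_coeffs (\<lambda>a B. a \<cdot>\<^sub>m 1\<^sub>m (dim_row A) + A * B) p (0\<^sub>m (dim_row A) (dim_row A))"

lemma poly_mat_0: "A \<in> carrier_mat n n \<Longrightarrow> poly_mat 0 A = 0\<^sub>m n n"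
  by (simp add: poly_mat_def)

lemma poly_mat_pCons:
  assumes A: "A \<in> carrier_mat n n"
  shows "poly_mat (pCons a p) A = a \<cdot>\<^sub>m 1\<^sub>m n + A * poly_mat p A"
\<comment> \<open>Only here does \<open>fold_coeffs\<close> perform no step, because
  \<open>pCons 0 0\<close> is the zero polynomial.\<close>
proof (cases "a = 0 \<and> p = 0")
  case True
  have "0 \<cdot>\<^sub>m 1\<^sub>m n + A * 0\<^sub>m n n = 0\<^sub>m n n" using A by (intro eq_matI) auto
  then show ?thesis using True A by (simp add: poly_mat_0)
next
  case False
  then show ?thesis using A by (auto simp: poly_mat_def)
qed

lemma poly_mat_dim [simp]:
  "dim_row (poly_mat p A) = dim_row A" "dim_col (poly_mat p A) = dim_row A"
proof (induction p rule: pCons_induct)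
  case (pCons a p)
  {
    case 1
    then show ?case using pCons by (cases "p = 0") (auto simp: poly_mat_def)
  next
    case 2
    then show ?case using pCons by (cases "p = 0") (auto simp: poly_mat_def)
  }
qed (simp_all add: poly_mat_def)

lemma poly_mat_carrier [simp]: "A \<in> carrier_mat n n \<Longrightarrow> poly_mat p A \<in> carrier_mat n n"
  by (rule carrier_matI) auto

lemma poly_mat_1: "A \<in> carrier_mat n n \<Longrightarrow> poly_mat 1 A = 1\<^sub>m n"
  unfolding one_pCons by (simp add: poly_mat_pCons poly_mat_0) (intro eq_matI; simp)

lemma poly_mat_const: "A \<in> carrier_mat n n \<Longrightarrow> poly_mat [:a:] A = a \<cdot>\<^sub>m 1\<^sub>m n"
  by (simp add: poly_mat_pCons poly_mat_0)

lemma poly_mat_X: "A \<in> carrier_mat n n \<Longrightarrow> poly_mat [:0, 1:] A = A"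
  by (simp add: poly_mat_pCons poly_mat_0) (intro eq_matI; auto)

lemma poly_mat_add:
  assumes A: "A \<in> carrier_mat n n"
  shows "poly_mat (p + q) A = poly_mat p A + poly_mat q A"
proof (induction p q rule: poly_induct2)
  case 0
  then show ?case using A by (simp add: poly_mat_0)
next
  case (pCons a p b q)
  have c: "poly_mat p A \<in> carrier_mat n n" "poly_mat q A \<in> carrier_mat n n" using A by auto
  have "A * (poly_mat p A + poly_mat q A) = A * poly_mat p A + A * poly_mat q A"
    using A by (intro mult_add_distrib_mat[of _ n n _ n]) auto
  then have "poly_mat (pCons a p + pCons b q) A =
      (a + b) \<cdot>\<^sub>m 1\<^sub>m n + (A * poly_mat p A + A * poly_mat q A)"
    using pCons A by (simp add: poly_mat_pCons)
  also have "\<dots> = (a \<cdot>\<^sub>m 1\<^sub>m n + A * poly_mat p A) + (b \<cdot>\<^sub>m 1\<^sub>m n + A * poly_mat q A)"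
    using A by (intro eq_matI) (simp_all add: algebra_simps)
  finally show ?case using A by (simp add: poly_mat_pCons)
qed

lemma poly_mat_smult:
  assumes A: "A \<in> carrier_mat n n"
  shows "poly_mat (Polynomial.smult c p) A = c \<cdot>\<^sub>m poly_mat p A"
proof (induction p rule: pCons_induct)
  case 0
  then show ?case using A by (simp add: poly_mat_0)
next
  case (pCons a p)
  have c: "poly_mat p A \<in> carrier_mat n n" using A by auto
  have "A * (c \<cdot>\<^sub>m poly_mat p A) = c \<cdot>\<^sub>m (A * poly_mat p A)"
    using A by (intro mult_smult_distrib[of _ n n _ n]) auto
  then have "poly_mat (Polynomial.smult c (pCons a p)) A = (c * a) \<cdot>\<^sub>m 1\<^sub>m n + c \<cdot>\<^sub>m (A * poly_mat p A)"
    using pCons A by (simp add: poly_mat_pCons)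
  also have "\<dots> = c \<cdot>\<^sub>m (a \<cdot>\<^sub>m 1\<^sub>m n + A * poly_mat p A)"
    using A by (intro eq_matI) (simp_all add: algebra_simps)
  finally show ?case using A by (simp add: poly_mat_pCons)
qed

lemma poly_mat_diff:
  assumes A: "A \<in> carrier_mat n n"
  shows "poly_mat (p - q) A = poly_mat p A - poly_mat q A"
proof -
  have c: "poly_mat p A \<in> carrier_mat n n" "poly_mat q A \<in> carrier_mat n n" using A by auto
  have "p - q = p + Polynomial.smult (-1) q" by simp
  then have "poly_mat (p - q) A = poly_mat p A + (-1) \<cdot>\<^sub>m poly_mat q A"
    using A by (simp only: poly_mat_add poly_mat_smult)
  also have "\<dots> = poly_mat p A - poly_mat q A" using c by (intro eq_matI) auto
  finally show ?thesis .
qed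

lemma poly_mat_mult:
  assumes A: "A \<in> carrier_mat n n"
  shows "poly_mat (p * q) A = poly_mat p A * poly_mat q A"
proof (induction p rule: pCons_induct)
  case 0
  then show ?case using A left_mult_zero_mat[OF poly_mat_carrier[OF A, of q], of n] by (simp add: poly_mat_0)
next
  case (pCons a p)
  let ?P = "poly_mat p A" and ?Q = "poly_mat q A"
  have c: "?P \<in> carrier_mat n n" "?Q \<in> carrier_mat n n" using A by auto
  have "poly_mat (pCons a p * q) A = a \<cdot>\<^sub>m ?Q + (0 \<cdot>\<^sub>m 1\<^sub>m n + A * (?P * ?Q))"
    using A pCons by (simp add: poly_mat_add poly_mat_smult poly_mat_pCons)
  also have "0 \<cdot>\<^sub>m 1\<^sub>m n + A * (?P * ?Q) = A * (?P * ?Q)" using A by (intro eq_matI) auto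
  also have "\<dots> = A * ?P * ?Q" using A by (simp add: assoc_mult_mat[of _ n n _ n _ n] square_mat_simps[where n = n])
  also have "a \<cdot>\<^sub>m ?Q = a \<cdot>\<^sub>m 1\<^sub>m n * ?Q" using c by (simp add: square_mat_simps[where n = n])
  also have "a \<cdot>\<^sub>m 1\<^sub>m n * ?Q + A * ?P * ?Q = (a \<cdot>\<^sub>m 1\<^sub>m n + A * ?P) * ?Q"
    using A c by (intro add_mult_distrib_mat[symmetric]) auto
  finally show ?case using A by (simp add: poly_mat_pCons)
qed

lemma poly_mat_commute:
  assumes A: "A \<in> carrier_mat n n"
  shows "poly_mat p A * poly_mat q A = poly_mat q A * poly_mat p A"
  using poly_mat_mult[OF A, of p q] poly_mat_mult[OF A, of q p] by (simp add: mult.commute)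

lemma poly_mat_eigenvector:
  assumes A: "A \<in> carrier_mat n n" and v: "v \<in> carrier_vec n" "A *\<^sub>v v = k \<cdot>\<^sub>v v"
  shows "poly_mat p A *\<^sub>v v = poly p k \<cdot>\<^sub>v v"
proof (induction p rule: pCons_induct)
  case 0
  show ?case using A v by (simp add: poly_mat_0) (intro eq_vecI; auto simp: scalar_prod_def)
next
  case (pCons a p)
  have c: "poly_mat p A \<in> carrier_mat n n" using A by auto
  have "poly_mat (pCons a p) A *\<^sub>v v = (a \<cdot>\<^sub>m 1\<^sub>m n) *\<^sub>v v + (A * poly_mat p A) *\<^sub>v v"
    using A c v by (simp add: poly_mat_pCons add_mult_distrib_mat_vec[of _ n n])
  also have "(a \<cdot>\<^sub>m 1\<^sub>m n) *\<^sub>v v = a \<cdot>\<^sub>v v" using v by (intro eq_vecI) auto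
  also have "(A * poly_mat p A) *\<^sub>v v = A *\<^sub>v (poly p k \<cdot>\<^sub>v v)" using A v pCons by (simp add: assoc_mult_mat_vec[of _ n n _ n])
  also have "\<dots> = poly p k \<cdot>\<^sub>v (k \<cdot>\<^sub>v v)" using A v by (simp add: mult_mat_vec)
  also have "a \<cdot>\<^sub>v v + poly p k \<cdot>\<^sub>v (k \<cdot>\<^sub>v v) = poly (pCons a p) k \<cdot>\<^sub>v v"
    using v by (intro eq_vecI) (auto simp: algebra_simps)
  finally show ?case .
qed

lemma poly_mat_similar:
  assumes A: "A \<in> carrier_mat n n" and st: "s \<in> carrier_mat n n" "t \<in> carrier_mat n n"
    "s * t = 1\<^sub>m n" "t * s = 1\<^sub>m n"
  shows "poly_mat p (t * A * s) = t * poly_mat p A * s"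
proof (induction p rule: pCons_induct)
  case 0
  have "t * A * s \<in> carrier_mat n n" using A st by auto
  then show ?case using A st by (simp add: poly_mat_0)
next
  case (pCons a p)
  let ?P = "poly_mat p A"
  have c: "t * A * s \<in> carrier_mat n n" "?P \<in> carrier_mat n n" using A st by auto
  have "t * A * s * (t * ?P * s) = t * A * (s * t) * ?P * s"
    using A st(1,2) c(2) by (simp add: assoc_mult_mat[of _ n n _ n _ n] square_mat_simps[where n = n])
  also have "\<dots> = t * (A * ?P) * s"
    using A st c(2) by (simp add: assoc_mult_mat[of _ n n _ n _ n] square_mat_simps[where n = n])
  finally have 1: "t * A * s * (t * ?P * s) = t * (A * ?P) * s" .
  have "t * (a \<cdot>\<^sub>m 1\<^sub>m n + A * ?P) * s = (t * (a \<cdot>\<^sub>m 1\<^sub>m n) + t * (A * ?P)) * s"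
    using A st c(2) by (subst mult_add_distrib_mat[of _ n n _ n]) auto
  also have "\<dots> = t * (a \<cdot>\<^sub>m 1\<^sub>m n) * s + t * (A * ?P) * s"
    using A st c(2) by (subst add_mult_distrib_mat[of _ n n _ _ n]) auto
  also have "t * (a \<cdot>\<^sub>m 1\<^sub>m n) * s = a \<cdot>\<^sub>m 1\<^sub>m n"
    using st by (simp add: square_mat_simps[where n = n])
  finally show ?case using pCons 1 A c by (simp add: poly_mat_pCons)
qed

lemma poly_mat_direct_sum:
  assumes A: "A \<in> carrier_mat n n" and B: "B \<in> carrier_mat m m"
  shows "poly_mat p (direct_sum A B) = direct_sum (poly_mat p A) (poly_mat p B)"
proof (induction p rule: pCons_induct)
  case 0
  then show ?case using A B by (simp add: poly_mat_0[OF direct_sum_carrier[OF A B]] poly_mat_0 direct_sum_zero)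
next
  case (pCons a p)
  have c: "poly_mat p A \<in> carrier_mat n n" "poly_mat p B \<in> carrier_mat m m" using A B by auto
  show ?case using pCons A B c
    by (simp add: poly_mat_pCons[OF direct_sum_carrier[OF A B]] poly_mat_pCons
        direct_sum_add[of _ n _ _ m] direct_sum_smult[of _ n _ m] direct_sum_mult[of _ n _ _ m] direct_sum_one)
qed

lemma is_free_poly_poly_mat:
  assumes "i < d"
  shows "is_free_poly d (\<lambda>x. poly_mat p (x ! i))"
proof (induction p rule: pCons_induct)
  case 0
  show ?case
  proof (rule is_free_poly_cong[OF is_free_poly_const])
    fix n x assume "x \<in> nc_level d n"
    then have "x ! i \<in> carrier_mat n n" "x ! 0 \<in> carrier_mat n n" using assms nc_level_nth by auto
    then show "poly_mat 0 (x ! i) = 0 \<cdot>\<^sub>m 1\<^sub>m (dim_row (x ! 0))"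
      by (simp add: poly_mat_0) (intro eq_matI; auto)
  qed (use assms in simp)
next
  case (pCons a p)
  show ?case
  proof (rule is_free_poly_cong[OF is_free_poly_add[OF is_free_poly_const
          is_free_poly_mult[OF is_free_poly_coord[OF assms] pCons(2)]]])
    fix n x assume "x \<in> nc_level d n"
    then have "x ! i \<in> carrier_mat n n" "x ! 0 \<in> carrier_mat n n" using assms nc_level_nth by auto
    then show "poly_mat (pCons a p) (x ! i) = a \<cdot>\<^sub>m 1\<^sub>m (dim_row (x ! 0)) + x ! i * poly_mat p (x ! i)"
      by (simp add: poly_mat_pCons)
  qed (use assms in simp)
qed

text \<open>A list of roots, not a set, because multiplicities matter: a matrix that is not
  diagonalisable is annihilated only by polynomials with repeated factors.\<close>

definition root_prod :: "complex list \<Rightarrow> complex poly" where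
  "root_prod L = (\<Prod>a\<leftarrow>L. [:- a, 1:])"

lemma root_prod_simps [simp]:
  "root_prod [] = 1" "root_prod (a # L) = [:- a, 1:] * root_prod L"
  "root_prod (L @ L') = root_prod L * root_prod L'"
  by (simp_all add: root_prod_def del: mult_pCons_left)

lemma poly_root_prod_eq_0_iff: "poly (root_prod L) z = 0 \<longleftrightarrow> z \<in> set L"
  by (induction L) (auto simp del: mult_pCons_left)

section \<open>Spectrum, resolvent and annihilating polynomials\<close>

lemma spectrum_iff:
  assumes "A \<in> carrier_mat n n"
  shows "k \<in> spectrum A \<longleftrightarrow> (\<exists>v\<in>carrier_vec n. v \<noteq> 0\<^sub>v n \<and> A *\<^sub>v v = k \<cdot>\<^sub>v v)"
  using assms by (auto simp: spectrum_def eigenvalue_def eigenvector_def)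

lemma root_of_annihilating:
  assumes A: "A \<in> carrier_mat n n" and p: "poly_mat p A = 0\<^sub>m n n" and k: "k \<in> spectrum A"
  shows "poly p k = 0"
proof (rule ccontr)
  assume "poly p k \<noteq> 0"
  obtain v where v: "v \<in> carrier_vec n" "v \<noteq> 0\<^sub>v n" "A *\<^sub>v v = k \<cdot>\<^sub>v v"
    using k spectrum_iff[OF A] by blast
  have "poly p k \<cdot>\<^sub>v v = 0\<^sub>m n n *\<^sub>v v"
    using poly_mat_eigenvector[OF A v(1,3), of p] p by simp
  also have "\<dots> = 0\<^sub>v n" using v by (intro eq_vecI) (auto simp: scalar_prod_def)
  finally have "cmod (poly p k) * vnorm v = 0" using vnorm_smult[of "poly p k" v] by simp
  then show False using \<open>poly p k \<noteq> 0\<close> v vnorm_eq_0_iff by auto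
qed

abbreviation pencil :: "complex mat \<Rightarrow> complex \<Rightarrow> complex mat" where
  "pencil A z \<equiv> z \<cdot>\<^sub>m 1\<^sub>m (dim_row A) - A"

lemma pencil_mult_vec:
  assumes "A \<in> carrier_mat n n" "v \<in> carrier_vec n"
  shows "pencil A z *\<^sub>v v = z \<cdot>\<^sub>v v - A *\<^sub>v v"
proof -
  have "pencil A z *\<^sub>v v = (z \<cdot>\<^sub>m 1\<^sub>m n) *\<^sub>v v - A *\<^sub>v v"
    using assms by (simp add: minus_mult_distrib_mat_vec[of _ n n])
  also have "(z \<cdot>\<^sub>m 1\<^sub>m n) *\<^sub>v v = z \<cdot>\<^sub>v v" using assms by (intro eq_vecI) auto
  finally show ?thesis .
qed

text \<open>Off the spectrum the pencil has trivial kernel, hence nonzero determinant, so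
  \<open>mat_inverse\<close> returns a value and \<open>the\<close> in \<open>resolvent\<close> is
  harmless.\<close>

lemma resolvent_inverse:
  assumes A: "A \<in> carrier_mat n n" and z: "z \<notin> spectrum A"
  shows "resolvent A z \<in> carrier_mat n n" "pencil A z * resolvent A z = 1\<^sub>m n"
    "resolvent A z * pencil A z = 1\<^sub>m n"
proof -
  have c: "pencil A z \<in> carrier_mat n n" using A by auto
  have "det (pencil A z) \<noteq> 0"
  proof
    assume "det (pencil A z) = 0"
    then obtain v where v: "v \<in> carrier_vec n" "v \<noteq> 0\<^sub>v n" "pencil A z *\<^sub>v v = 0\<^sub>v n"
      using det_0_iff_vec_prod_zero[OF c] by auto
    have "A *\<^sub>v v = z \<cdot>\<^sub>v v"
    proof (rule eq_vecI)
      fix i assume "i < dim_vec (z \<cdot>\<^sub>v v)"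
      then have i: "i < n" using v by auto
      have "(z \<cdot>\<^sub>v v - A *\<^sub>v v) $ i = 0"
        using v(3) i unfolding pencil_mult_vec[OF A v(1)] by simp
      then show "(A *\<^sub>v v) $ i = (z \<cdot>\<^sub>v v) $ i" using A v i by auto
    qed (use A v in auto)
    then show False using z v spectrum_iff[OF A] by blast
  qed
  then have "pencil A z \<in> Units (ring_mat TYPE(complex) n ())" by (rule det_non_zero_imp_unit[OF c])
  then obtain B where B: "mat_inverse (pencil A z) = Some B"
    using mat_inverse(1)[OF c, where b = "()"] by (cases "mat_inverse (pencil A z)") auto
  have "resolvent A z = B" by (simp add: resolvent_def B)
  then show "resolvent A z \<in> carrier_mat n n" "pencil A z * resolvent A z = 1\<^sub>m n"
    "resolvent A z * pencil A z = 1\<^sub>m n"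
    using mat_inverse(2)[OF c B] by auto
qed

lemma poly_mat_sum_index:
  assumes A: "A \<in> carrier_mat n n" and "finite J" "i < n" "j < n"
  shows "poly_mat (\<Sum>k\<in>J. q k) A $$ (i, j) = (\<Sum>k\<in>J. poly_mat (q k) A $$ (i, j))"
  using assms(2)
proof (induction J rule: finite_induct)
  case empty
  then show ?case using assms by (simp add: poly_mat_0)
next
  case (insert k J)
  show ?case using insert assms by (simp add: poly_mat_add)
qed

text \<open>The \<open>n\<^sup>2 + 1\<close> powers \<open>1, A, \<dots>\<close> are linearly dependent.\<close>

lemma annihilating_poly_exists:
  assumes A: "A \<in> carrier_mat n n"
  shows "\<exists>p. p \<noteq> 0 \<and> poly_mat p A = 0\<^sub>m n n"
proof -
  define N where "N = n * n"
  define c where "c = (\<lambda>k. vec (Suc N) (\<lambda>j. poly_mat (monom 1 j) A $$ (k div n, k mod n)))"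
  \<comment> \<open>There are \<open>N\<close> equations, one per entry, for \<open>Suc N\<close>
    coefficients. A zero row makes the system square and its determinant zero.\<close>
  define M where "M = mat\<^sub>r (Suc N) (Suc N) (\<lambda>i. if i = N then 0\<^sub>v (Suc N) else c i)"
  have M: "M \<in> carrier_mat (Suc N) (Suc N)" by (simp add: M_def)
  have "det M = 0" unfolding M_def by (rule det_row_0) (auto simp: c_def)
  then obtain v where v: "v \<in> carrier_vec (Suc N)" "v \<noteq> 0\<^sub>v (Suc N)" "M *\<^sub>v v = 0\<^sub>v (Suc N)"
    using det_0_iff_vec_prod_zero[OF M] by auto
  define p where "p = (\<Sum>j<Suc N. Polynomial.smult (v $ j) (monom 1 j))"
  have coeff: "coeff p j = v $ j" if "j < Suc N" for j
  proof -
    have "coeff p j = (\<Sum>i<Suc N. if i = j then v $ i else 0)"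
      unfolding p_def coeff_sum by (rule sum.cong) auto
    then show ?thesis using that by simp
  qed
  have "p \<noteq> 0"
  proof
    assume "p = 0"
    then have "v = 0\<^sub>v (Suc N)" using v(1) coeff by (intro eq_vecI) auto
    with v show False by simp
  qed
  moreover have "poly_mat p A = 0\<^sub>m n n"
  proof (rule eq_matI)
    fix i j assume "i < dim_row (0\<^sub>m n n :: complex mat)" "j < dim_col (0\<^sub>m n n :: complex mat)"
    then have ij: "i < n" "j < n" by auto
    define k where "k = i * n + j"
    have k: "k < N" "k div n = i" "k mod n = j"
      using ij mult_add_less[of i n j n] by (auto simp: k_def N_def)
    have "poly_mat p A $$ (i, j) = (\<Sum>l<Suc N. v $ l * poly_mat (monom 1 l) A $$ (i, j))"
    proof -
      have "poly_mat (Polynomial.smult c q) A $$ (i, j) = c * poly_mat q A $$ (i, j)" for c q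
        using A ij carrier_matD[OF poly_mat_carrier[OF A, of q]] by (simp add: poly_mat_smult)
      then show ?thesis unfolding p_def using poly_mat_sum_index[OF A _ ij, of "{..<Suc N}"]
        by (simp del: sum.lessThan_Suc)
    qed
    also have "\<dots> = (\<Sum>l<Suc N. c k $ l * v $ l)"
      by (rule sum.cong) (auto simp: c_def k)
    also have "\<dots> = (M *\<^sub>v v) $ k"
      using k v(1) by (simp add: M_def scalar_prod_def atLeast0LessThan)
    also have "\<dots> = 0" using v k by simp
    finally show "poly_mat p A $$ (i, j) = 0\<^sub>m n n $$ (i, j)" using ij by simp
  qed (use A carrier_matD[OF poly_mat_carrier[OF A, of p]] in auto)
  ultimately show ?thesis by blast
qed

text \<open>A linear factor whose root is not an eigenvalue is invertible at \<open>A\<close> and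
  can be cancelled from any annihilating polynomial; conversely every eigenvalue is a root.\<close>

lemma annihilating_root_prod:
  assumes A: "A \<in> carrier_mat n n"
  obtains L where "set L = spectrum A" "poly_mat (root_prod L) A = 0\<^sub>m n n"
proof -
  obtain p where p: "p \<noteq> 0" "poly_mat p A = 0\<^sub>m n n" using annihilating_poly_exists[OF A] by blast
  obtain L where L: "Polynomial.smult (lead_coeff p) (root_prod L) = p"
    using fundamental_theorem_algebra_factorized[of p] unfolding root_prod_def by blast
  have "poly_mat (root_prod L) A = 0\<^sub>m n n"
  proof -
    have "root_prod L = Polynomial.smult (1 / lead_coeff p) p" using p(1) by (subst (3) L[symmetric]) simp
    then show ?thesis using A p(2) by (simp add: poly_mat_smult)
  qed
  \<comment> \<open>The matrix \<open>M\<close> collects the factors that are kept: moving them to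
    the right by commutation lets the induction reach the factors behind them.\<close>
  have strip: "poly_mat (root_prod (filter (\<lambda>a. a \<in> spectrum A) L)) A * M = 0\<^sub>m n n"
    if "M \<in> carrier_mat n n" "poly_mat (root_prod L) A * M = 0\<^sub>m n n" for M L
    using that
  proof (induction L arbitrary: M)
    case Nil
    then show ?case by simp
  next
    case (Cons a L)
    let ?X = "poly_mat [:- a, 1:] A" and ?P = "\<lambda>L. poly_mat (root_prod L) A"
    have c: "?X \<in> carrier_mat n n" "\<And>L. ?P L \<in> carrier_mat n n" using A by auto
    have X: "?X = (-1) \<cdot>\<^sub>m pencil A a"
      using A by (simp add: poly_mat_pCons poly_mat_0) (intro eq_matI; auto)
    show ?case
    proof (cases "a \<in> spectrum A")
      case True
      have swap: "?P (a # K) * M = ?P K * (?X * M)" for K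
        using poly_mat_mult[OF A, of "[:- a, 1:]" "root_prod K"]
          poly_mat_commute[OF A, of "[:- a, 1:]" "root_prod K"] c Cons.prems(1)
        by (simp add: assoc_mult_mat[of _ n n _ n _ n] square_mat_simps[where n = n] del: mult_pCons_left)
      have "?P L * (?X * M) = 0\<^sub>m n n" using Cons.prems(2) swap[of L] by simp
      then have "?P (filter (\<lambda>a. a \<in> spectrum A) L) * (?X * M) = 0\<^sub>m n n"
        by (rule Cons.IH[OF mult_carrier_mat[OF c(1) Cons.prems(1)]])
      then show ?thesis using True swap by simp
    next
      case False
      let ?R = "resolvent A a"
      note R = resolvent_inverse[OF A False]
      have pen: "pencil A a \<in> carrier_mat n n" using A by auto
      have RX: "?R * ?X = (-1) \<cdot>\<^sub>m 1\<^sub>m n"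
        unfolding X using R pen by (simp add: square_mat_simps[where n = n])
      have LM: "?P L * M \<in> carrier_mat n n" by (rule mult_carrier_mat[OF c(2) Cons.prems(1)])
      have "?X * (?P L * M) = 0\<^sub>m n n"
        using Cons.prems c poly_mat_mult[OF A, of "[:- a, 1:]" "root_prod L"]
        by (simp add: assoc_mult_mat[of _ n n _ n _ n] square_mat_simps[where n = n] del: mult_pCons_left)
      then have "?R * (?X * (?P L * M)) = 0\<^sub>m n n" using R(1) by simp
      moreover have "?R * (?X * (?P L * M)) = (-1) \<cdot>\<^sub>m (?P L * M)"
        using R(1) c LM RX
        by (simp add: assoc_mult_mat[of _ n n _ n _ n, symmetric] square_mat_simps[where n = n]
            del: assoc_mult_mat)
      ultimately have "(-1) \<cdot>\<^sub>m ((-1) \<cdot>\<^sub>m (?P L * M)) = (-1) \<cdot>\<^sub>m (0\<^sub>m n n)" by simp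
      moreover have "(-1) \<cdot>\<^sub>m ((-1) \<cdot>\<^sub>m N) = N" for N :: "complex mat" by (intro eq_matI) auto
      moreover have "(-1) \<cdot>\<^sub>m (0\<^sub>m n n) = (0\<^sub>m n n :: complex mat)" by (intro eq_matI) auto
      ultimately have "?P L * M = 0\<^sub>m n n" by metis
      then show ?thesis using Cons False by simp
    qed
  qed
  define L' where "L' = filter (\<lambda>a. a \<in> spectrum A) L"
  have "poly_mat (root_prod L') A * 1\<^sub>m n = 0\<^sub>m n n"
    unfolding L'_def using \<open>poly_mat (root_prod L) A = 0\<^sub>m n n\<close> by (intro strip) auto
  then have "poly_mat (root_prod L') A = 0\<^sub>m n n" using A by simp
  moreover have "set L' = spectrum A"
  proof
    show "spectrum A \<subseteq> set L'"
      using root_of_annihilating[OF A \<open>poly_mat (root_prod L') A = 0\<^sub>m n n\<close>]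
      by (auto simp: poly_root_prod_eq_0_iff)
  qed (auto simp: L'_def)
  ultimately show thesis using that by blast
qed

text \<open>When \<open>p\<close> becomes \<open>a + z p\<close>, the quotient \<open>Q(z)\<close>
  becomes \<open>p(A) + z Q(z)\<close>. Its entries are polynomials in \<open>z\<close>, so they
  contribute no residues later.\<close>

lemma pencil_divides:
  assumes A: "A \<in> carrier_mat n n"
  shows "\<exists>q. \<forall>z. pencil A z * Matrix.mat n n (\<lambda>(i, j). poly (q i j) z) =
    poly p z \<cdot>\<^sub>m 1\<^sub>m n - poly_mat p A"
proof (induction p rule: pCons_induct)
  case 0
  have "pencil A z * Matrix.mat n n (\<lambda>(i, j). poly 0 z) = poly 0 z \<cdot>\<^sub>m 1\<^sub>m n - poly_mat 0 A" for z
    using A by (intro eq_matI) (auto simp: poly_mat_0 scalar_prod_def)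
  then show ?case by (intro exI[of _ "\<lambda>i j. 0"] allI)
next
  case (pCons a p)
  then obtain q where q: "\<And>z. pencil A z * Matrix.mat n n (\<lambda>(i, j). poly (q i j) z) =
      poly p z \<cdot>\<^sub>m 1\<^sub>m n - poly_mat p A" by blast
  let ?P = "poly_mat p A"
  define q' where "q' = (\<lambda>i j. pCons (?P $$ (i, j)) (q i j))"
  have P: "?P \<in> carrier_mat n n" using A by auto
  have "pencil A z * Matrix.mat n n (\<lambda>(i, j). poly (q' i j) z) =
      poly (pCons a p) z \<cdot>\<^sub>m 1\<^sub>m n - poly_mat (pCons a p) A" for z
  proof -
    let ?Q = "Matrix.mat n n (\<lambda>(i, j). poly (q i j) z)"
    have pen: "pencil A z \<in> carrier_mat n n" using A by auto
    have "Matrix.mat n n (\<lambda>(i, j). poly (q' i j) z) = ?P + z \<cdot>\<^sub>m ?Q"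
      using P by (intro eq_matI) (auto simp: q'_def)
    then have "pencil A z * Matrix.mat n n (\<lambda>(i, j). poly (q' i j) z) =
        pencil A z * ?P + z \<cdot>\<^sub>m (pencil A z * ?Q)"
      using pen P by (simp add: mult_add_distrib_mat[of _ n n _ n] square_mat_simps[where n = n])
    also have "pencil A z * ?P = z \<cdot>\<^sub>m ?P - A * ?P"
    proof -
      have "pencil A z * ?P = (z \<cdot>\<^sub>m 1\<^sub>m n) * ?P - A * ?P"
        using A P by (simp add: minus_mult_distrib_mat[of _ n n _ _ n])
      then show ?thesis using P by (simp add: square_mat_simps[where n = n])
    qed
    also have "z \<cdot>\<^sub>m ?P - A * ?P + z \<cdot>\<^sub>m (pencil A z * ?Q) =
        poly (pCons a p) z \<cdot>\<^sub>m 1\<^sub>m n - (a \<cdot>\<^sub>m 1\<^sub>m n + A * ?P)"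
      unfolding q using P A by (intro eq_matI) (auto simp: algebra_simps)
    finally show ?thesis using A by (simp add: poly_mat_pCons)
  qed
  then show ?case by blast
qed

section \<open>The holomorphic functional calculus\<close>

text \<open>All residues in \<open>K\<close> are collected by one circle; its length
  \<open>2 * pi * \<rho>\<close>, divided by \<open>2 * pi\<close>, leaves the factor
  \<open>\<rho>\<close>. The ball of radius \<open>\<rho>'\<close> supplies an open neighbourhood of
  the closed disc.\<close>

lemma residue_sum_circle_bound:
  assumes \<rho>: "0 < \<rho>" "\<rho> < \<rho>'" and K: "finite K" "K \<subseteq> ball c \<rho>"
    and F: "F holomorphic_on ball c \<rho>' - K"
    and B: "0 \<le> B" "\<And>z. cmod (z - c) = \<rho> \<Longrightarrow> cmod (F z) \<le> B"
  shows "cmod (\<Sum>\<mu>\<in>K. residue F \<mu>) \<le> B * \<rho>"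
proof -
  have sph: "path_image (circlepath c \<rho>) \<subseteq> ball c \<rho>' - K"
    using \<rho> K(2) by (auto simp: dist_norm norm_minus_commute)
  have "continuous_on (path_image (circlepath c \<rho>)) F"
    using F sph by (meson continuous_on_subset holomorphic_on_imp_continuous_on)
  then have "(F has_contour_integral contour_integral (circlepath c \<rho>) F) (circlepath c \<rho>)"
    by (intro has_contour_integral_integral contour_integrable_continuous_circlepath)
  moreover have "contour_integral (circlepath c \<rho>) F =
      2 * pi * \<i> * (\<Sum>\<mu>\<in>K. winding_number (circlepath c \<rho>) \<mu> * residue F \<mu>)"
  proof (rule Residue_theorem[of "ball c \<rho>'"])
    show "\<forall>z. z \<notin> ball c \<rho>' \<longrightarrow> winding_number (circlepath c \<rho>) z = 0"
      using sph by (auto intro!: winding_number_zero_outside[of _ "ball c \<rho>'"])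
  qed (use F K sph in auto)
  moreover have "winding_number (circlepath c \<rho>) \<mu> = 1" if "\<mu> \<in> K" for \<mu>
    using K(2) that by (intro winding_number_circlepath) (auto simp: dist_norm norm_minus_commute)
  ultimately have "(F has_contour_integral 2 * pi * \<i> * (\<Sum>\<mu>\<in>K. residue F \<mu>)) (circlepath c \<rho>)"
    by simp
  from has_contour_integral_bound_circlepath[OF this B(1) \<rho>(1) B(2)]
  have "2 * pi * cmod (\<Sum>\<mu>\<in>K. residue F \<mu>) \<le> B * (2 * pi * \<rho>)" by (simp add: norm_mult)
  then have "(2 * pi) * cmod (\<Sum>\<mu>\<in>K. residue F \<mu>) \<le> (2 * pi) * (B * \<rho>)" by (simp add: mult_ac)
  then show ?thesis by (rule mult_left_le_imp_le) simp
qed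

lemma residue_sum:
  assumes "finite J" "open s" "z \<in> s" "\<And>j. j \<in> J \<Longrightarrow> F j holomorphic_on s - {z}"
  shows "residue (\<lambda>w. \<Sum>j\<in>J. F j w) z = (\<Sum>j\<in>J. residue (F j) z)"
  using assms(1,4)
proof (induction J rule: finite_induct)
  case empty
  then show ?case by (simp add: residue_const)
next
  case (insert j J)
  then have "residue (\<lambda>w. F j w + (\<Sum>j\<in>J. F j w)) z =
      residue (F j) z + residue (\<lambda>w. \<Sum>j\<in>J. F j w) z"
    using assms(2,3) by (intro residue_add[of s]) (auto intro!: holomorphic_intros)
  with insert show ?case by simp
qed

section \<open>The resolvent as a rational function\<close>

lemma resolvent_quotient:
  assumes A: "A \<in> carrier_mat n n"
  obtains q where "\<And>z. z \<notin> spectrum A \<Longrightarrow> poly p z \<cdot>\<^sub>m resolvent A z =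
    Matrix.mat n n (\<lambda>(i, j). poly (q i j) z) + resolvent A z * poly_mat p A"
proof -
  obtain q where q: "\<And>z. pencil A z * Matrix.mat n n (\<lambda>(i, j). poly (q i j) z) =
      poly p z \<cdot>\<^sub>m 1\<^sub>m n - poly_mat p A" using pencil_divides[OF A] by blast
  show thesis
  proof (rule that)
    fix z assume z: "z \<notin> spectrum A"
    let ?Q = "Matrix.mat n n (\<lambda>(i, j). poly (q i j) z)" and ?R = "resolvent A z" and ?P = "poly_mat p A"
    note R = resolvent_inverse[OF A z]
    have pen: "pencil A z \<in> carrier_mat n n" and P: "?P \<in> carrier_mat n n" using A by auto
    have "?Q = ?R * (pencil A z * ?Q)"
      using R pen by (simp add: assoc_mult_mat[of _ n n _ n _ n, symmetric] del: assoc_mult_mat)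
    also have "\<dots> = ?R * (poly p z \<cdot>\<^sub>m 1\<^sub>m n) - ?R * ?P"
      unfolding q using R P by (intro mult_minus_distrib_mat[of _ n n _ n]) auto
    also have "?R * (poly p z \<cdot>\<^sub>m 1\<^sub>m n) = poly p z \<cdot>\<^sub>m ?R"
      using R by (simp add: square_mat_simps[where n = n])
    finally show "poly p z \<cdot>\<^sub>m ?R = ?Q + ?R * ?P" using R(1) P by (auto intro!: eq_matI)
  qed
qed

text \<open>With \<open>p(A) = 0\<close> the term \<open>R(z) p(A)\<close> of the quotient formula
  disappears: multiplication by \<open>p\<close> cancels all poles of the resolvent.\<close>

lemma resolvent_annihilating:
  assumes A: "A \<in> carrier_mat n n" and p: "poly_mat p A = 0\<^sub>m n n"
  obtains q where "\<And>z i j. z \<notin> spectrum A \<Longrightarrow> i < n \<Longrightarrow> j < n \<Longrightarrow>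
    poly p z * resolvent A z $$ (i, j) = poly (q i j) z"
proof -
  obtain q where q: "\<And>z. z \<notin> spectrum A \<Longrightarrow> poly p z \<cdot>\<^sub>m resolvent A z =
      Matrix.mat n n (\<lambda>(i, j). poly (q i j) z) + resolvent A z * poly_mat p A"
    using resolvent_quotient[OF A] by blast
  show thesis
  proof (rule that)
    fix z i j assume z: "z \<notin> spectrum A" and ij: "i < n" "j < n"
    have "resolvent A z \<in> carrier_mat n n" using resolvent_inverse[OF A z] by blast
    then show "poly p z * resolvent A z $$ (i, j) = poly (q i j) z"
      using arg_cong[OF q[OF z], of "\<lambda>M. M $$ (i, j)"] ij unfolding p
      by (simp add: right_mult_zero_mat[of _ n n])
  qed
qed

lemma finite_spectrum [simp]: "A \<in> carrier_mat n n \<Longrightarrow> finite (spectrum (A :: complex mat))"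
  by (rule card_finite_spectrum)

lemma resolvent_entry_holomorphic:
  assumes A: "A \<in> carrier_mat n n" and ij: "i < n" "j < n"
  shows "(\<lambda>z. resolvent A z $$ (i, j)) holomorphic_on - spectrum A"
proof -
  obtain L where L: "set L = spectrum A" "poly_mat (root_prod L) A = 0\<^sub>m n n"
    using annihilating_root_prod[OF A] by blast
  obtain q where q: "\<And>z i j. z \<notin> spectrum A \<Longrightarrow> i < n \<Longrightarrow> j < n \<Longrightarrow>
      poly (root_prod L) z * resolvent A z $$ (i, j) = poly (q i j) z"
    using resolvent_annihilating[OF A L(2)] by blast
  have nz: "poly (root_prod L) z \<noteq> 0" if "z \<in> - spectrum A" for z
    using that by (simp add: poly_root_prod_eq_0_iff L(1))
  have "(\<lambda>z. poly (q i j) z / poly (root_prod L) z) holomorphic_on - spectrum A"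
    using nz by (intro holomorphic_intros)
  then show ?thesis
  proof (rule holomorphic_transform)
    fix z assume z: "z \<in> - spectrum A"
    then show "poly (q i j) z / poly (root_prod L) z = resolvent A z $$ (i, j)"
      using nz[OF z] q[OF _ ij, of z, symmetric] by simp
  qed
qed

text \<open>The pencil stretches every vector at least by \<open>cmod z - op_norm A\<close>. This
  excludes eigenvectors and, applied to \<open>R(z) v\<close>, bounds the resolvent.\<close>

lemma resolvent_norm_bound:
  assumes A: "A \<in> carrier_mat n n" and z: "op_norm A < cmod z"
  shows "z \<notin> spectrum A" "op_norm (resolvent A z) \<le> 1 / (cmod z - op_norm A)"
proof -
  have lower: "(cmod z - op_norm A) * vnorm v \<le> vnorm (pencil A z *\<^sub>v v)" if v: "v \<in> carrier_vec n" for v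
  proof -
    have Av: "A *\<^sub>v v \<in> carrier_vec n" using A v by auto
    have pv: "pencil A z *\<^sub>v v \<in> carrier_vec n" using A v by (intro mult_mat_vec_carrier[of _ n n]) auto
    have "z \<cdot>\<^sub>v v = pencil A z *\<^sub>v v + A *\<^sub>v v"
      unfolding pencil_mult_vec[OF A v] using A Av v by (intro eq_vecI) auto
    then have "vnorm (z \<cdot>\<^sub>v v) \<le> vnorm (pencil A z *\<^sub>v v) + vnorm (A *\<^sub>v v)"
      using vnorm_add[OF pv Av] by simp
    moreover have "vnorm (A *\<^sub>v v) \<le> op_norm A * vnorm v" using A v by (intro op_norm_mult_vec) auto
    ultimately show ?thesis by (simp add: algebra_simps)
  qed
  show nz: "z \<notin> spectrum A"
  proof
    assume "z \<in> spectrum A"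
    then obtain v where v: "v \<in> carrier_vec n" "v \<noteq> 0\<^sub>v n" "A *\<^sub>v v = z \<cdot>\<^sub>v v"
      using spectrum_iff[OF A] by blast
    have "pencil A z *\<^sub>v v = 0\<^sub>v n" unfolding pencil_mult_vec[OF A v(1)] v(3) using v(1) by auto
    then have "(cmod z - op_norm A) * vnorm v \<le> 0" using lower[OF v(1)] by simp
    then have "vnorm v = 0" using z vnorm_nonneg[of v] by (simp add: mult_le_0_iff)
    then show False using v vnorm_eq_0_iff by blast
  qed
  note R = resolvent_inverse[OF A nz]
  show "op_norm (resolvent A z) \<le> 1 / (cmod z - op_norm A)"
  proof (rule op_norm_leI)
    fix v :: "complex vec" assume "v \<in> carrier_vec (dim_col (resolvent A z))"
    then have v: "v \<in> carrier_vec n" using R by auto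
    have pen: "pencil A z \<in> carrier_mat n n" using A by auto
    have Rv: "resolvent A z *\<^sub>v v \<in> carrier_vec n" using R v by auto
    have "pencil A z *\<^sub>v (resolvent A z *\<^sub>v v) = v"
      using assoc_mult_mat_vec[OF pen R(1) v] R(2) v by simp
    then show "vnorm (resolvent A z *\<^sub>v v) \<le> 1 / (cmod z - op_norm A) * vnorm v"
      using lower[OF Rv] z by (simp add: field_simps)
  qed (use z in simp)
qed

text \<open>Since \<open>z R(z) = 1 + A R(z)\<close>, the resolvent differs from \<open>1 / z\<close> by \<open>O(\<bar>z\<bar>\<^sup>-\<^sup>2)\<close>, so that its
  integral over a large circle is \<open>2 \<pi> \<i>\<close>.\<close>

lemma sum_residue_resolvent:
  assumes A: "A \<in> carrier_mat n n" and ij: "i < n" "j < n"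
  shows "(\<Sum>\<mu>\<in>spectrum A. residue (\<lambda>z. resolvent A z $$ (i, j)) \<mu>) = 1\<^sub>m n $$ (i, j)"
proof -
  let ?\<delta> = "1\<^sub>m n $$ (i, j) :: complex" and ?a = "op_norm A"
  \<comment> \<open>The point 0 is added as the pole of \<open>?\<delta> / z\<close>; it may or may
    not be an eigenvalue.\<close>
  let ?R = "\<lambda>z. resolvent A z $$ (i, j)" and ?K = "insert 0 (spectrum A)"
  let ?F = "\<lambda>z. ?R z - ?\<delta> / z"
  define x where "x = cmod ((\<Sum>\<mu>\<in>spectrum A. residue ?R \<mu>) - ?\<delta>)"
  note Rh = resolvent_entry_holomorphic[OF A ij]
  have fin: "finite ?K" using A by simp
  have res: "(\<Sum>\<mu>\<in>?K. residue ?F \<mu>) = (\<Sum>\<mu>\<in>spectrum A. residue ?R \<mu>) - ?\<delta>"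
  proof -
    have "residue ?F \<mu> = residue ?R \<mu> - residue (\<lambda>z. ?\<delta> / z) \<mu>" if "\<mu> \<in> ?K" for \<mu>
    proof (rule residue_diff[of "- (?K - {\<mu>})"])
      have "- (?K - {\<mu>}) - {\<mu>} = - ?K" using that by auto
      then show "?R holomorphic_on - (?K - {\<mu>}) - {\<mu>}" "(\<lambda>z. ?\<delta> / z) holomorphic_on - (?K - {\<mu>}) - {\<mu>}"
        by (auto intro!: holomorphic_intros intro: holomorphic_on_subset[OF Rh])
      show "open (- (?K - {\<mu>}))" by (intro open_Compl finite_imp_closed finite_Diff fin)
    qed auto
    then have "(\<Sum>\<mu>\<in>?K. residue ?F \<mu>) = (\<Sum>\<mu>\<in>?K. residue ?R \<mu> - residue (\<lambda>z. ?\<delta> / z) \<mu>)"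
      by (rule sum.cong[OF refl])
    also have "\<dots> = (\<Sum>\<mu>\<in>?K. residue ?R \<mu>) - (\<Sum>\<mu>\<in>?K. residue (\<lambda>z. ?\<delta> / z) \<mu>)"
      by (rule sum_subtractf)
    also have "(\<Sum>\<mu>\<in>?K. residue ?R \<mu>) = (\<Sum>\<mu>\<in>spectrum A. residue ?R \<mu>)"
    proof (rule sum.mono_neutral_right[OF fin])
      show "\<forall>\<mu>\<in>?K - spectrum A. residue ?R \<mu> = 0"
        using A Rh by (auto intro!: residue_holo[of "- spectrum A"] finite_imp_closed)
    qed auto
    also have "(\<Sum>\<mu>\<in>?K. residue (\<lambda>z. ?\<delta> / z) \<mu>) = (\<Sum>\<mu>\<in>{0}. residue (\<lambda>z. ?\<delta> / z) \<mu>)"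
    proof (rule sum.mono_neutral_right[OF fin])
      show "\<forall>\<mu>\<in>?K - {0}. residue (\<lambda>z. ?\<delta> / z) \<mu> = 0"
        by (auto intro!: residue_holo[of "- {0}"] holomorphic_intros)
    qed auto
    also have "\<dots> = ?\<delta>" using residue_simple[of UNIV 0 "\<lambda>_. ?\<delta>"] by simp
    finally show ?thesis .
  qed
  have bound: "x \<le> ?a / (\<rho> - ?a)" if \<rho>: "?a < \<rho>" for \<rho>
  proof -
    have \<rho>0: "0 < \<rho>" using \<rho> op_norm_nonneg[of A] by linarith
    have "cmod (\<Sum>\<mu>\<in>?K. residue ?F \<mu>) \<le> (?a / (\<rho> - ?a) / \<rho>) * \<rho>"
    proof (rule residue_sum_circle_bound[of \<rho> "\<rho> + 1"])
      have "cmod \<mu> \<le> ?a" if "\<mu> \<in> spectrum A" for \<mu>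
        using resolvent_norm_bound(1)[OF A, of \<mu>] that by (meson not_le)
      then show "?K \<subseteq> ball 0 \<rho>" using \<rho> \<rho>0 by force
      show "?F holomorphic_on ball 0 (\<rho> + 1) - ?K"
        by (auto intro!: holomorphic_intros intro: holomorphic_on_subset[OF Rh])
      fix z assume "cmod (z - 0) = \<rho>"
      then have z: "cmod z = \<rho>" by simp
      then have za: "?a < cmod z" using \<rho> by simp
      note nb = resolvent_norm_bound[OF A za]
      note R = resolvent_inverse[OF A nb(1)]
      let ?RR = "resolvent A z"
      have AR: "A * ?RR \<in> carrier_mat n n" using A R by auto
      have "pencil A z * ?RR = (z \<cdot>\<^sub>m 1\<^sub>m n) * ?RR - A * ?RR"
        using R(1) A by (simp add: minus_mult_distrib_mat[of _ n n _ _ n])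
      then have "1\<^sub>m n = (z \<cdot>\<^sub>m 1\<^sub>m n) * ?RR - A * ?RR" by (simp only: R(2))
      also have "(z \<cdot>\<^sub>m 1\<^sub>m n) * ?RR = z \<cdot>\<^sub>m ?RR" using R(1) by (simp add: square_mat_simps[where n = n])
      finally have "?\<delta> = (z \<cdot>\<^sub>m ?RR - A * ?RR) $$ (i, j)" by (rule arg_cong)
      then have "?\<delta> = z * ?R z - (A * ?RR) $$ (i, j)"
        using A R(1) ij by simp
      moreover have "z \<noteq> 0" using z \<rho>0 by auto
      ultimately have "?F z = (A * ?RR) $$ (i, j) / z" by (simp add: field_simps)
      then have "cmod (?F z) = cmod ((A * ?RR) $$ (i, j)) / \<rho>" by (simp add: norm_divide z)
      also have "\<dots> \<le> (?a / (\<rho> - ?a)) / \<rho>"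
      proof (rule divide_right_mono)
        have "cmod ((A * ?RR) $$ (i, j)) \<le> op_norm (A * ?RR)" by (rule entry_le_op_norm[OF AR ij])
        also have "\<dots> \<le> ?a * op_norm ?RR" by (rule op_norm_mult[OF A R(1)])
        also have "\<dots> \<le> ?a * (1 / (\<rho> - ?a))" using nb(2) z by (intro mult_left_mono) auto
        finally show "cmod ((A * ?RR) $$ (i, j)) \<le> ?a / (\<rho> - ?a)" by simp
      qed (use \<rho>0 in simp)
      finally show "cmod (?F z) \<le> ?a / (\<rho> - ?a) / \<rho>" .
    qed (use \<rho> \<rho>0 fin in auto)
    then show ?thesis using \<rho>0 by (simp add: res x_def)
  qed
  have "x = 0"
  proof (rule ccontr)
    assume "x \<noteq> 0"
    then have x: "0 < x" by (simp add: x_def)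
    have a: "0 \<le> ?a" by simp
    \<comment> \<open>The radius is chosen so that the bound becomes
      \<open>x * ?a / (2 * (?a + 1))\<close>, which is less than \<open>x\<close>.\<close>
    have "x \<le> ?a / ((?a + 2 * (?a + 1) / x) - ?a)" using x a by (intro bound) (simp add: add_nonneg_pos)
    also have "\<dots> = x * ?a / (2 * (?a + 1))" using x a by (simp add: field_simps)
    also have "\<dots> < x"
    proof -
      have "x * t / (2 * (t + 1)) < x" if "0 \<le> t" for t
        using x that by (simp add: pos_divide_less_eq add_pos_nonneg algebra_simps add_strict_increasing)
      then show ?thesis using a by blast
    qed
    finally show False by simp
  qed
  then show ?thesis by (simp add: x_def)
qed

text \<open>Whatever the annihilating polynomial \<open>p\<close>, the remainder \<open>p g\<close> does not contribute, because
  \<open>p(z) R(z)\<close> is a polynomial in \<open>z\<close>.\<close>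

theorem hol_calculus_eq_poly_mat:
  assumes A: "A \<in> carrier_mat n n" and X: "open X" "spectrum A \<subseteq> X"
    and f: "\<And>z. z \<in> X \<Longrightarrow> f z = poly h z + poly p z * g z" and g: "g holomorphic_on X"
    and p: "poly_mat p A = 0\<^sub>m n n"
  shows "hol_calculus f A = poly_mat h A"
proof (rule eq_matI)
  fix i j assume "i < dim_row (poly_mat h A)" "j < dim_col (poly_mat h A)"
  then have ij: "i < n" "j < n" using A by auto
  let ?R = "resolvent A" and ?H = "poly_mat h A"
  obtain q where q: "\<And>z i j. z \<notin> spectrum A \<Longrightarrow> i < n \<Longrightarrow> j < n \<Longrightarrow>
      poly p z * ?R z $$ (i, j) = poly (q i j) z"
    using resolvent_annihilating[OF A p] by blast
  obtain k where k: "\<And>z. z \<notin> spectrum A \<Longrightarrow> poly h z \<cdot>\<^sub>m ?R z =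
      Matrix.mat n n (\<lambda>(i, j). poly (k i j) z) + ?R z * ?H"
    using resolvent_quotient[OF A] by blast
  note Rh = resolvent_entry_holomorphic[OF A ij(1)]
  have "residue (\<lambda>z. f z * ?R z $$ (i, j)) \<mu> =
      (\<Sum>l<n. residue (\<lambda>z. ?R z $$ (i, l)) \<mu> * ?H $$ (l, j))" if \<mu>: "\<mu> \<in> spectrum A" for \<mu>
  proof -
    \<comment> \<open>An open neighbourhood of \<open>\<mu>\<close> that contains no other
      eigenvalue.\<close>
    define s where "s = X - (spectrum A - {\<mu>})"
    have s: "open s" "\<mu> \<in> s" "s - {\<mu>} \<subseteq> - spectrum A" "s \<subseteq> X"
      using X \<mu> A by (auto simp: s_def intro!: open_Diff finite_imp_closed)
    \<comment> \<open>The part of \<open>f(z) R(z)\<close> without poles: the quotient belonging to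
      \<open>h\<close>, plus \<open>g\<close> times the polynomial \<open>p(z) R(z)\<close>. What
      remains is \<open>R(z) h(A)\<close>, whose residues sum to \<open>h(A)\<close>.\<close>
    let ?G = "\<lambda>z. poly (k i j) z + g z * poly (q i j) z"
    have Gh: "?G holomorphic_on s"
      using holomorphic_on_subset[OF g s(4)] by (intro holomorphic_intros)
    have Rs: "(\<lambda>z. ?R z $$ (i, l) * ?H $$ (l, j)) holomorphic_on s - {\<mu>}" if "l < n" for l
      using holomorphic_on_subset[OF Rh[OF that] s(3)] by (intro holomorphic_intros)
    have "f z * ?R z $$ (i, j) = ?G z + (\<Sum>l<n. ?R z $$ (i, l) * ?H $$ (l, j))" if "z \<in> s - {\<mu>}" for z
    proof -
      have z: "z \<notin> spectrum A" "z \<in> X" using that s by auto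
      have R: "?R z \<in> carrier_mat n n" using resolvent_inverse[OF A z(1)] by blast
      have "(?R z * ?H) $$ (i, j) = (\<Sum>l<n. ?R z $$ (i, l) * ?H $$ (l, j))"
        using ij R A by (auto simp: scalar_prod_def atLeast0LessThan intro!: sum.cong)
      then have "poly h z * ?R z $$ (i, j) = poly (k i j) z + (\<Sum>l<n. ?R z $$ (i, l) * ?H $$ (l, j))"
        using arg_cong[OF k[OF z(1)], of "\<lambda>M. M $$ (i, j)"] ij R A by simp
      then show ?thesis using q[OF z(1) ij] by (simp add: f[OF z(2)] algebra_simps)
    qed
    then have "\<forall>\<^sub>F z in at \<mu>. f z * ?R z $$ (i, j) = ?G z + (\<Sum>l<n. ?R z $$ (i, l) * ?H $$ (l, j))"
      using s(1,2) by (auto simp: eventually_at_topological)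
    then have "residue (\<lambda>z. f z * ?R z $$ (i, j)) \<mu> =
        residue (\<lambda>z. ?G z + (\<Sum>l<n. ?R z $$ (i, l) * ?H $$ (l, j))) \<mu>"
      by (rule residue_cong) simp
    also have "\<dots> = residue ?G \<mu> + residue (\<lambda>z. \<Sum>l<n. ?R z $$ (i, l) * ?H $$ (l, j)) \<mu>"
      using s Rs Gh by (intro residue_add[of s] holomorphic_on_sum) (auto intro: holomorphic_on_subset)
    also have "residue ?G \<mu> = 0" by (rule residue_holo[OF s(1,2) Gh])
    also have "residue (\<lambda>z. \<Sum>l<n. ?R z $$ (i, l) * ?H $$ (l, j)) \<mu> =
        (\<Sum>l<n. residue (\<lambda>z. ?R z $$ (i, l) * ?H $$ (l, j)) \<mu>)"
      using s Rs by (intro residue_sum[of _ s]) auto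
    also have "\<dots> = (\<Sum>l<n. residue (\<lambda>z. ?R z $$ (i, l)) \<mu> * ?H $$ (l, j))"
      using s holomorphic_on_subset[OF Rh s(3)] by (intro sum.cong residue_rmul[of s]) auto
    finally show ?thesis by simp
  qed
  then have "hol_calculus f A $$ (i, j) =
      (\<Sum>\<mu>\<in>spectrum A. \<Sum>l<n. residue (\<lambda>z. ?R z $$ (i, l)) \<mu> * ?H $$ (l, j))"
    using A ij by (simp add: hol_calculus_def)
  also have "\<dots> = (\<Sum>l<n. (\<Sum>\<mu>\<in>spectrum A. residue (\<lambda>z. ?R z $$ (i, l)) \<mu>) * ?H $$ (l, j))"
    by (subst sum.swap) (simp add: sum_distrib_right)
  also have "\<dots> = (\<Sum>l<n. if l = i then ?H $$ (l, j) else 0)"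
    using ij by (intro sum.cong) (auto simp: sum_residue_resolvent[OF A])
  also have "\<dots> = ?H $$ (i, j)" using ij by simp
  finally show "hol_calculus f A $$ (i, j) = ?H $$ (i, j)" .
qed (use A in \<open>auto simp: hol_calculus_def\<close>)

text \<open>Each node contributes one divided difference, and the derivative fills its removable
  singularity, so the remainder stays holomorphic on \<open>X\<close>. Repeated nodes are treated in
  the same way, which gives Hermite interpolation.\<close>

lemma newton_interpolation:
  assumes X: "open X" and f: "f holomorphic_on X"
  shows "\<exists>h g. g holomorphic_on X \<and> (\<forall>z\<in>X. f z = poly h z + poly (root_prod L) z * g z)"
proof (induction L)
  case Nil
  then show ?case using f by (intro exI[of _ 0] exI[of _ f]) auto
next
  case (Cons a L)
  then obtain h g where g: "g holomorphic_on X"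
    and f: "\<And>z. z \<in> X \<Longrightarrow> f z = poly h z + poly (root_prod L) z * g z" by blast
  define g' where "g' = (\<lambda>z. if z = a then deriv g a else (g z - g a) / (z - a))"
  have "g' holomorphic_on X" unfolding g'_def by (rule pole_lemma_open[OF g X])
  moreover have "f z = poly (h + Polynomial.smult (g a) (root_prod L)) z + poly (root_prod (a # L)) z * g' z"
    if z: "z \<in> X" for z
  proof -
    have "(z - a) * g' z = g z - g a" by (auto simp: g'_def)
    then have gz: "g z = g a + (z - a) * g' z" by simp
    show ?thesis unfolding f[OF z] by (subst gz) (simp add: algebra_simps)
  qed
  ultimately show ?case by blast
qed

section \<open>Rules of the functional calculus, by interpolation\<close>

lemma poly_mat_root_prod_append:
  assumes A: "A \<in> carrier_mat n n"
    and "poly_mat (root_prod L) A = 0\<^sub>m n n \<or> poly_mat (root_prod L') A = 0\<^sub>m n n"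
  shows "poly_mat (root_prod (L @ L')) A = 0\<^sub>m n n"
  using assms(2) poly_mat_mult[OF A, of "root_prod L" "root_prod L'"]
    left_mult_zero_mat[OF poly_mat_carrier[OF A, of "root_prod L'"], of n]
    right_mult_zero_mat[OF poly_mat_carrier[OF A, of "root_prod L"], of n] by auto

lemma hol_calculus_carrier [simp]: "A \<in> carrier_mat n n \<Longrightarrow> hol_calculus f A \<in> carrier_mat n n"
  by (auto simp: hol_calculus_def)

text \<open>The polynomial \<open>h\<close> depends on \<open>f\<close> and \<open>L\<close> alone
  and so serves matrices of every size. This reduces compatibility with direct sums and similarities
  to that of polynomials.\<close>

lemma hol_calculus_interpolation:
  assumes X: "open X" and f: "f holomorphic_on X"
  obtains h where "\<And>n A. A \<in> carrier_mat n n \<Longrightarrow> spectrum A \<subseteq> X \<Longrightarrow>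
    poly_mat (root_prod L) A = 0\<^sub>m n n \<Longrightarrow> hol_calculus f A = poly_mat h A"
proof -
  obtain h g where hg: "g holomorphic_on X" "\<And>z. z \<in> X \<Longrightarrow> f z = poly h z + poly (root_prod L) z * g z"
    using newton_interpolation[OF X f] by blast
  show thesis
    by (rule that) (rule hol_calculus_eq_poly_mat[OF _ X _ hg(2) hg(1)])
qed

lemma spectrum_direct_sum:
  assumes A: "A \<in> carrier_mat n n" and B: "B \<in> carrier_mat m m"
  shows "spectrum (direct_sum A B) \<subseteq> spectrum A \<union> spectrum B"
proof -
  obtain L where L: "set L = spectrum A" "poly_mat (root_prod L) A = 0\<^sub>m n n"
    using annihilating_root_prod[OF A] by blast
  obtain M where M: "set M = spectrum B" "poly_mat (root_prod M) B = 0\<^sub>m m m"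
    using annihilating_root_prod[OF B] by blast
  have "poly_mat (root_prod (L @ M)) (direct_sum A B) = 0\<^sub>m (n + m) (n + m)"
    using poly_mat_root_prod_append[OF A, of L M] poly_mat_root_prod_append[OF B, of L M] L M
    by (simp add: poly_mat_direct_sum[OF A B] direct_sum_zero del: root_prod_simps)
  then show ?thesis
    using root_of_annihilating[OF direct_sum_carrier[OF A B], of "root_prod (L @ M)"] L M
    by (auto simp: poly_root_prod_eq_0_iff simp del: root_prod_simps)
qed

text \<open>Concatenated root lists annihilate both summands and therefore their direct sum, so one
  interpolating polynomial computes all three values.\<close>

lemma hol_calculus_direct_sum:
  assumes A: "A \<in> carrier_mat n n" and B: "B \<in> carrier_mat m m"
    and X: "open X" "spectrum A \<subseteq> X" "spectrum B \<subseteq> X" and f: "f holomorphic_on X"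
  shows "hol_calculus f (direct_sum A B) = direct_sum (hol_calculus f A) (hol_calculus f B)"
proof -
  obtain L where L: "poly_mat (root_prod L) A = 0\<^sub>m n n"
    using annihilating_root_prod[OF A] by blast
  obtain M where M: "poly_mat (root_prod M) B = 0\<^sub>m m m"
    using annihilating_root_prod[OF B] by blast
  have a: "poly_mat (root_prod (L @ M)) A = 0\<^sub>m n n" "poly_mat (root_prod (L @ M)) B = 0\<^sub>m m m"
    using poly_mat_root_prod_append[OF A, of L M] poly_mat_root_prod_append[OF B, of L M] L M by blast+
  have ab: "poly_mat (root_prod (L @ M)) (direct_sum A B) = 0\<^sub>m (n + m) (n + m)"
    unfolding poly_mat_direct_sum[OF A B] a by (rule direct_sum_zero)
  have sp: "spectrum (direct_sum A B) \<subseteq> X" using spectrum_direct_sum[OF A B] X by blast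
  obtain h where h: "\<And>n A. A \<in> carrier_mat n n \<Longrightarrow> spectrum A \<subseteq> X \<Longrightarrow>
      poly_mat (root_prod (L @ M)) A = 0\<^sub>m n n \<Longrightarrow> hol_calculus f A = poly_mat h A"
    using hol_calculus_interpolation[OF X(1) f] by metis
  show ?thesis
    unfolding h[OF A X(2) a(1)] h[OF B X(3) a(2)] h[OF direct_sum_carrier[OF A B] sp ab]
    by (rule poly_mat_direct_sum[OF A B])
qed

lemma poly_mat_similar_eq_zero:
  assumes A: "A \<in> carrier_mat n n" and st: "s \<in> carrier_mat n n" "t \<in> carrier_mat n n"
    "s * t = 1\<^sub>m n" "t * s = 1\<^sub>m n" and p: "poly_mat p A = 0\<^sub>m n n"
  shows "poly_mat p (t * A * s) = 0\<^sub>m n n"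
  unfolding poly_mat_similar[OF A st] p using st by simp

lemma spectrum_similar:
  fixes A :: "complex mat"
  assumes A: "A \<in> carrier_mat n n" and st: "s \<in> carrier_mat n n" "t \<in> carrier_mat n n"
    "s * t = 1\<^sub>m n" "t * s = 1\<^sub>m n"
  shows "spectrum (t * A * s) \<subseteq> spectrum A"
proof -
  obtain L where L: "set L = spectrum A" "poly_mat (root_prod L) A = 0\<^sub>m n n"
    using annihilating_root_prod[OF A] by blast
  have c: "t * A * s \<in> carrier_mat n n" using A st by auto
  show ?thesis
    using root_of_annihilating[OF c poly_mat_similar_eq_zero[OF A st L(2)]] L(1)
    by (auto simp: poly_root_prod_eq_0_iff)
qed

lemma hol_calculus_similar:
  assumes A: "A \<in> carrier_mat n n" and st: "s \<in> carrier_mat n n" "t \<in> carrier_mat n n"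
    "s * t = 1\<^sub>m n" "t * s = 1\<^sub>m n"
    and X: "open X" "spectrum A \<subseteq> X" and f: "f holomorphic_on X"
  shows "hol_calculus f (t * A * s) = t * hol_calculus f A * s"
proof -
  obtain L where L: "set L = spectrum A" "poly_mat (root_prod L) A = 0\<^sub>m n n"
    using annihilating_root_prod[OF A] by blast
  have c: "t * A * s \<in> carrier_mat n n" using A st by auto
  have sp: "spectrum (t * A * s) \<subseteq> X" using spectrum_similar[OF A st] X by blast
  obtain h where h: "\<And>n A. A \<in> carrier_mat n n \<Longrightarrow> spectrum A \<subseteq> X \<Longrightarrow>
      poly_mat (root_prod L) A = 0\<^sub>m n n \<Longrightarrow> hol_calculus f A = poly_mat h A"
    using hol_calculus_interpolation[OF X(1) f] by metis
  show ?thesis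
    unfolding h[OF A X(2) L(2)] h[OF c sp poly_mat_similar_eq_zero[OF A st L(2)]]
    by (rule poly_mat_similar[OF A st])
qed

text \<open>If \<open>k\<close> interpolates \<open>g\<close> for an annihilator of
  \<open>A\<close>, then \<open>h + p * k\<close> interpolates \<open>f\<close>. This becomes the
  error formula of the approximation, where \<open>p\<close> annihilates the centre of a
  neighbourhood and is merely small at \<open>A\<close>.\<close>

lemma hol_calculus_add_mult:
  assumes A: "A \<in> carrier_mat n n" and X: "open X" "spectrum A \<subseteq> X"
    and g: "g holomorphic_on X" and f: "\<And>z. z \<in> X \<Longrightarrow> f z = poly h z + poly p z * g z"
  shows "hol_calculus f A = poly_mat h A + poly_mat p A * hol_calculus g A"
proof -
  obtain L where L: "poly_mat (root_prod L) A = 0\<^sub>m n n"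
    using annihilating_root_prod[OF A] by blast
  obtain k e where e: "e holomorphic_on X" "\<And>z. z \<in> X \<Longrightarrow> g z = poly k z + poly (root_prod L) z * e z"
    using newton_interpolation[OF X(1) g] by blast
  have "hol_calculus f A = poly_mat (h + p * k) A"
  proof (rule hol_calculus_eq_poly_mat[OF A X _ _ L])
    show "(\<lambda>z. poly p z * e z) holomorphic_on X" using e(1) by (intro holomorphic_intros)
    show "f z = poly (h + p * k) z + poly (root_prod L) z * (poly p z * e z)" if "z \<in> X" for z
      by (simp add: f[OF that] e(2)[OF that] algebra_simps)
  qed
  moreover have "hol_calculus g A = poly_mat k A"
    by (rule hol_calculus_eq_poly_mat[OF A X e(2) e(1) L])
  ultimately show ?thesis by (simp add: poly_mat_add[OF A] poly_mat_mult[OF A])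
qed

lemma hol_calculus_mult:
  assumes A: "A \<in> carrier_mat n n" and X: "open X" "spectrum A \<subseteq> X"
    and f: "f holomorphic_on X" and g: "g holomorphic_on X"
  shows "hol_calculus (\<lambda>z. f z * g z) A = hol_calculus f A * hol_calculus g A"
proof -
  obtain L where L: "poly_mat (root_prod L) A = 0\<^sub>m n n"
    using annihilating_root_prod[OF A] by blast
  obtain h e where e: "e holomorphic_on X" "\<And>z. z \<in> X \<Longrightarrow> f z = poly h z + poly (root_prod L) z * e z"
    using newton_interpolation[OF X(1) f] by blast
  obtain h' e' where e': "e' holomorphic_on X" "\<And>z. z \<in> X \<Longrightarrow> g z = poly h' z + poly (root_prod L) z * e' z"
    using newton_interpolation[OF X(1) g] by blast
  have "hol_calculus (\<lambda>z. f z * g z) A = poly_mat (h * h') A"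
  proof (rule hol_calculus_eq_poly_mat[OF A X _ _ L])
    \<comment> \<open>With \<open>l\<close> for \<open>root_prod L\<close>: from
      \<open>f = h + l e\<close> and \<open>g = h' + l e'\<close> follows
      \<open>f g - h h' = l (h e' + e g)\<close>.\<close>
    show "(\<lambda>z. poly h z * e' z + e z * g z) holomorphic_on X" using e(1) e'(1) g by (intro holomorphic_intros)
    show "f z * g z = poly (h * h') z + poly (root_prod L) z * (poly h z * e' z + e z * g z)" if "z \<in> X" for z
      by (simp add: e(2)[OF that] e'(2)[OF that] algebra_simps)
  qed
  moreover have "hol_calculus f A = poly_mat h A"
    by (rule hol_calculus_eq_poly_mat[OF A X e(2) e(1) L])
  moreover have "hol_calculus g A = poly_mat h' A"
    by (rule hol_calculus_eq_poly_mat[OF A X e'(2) e'(1) L])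
  ultimately show ?thesis by (simp add: poly_mat_mult[OF A])
qed

lemma hol_calculus_cong:
  assumes A: "A \<in> carrier_mat n n" and X: "open X" "spectrum A \<subseteq> X"
    and eq: "\<And>z. z \<in> X \<Longrightarrow> f z = g z"
  shows "hol_calculus f A = hol_calculus g A"
proof -
  have "residue (\<lambda>z. f z * B z) \<mu> = residue (\<lambda>z. g z * B z) \<mu>" if "\<mu> \<in> spectrum A" for B \<mu>
    using X that eq by (intro residue_cong) (auto simp: eventually_at_topological)
  then show ?thesis by (simp add: hol_calculus_def cong: sum.cong)
qed

lemma hol_calculus_poly:
  assumes A: "A \<in> carrier_mat n n" and X: "open X" "spectrum A \<subseteq> X"
    and f: "\<And>z. z \<in> X \<Longrightarrow> f z = poly h z"
  shows "hol_calculus f A = poly_mat h A"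
  by (rule hol_calculus_eq_poly_mat[OF A X, of f h 0 "\<lambda>_. 0"]) (use f A in \<open>auto simp: poly_mat_0\<close>)

text \<open>Apply the linear factors to \<open>y\<close> one after the other. Just before the vector
  becomes zero it is an eigenvector, and it is still killed by \<open>q(A)\<close>, so
  \<open>q\<close> vanishes at its eigenvalue.\<close>

lemma joint_eigenvector:
  assumes A: "A \<in> carrier_mat n n"
  shows "y \<in> carrier_vec n \<Longrightarrow> y \<noteq> 0\<^sub>v n \<Longrightarrow> poly_mat q A *\<^sub>v y = 0\<^sub>v n \<Longrightarrow>
    poly_mat (root_prod L) A *\<^sub>v y = 0\<^sub>v n \<Longrightarrow> \<exists>k\<in>spectrum A. poly q k = 0"
proof (induction L arbitrary: y)
  case Nil
  then show ?case using A by (simp add: poly_mat_1)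
next
  case (Cons a L)
  let ?X = "poly_mat [:- a, 1:] A"
  have X: "?X \<in> carrier_mat n n" using A by simp
  have Xy: "?X *\<^sub>v y = A *\<^sub>v y - a \<cdot>\<^sub>v y"
  proof -
    have "?X = A + (- a) \<cdot>\<^sub>m 1\<^sub>m n"
      using A by (simp add: poly_mat_pCons poly_mat_0) (intro eq_matI; auto)
    then have "?X *\<^sub>v y = A *\<^sub>v y + ((- a) \<cdot>\<^sub>m 1\<^sub>m n) *\<^sub>v y"
      using A Cons.prems by (simp add: add_mult_distrib_mat_vec[of _ n n])
    also have "((- a) \<cdot>\<^sub>m 1\<^sub>m n) *\<^sub>v y = - (a \<cdot>\<^sub>v y)" using Cons.prems by (intro eq_vecI) auto
    finally show ?thesis using A Cons.prems by (intro eq_vecI) auto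
  qed
  show ?case
  proof (cases "?X *\<^sub>v y = 0\<^sub>v n")
    case True
    have ev: "A *\<^sub>v y = a \<cdot>\<^sub>v y"
    proof (rule eq_vecI)
      fix i assume "i < dim_vec (a \<cdot>\<^sub>v y)"
      then have i: "i < n" using Cons.prems by auto
      have "(A *\<^sub>v y - a \<cdot>\<^sub>v y) $ i = 0" using True i unfolding Xy by simp
      then show "(A *\<^sub>v y) $ i = (a \<cdot>\<^sub>v y) $ i" using A Cons.prems i by auto
    qed (use A Cons.prems in auto)
    then have "poly q a \<cdot>\<^sub>v y = 0\<^sub>v n"
      using poly_mat_eigenvector[OF A Cons.prems(1) ev, of q] Cons.prems(3) by simp
    then have "cmod (poly q a) * vnorm y = 0" using vnorm_smult[of "poly q a" y] by simp
    then have "poly q a = 0" using Cons.prems vnorm_eq_0_iff by auto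
    moreover have "a \<in> spectrum A" using ev Cons.prems spectrum_iff[OF A] by blast
    ultimately show ?thesis by blast
  next
    case False
    have swap: "poly_mat p A *\<^sub>v (?X *\<^sub>v y) = ?X *\<^sub>v (poly_mat p A *\<^sub>v y)" for p
      using assoc_mult_mat_vec[of "poly_mat p A" n n ?X n y] assoc_mult_mat_vec[of ?X n n "poly_mat p A" n y]
        poly_mat_commute[OF A, of p "[:- a, 1:]"] A Cons.prems(1) by simp
    have "poly_mat (root_prod (a # L)) A *\<^sub>v y = ?X *\<^sub>v (poly_mat (root_prod L) A *\<^sub>v y)"
      using assoc_mult_mat_vec[of ?X n n "poly_mat (root_prod L) A" n y] A Cons.prems(1)
      by (simp add: poly_mat_mult[OF A] del: mult_pCons_left)
    then have "poly_mat (root_prod L) A *\<^sub>v (?X *\<^sub>v y) = 0\<^sub>v n"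
      using Cons.prems(4) swap by simp
    moreover have "poly_mat q A *\<^sub>v (?X *\<^sub>v y) = 0\<^sub>v n"
      unfolding swap Cons.prems(3) using X by (intro eq_vecI) (auto simp: scalar_prod_def)
    ultimately show ?thesis using False X Cons.prems(1) by (intro Cons.IH[of "?X *\<^sub>v y"]) auto
  qed
qed

text \<open>An eigenvector of \<open>h(A)\<close> for \<open>k\<close> is killed by
  \<open>h - k\<close> at \<open>A\<close> and by any annihilator of \<open>A\<close>; hence
  \<open>h - k\<close> vanishes at some eigenvalue of \<open>A\<close>.\<close>

lemma spectrum_poly_mat:
  assumes A: "A \<in> carrier_mat n n" and k: "k \<in> spectrum (poly_mat h A)"
  shows "\<exists>l\<in>spectrum A. k = poly h l"
proof -
  obtain y where y: "y \<in> carrier_vec n" "y \<noteq> 0\<^sub>v n" "poly_mat h A *\<^sub>v y = k \<cdot>\<^sub>v y"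
    using k spectrum_iff[OF poly_mat_carrier[OF A]] by blast
  obtain L where L: "poly_mat (root_prod L) A = 0\<^sub>m n n"
    using annihilating_root_prod[OF A] by blast
  have "poly_mat (h - [:k:]) A *\<^sub>v y = poly_mat h A *\<^sub>v y - (k \<cdot>\<^sub>m 1\<^sub>m n) *\<^sub>v y"
    using A y(1) by (simp add: poly_mat_diff[OF A] poly_mat_const[OF A] minus_mult_distrib_mat_vec[of _ n n])
  also have "(k \<cdot>\<^sub>m 1\<^sub>m n) *\<^sub>v y = k \<cdot>\<^sub>v y" using y(1) by (intro eq_vecI) auto
  finally have "poly_mat (h - [:k:]) A *\<^sub>v y = 0\<^sub>v n" using y by auto
  moreover have "poly_mat (root_prod L) A *\<^sub>v y = 0\<^sub>v n"
    unfolding L using y(1) by (intro eq_vecI) (auto simp: scalar_prod_def)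
  ultimately obtain l where "l \<in> spectrum A" "poly (h - [:k:]) l = 0"
    using joint_eigenvector[OF A y(1,2)] by blast
  then show ?thesis by (intro bexI[of _ l]) auto
qed

text \<open>The annihilator vanishes on the spectrum, so there the interpolating polynomial agrees
  with \<open>f\<close>.\<close>

lemma spectrum_hol_calculus:
  assumes A: "A \<in> carrier_mat n n" and X: "open X" "spectrum A \<subseteq> X" and f: "f holomorphic_on X"
  shows "spectrum (hol_calculus f A) \<subseteq> f ` spectrum A"
proof
  fix k assume k: "k \<in> spectrum (hol_calculus f A)"
  obtain L where L: "set L = spectrum A" "poly_mat (root_prod L) A = 0\<^sub>m n n"
    using annihilating_root_prod[OF A] by blast
  obtain h g where g: "g holomorphic_on X" and hg: "\<And>z. z \<in> X \<Longrightarrow> f z = poly h z + poly (root_prod L) z * g z"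
    using newton_interpolation[OF X(1) f] by blast
  have "hol_calculus f A = poly_mat h A" by (rule hol_calculus_eq_poly_mat[OF A X hg g L(2)])
  then obtain l where l: "l \<in> spectrum A" "k = poly h l" using spectrum_poly_mat[OF A] k by metis
  moreover have "poly (root_prod L) l = 0" using l(1) L(1) poly_root_prod_eq_0_iff by simp
  ultimately have "k = f l" using hg[of l] X(2) by auto
  then show "k \<in> f ` spectrum A" using l(1) by blast
qed

lemma poly_mat_square: "A \<in> carrier_mat n n \<Longrightarrow> poly_mat [:0, 0, 1:] A = A * A"
  using poly_mat_mult[of A n "[:0, 1:]" "[:0, 1:]"] by (simp add: poly_mat_X)

lemma poly_mat_pcompose:
  assumes A: "A \<in> carrier_mat n n"
  shows "poly_mat (pcompose p q) A = poly_mat p (poly_mat q A)"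
proof (induction p rule: pCons_induct)
  case 0
  show ?case using A by (simp add: poly_mat_0[OF A] poly_mat_0[OF poly_mat_carrier[OF A]])
next
  case (pCons a p)
  then show ?case
    by (simp add: pcompose_pCons poly_mat_add[OF A] poly_mat_mult[OF A] poly_mat_const[OF A]
        poly_mat_pCons[OF poly_mat_carrier[OF A]])
qed

text \<open>If \<open>h\<close> interpolates \<open>f\<close> for \<open>A * A\<close>, then
  \<open>h(z^2)\<close> interpolates the identity for \<open>A\<close>. This is how a branch of the
  square root recovers \<open>v\<close> from \<open>v * v\<close>.\<close>

lemma hol_calculus_of_square:
  assumes A: "A \<in> carrier_mat n n" and X: "open X" "spectrum (A * A) \<subseteq> X" and f: "f holomorphic_on X"
    and Y: "open Y" "spectrum A \<subseteq> Y" and inv: "\<And>z. z \<in> Y \<Longrightarrow> z\<^sup>2 \<in> X" "\<And>z. z \<in> Y \<Longrightarrow> f (z\<^sup>2) = z"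
  shows "hol_calculus f (A * A) = A"
proof -
  have AA: "A * A \<in> carrier_mat n n" using A by auto
  obtain L where L: "poly_mat (root_prod L) (A * A) = 0\<^sub>m n n"
    using annihilating_root_prod[OF AA] by blast
  obtain h g where g: "g holomorphic_on X" and hg: "\<And>z. z \<in> X \<Longrightarrow> f z = poly h z + poly (root_prod L) z * g z"
    using newton_interpolation[OF X(1) f] by blast
  have "hol_calculus f (A * A) = poly_mat h (A * A)"
    by (rule hol_calculus_eq_poly_mat[OF AA X hg g L])
  also have "\<dots> = poly_mat (pcompose h [:0, 0, 1:]) A"
    by (simp add: poly_mat_pcompose[OF A] poly_mat_square[OF A])
  also have "\<dots> = hol_calculus (\<lambda>z. z) A"
  proof (rule hol_calculus_eq_poly_mat[OF A Y, symmetric])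
    show "z = poly (pcompose h [:0, 0, 1:]) z + poly (pcompose (root_prod L) [:0, 0, 1:]) z * g (z\<^sup>2)"
      if "z \<in> Y" for z
      using hg[OF inv(1)[OF that]] inv(2)[OF that] by (simp add: poly_pcompose power2_eq_square)
    have "(g \<circ> (\<lambda>z. z\<^sup>2)) holomorphic_on Y"
      using inv(1) by (intro holomorphic_on_compose_gen[OF _ g] holomorphic_intros) auto
    then show "(\<lambda>z. g (z\<^sup>2)) holomorphic_on Y" by (simp add: o_def)
    show "poly_mat (pcompose (root_prod L) [:0, 0, 1:]) A = 0\<^sub>m n n"
      by (simp add: poly_mat_pcompose[OF A] poly_mat_square[OF A] L)
  qed
  also have "\<dots> = A"
    using hol_calculus_poly[OF A Y, of "\<lambda>z. z" "[:0, 1:]"] poly_mat_X[OF A] by simp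
  finally show ?thesis .
qed

section \<open>Bounds that are uniform over all matrix sizes\<close>

lemma hol_calculus_dim [simp]:
  "dim_row (hol_calculus f A) = dim_row A" "dim_col (hol_calculus f A) = dim_row A"
  by (simp_all add: hol_calculus_def)

lemma op_norm_poly_mat_bound:
  assumes C: "0 \<le> C"
  shows "\<exists>c\<ge>0. \<forall>n A. A \<in> carrier_mat n n \<longrightarrow> op_norm A \<le> C \<longrightarrow> op_norm (poly_mat p A) \<le> c"
proof (induction p rule: pCons_induct)
  case 0
  then show ?case by (intro exI[of _ 0]) (auto simp: poly_mat_0)
next
  case (pCons a p)
  then obtain c where c: "0 \<le> c" "\<And>n A. A \<in> carrier_mat n n \<Longrightarrow> op_norm A \<le> C \<Longrightarrow> op_norm (poly_mat p A) \<le> c"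
    by blast
  have "op_norm (poly_mat (pCons a p) A) \<le> cmod a + C * c"
    if A: "A \<in> carrier_mat n n" and AC: "op_norm A \<le> C" for n A
  proof -
    have "op_norm (poly_mat (pCons a p) A) \<le> op_norm (a \<cdot>\<^sub>m 1\<^sub>m n) + op_norm (A * poly_mat p A)"
      unfolding poly_mat_pCons[OF A] using A by (intro op_norm_add[of _ n n]) auto
    also have "op_norm (a \<cdot>\<^sub>m 1\<^sub>m n) \<le> cmod a"
      using op_norm_one_le[of n] by (simp add: op_norm_smult mult_left_le)
    also have "op_norm (A * poly_mat p A) \<le> op_norm A * op_norm (poly_mat p A)"
      using A by (intro op_norm_mult[of _ n n]) auto
    also have "\<dots> \<le> C * c" using c(2)[OF A AC] AC C by (intro mult_mono) auto
    finally show ?thesis by simp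
  qed
  then show ?case using c C by (intro exI[of _ "cmod a + C * c"]) auto
qed

text \<open>The induction telescopes \<open>p(z) y - p(A) y\<close> along the roots of \<open>p\<close>; this bounds the
  resolvent off the zeros of \<open>p\<close>.\<close>

lemma pencil_lower_bound:
  assumes C: "0 \<le> C" and Z: "0 \<le> Z"
  shows "\<exists>b\<ge>0. \<forall>n A y z. A \<in> carrier_mat n n \<longrightarrow> op_norm A \<le> C \<longrightarrow> cmod z \<le> Z \<longrightarrow> y \<in> carrier_vec n \<longrightarrow>
    cmod (poly (root_prod L) z) * vnorm y \<le>
      vnorm (poly_mat (root_prod L) A *\<^sub>v y) + b * vnorm (pencil A z *\<^sub>v y)"
proof (induction L)
  case Nil
  then show ?case by (intro exI[of _ 0]) (auto simp: poly_mat_1)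
next
  case (Cons a L)
  then obtain b where b: "0 \<le> b" "\<And>n A y z. A \<in> carrier_mat n n \<Longrightarrow> op_norm A \<le> C \<Longrightarrow> cmod z \<le> Z \<Longrightarrow>
      y \<in> carrier_vec n \<Longrightarrow> cmod (poly (root_prod L) z) * vnorm y \<le>
        vnorm (poly_mat (root_prod L) A *\<^sub>v y) + b * vnorm (pencil A z *\<^sub>v y)"
    by blast
  obtain c where c: "0 \<le> c" "\<And>n A. A \<in> carrier_mat n n \<Longrightarrow> op_norm A \<le> C \<Longrightarrow> op_norm (poly_mat (root_prod L) A) \<le> c"
    using op_norm_poly_mat_bound[OF C] by blast
  \<comment> \<open>Write \<open>(z - a) y\<close> as \<open>(z - A) y + (A - a) y\<close> and apply
    \<open>root_prod L\<close> at \<open>A\<close>. The first term costs \<open>c\<close>; the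
    induction hypothesis, multiplied by \<open>cmod (z - a)\<close>, costs the rest.\<close>
  define b' where "b' = (Z + cmod a) * b + c"
  have "cmod (poly (root_prod (a # L)) z) * vnorm y \<le>
      vnorm (poly_mat (root_prod (a # L)) A *\<^sub>v y) + b' * vnorm (pencil A z *\<^sub>v y)"
    if A: "A \<in> carrier_mat n n" and AC: "op_norm A \<le> C" and z: "cmod z \<le> Z" and y: "y \<in> carrier_vec n" for n A y z
  proof -
    let ?P = "poly_mat (root_prod L) A" and ?X = "poly_mat [:- a, 1:] A" and ?My = "pencil A z *\<^sub>v y"
    have P: "?P \<in> carrier_mat n n" and X: "?X \<in> carrier_mat n n" using A by auto
    have My: "?My \<in> carrier_vec n" using A y by (intro mult_mat_vec_carrier[of _ n n]) auto
    have Xy: "?X *\<^sub>v y \<in> carrier_vec n" using X y by (rule mult_mat_vec_carrier)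
    have za: "cmod (z - a) \<le> Z + cmod a" using z norm_triangle_ineq4[of z a] by linarith
    have Xeq: "?X = A + (- a) \<cdot>\<^sub>m 1\<^sub>m n"
      using A by (simp add: poly_mat_pCons poly_mat_0) (intro eq_matI; auto)
    have "(z - a) \<cdot>\<^sub>v y = ?My + ?X *\<^sub>v y"
    proof -
      have "?X *\<^sub>v y = A *\<^sub>v y + ((- a) \<cdot>\<^sub>m 1\<^sub>m n) *\<^sub>v y"
        unfolding Xeq using A y by (intro add_mult_distrib_mat_vec[of _ n n]) auto
      also have "((- a) \<cdot>\<^sub>m 1\<^sub>m n) *\<^sub>v y = (- a) \<cdot>\<^sub>v y" using y by (intro eq_vecI) auto
      finally show ?thesis unfolding pencil_mult_vec[OF A y] using A y
        by (intro eq_vecI) (auto simp: algebra_simps)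
    qed
    then have "?P *\<^sub>v ((z - a) \<cdot>\<^sub>v y) = ?P *\<^sub>v ?My + ?P *\<^sub>v (?X *\<^sub>v y)"
      using mult_add_distrib_mat_vec[OF P My Xy] by simp
    also have "?P *\<^sub>v (?X *\<^sub>v y) = poly_mat (root_prod (a # L)) A *\<^sub>v y"
      using assoc_mult_mat_vec[OF P X y] poly_mat_mult[OF A, of "root_prod L" "[:- a, 1:]"]
      by (simp add: mult.commute del: mult_pCons_left mult_pCons_right)
    finally have "vnorm (?P *\<^sub>v ((z - a) \<cdot>\<^sub>v y)) \<le> vnorm (?P *\<^sub>v ?My) + vnorm (poly_mat (root_prod (a # L)) A *\<^sub>v y)"
      using vnorm_add[OF mult_mat_vec_carrier[OF P My] mult_mat_vec_carrier[OF poly_mat_carrier[OF A] y]] by simp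
    moreover have "vnorm (?P *\<^sub>v ?My) \<le> c * vnorm ?My"
      by (rule op_norm_mult_vec_le[OF P My c(2)[OF A AC]])
    moreover have "?P *\<^sub>v ((z - a) \<cdot>\<^sub>v y) = (z - a) \<cdot>\<^sub>v (?P *\<^sub>v y)"
      by (rule mult_mat_vec[OF P y])
    ultimately have 1: "cmod (z - a) * vnorm (?P *\<^sub>v y) \<le>
        c * vnorm ?My + vnorm (poly_mat (root_prod (a # L)) A *\<^sub>v y)" by simp
    have "cmod (poly (root_prod (a # L)) z) * vnorm y = cmod (z - a) * (cmod (poly (root_prod L) z) * vnorm y)"
      by (simp add: norm_mult[symmetric] algebra_simps)
    also have "\<dots> \<le> cmod (z - a) * (vnorm (?P *\<^sub>v y) + b * vnorm ?My)"
      by (rule mult_left_mono[OF b(2)[OF A AC z y]]) simp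
    also have "\<dots> = cmod (z - a) * vnorm (?P *\<^sub>v y) + cmod (z - a) * (b * vnorm ?My)"
      by (simp add: algebra_simps)
    also have "cmod (z - a) * (b * vnorm ?My) \<le> (Z + cmod a) * (b * vnorm ?My)"
      using za b(1) by (intro mult_right_mono) auto
    finally show ?thesis using 1 by (simp add: b'_def algebra_simps del: root_prod_simps)
  qed
  moreover have "0 \<le> b'" using b(1) c(1) Z by (simp add: b'_def)
  ultimately show ?case by (intro exI[of _ b']) blast
qed

text \<open>The spacing \<open>4 * \<rho>\<close> ensures that a point within
  \<open>2 * \<rho>\<close> of one root stays at distance at least \<open>2 * \<rho>\<close> from
  the others, so each circle can be drawn without regard to the other clusters of
  eigenvalues.\<close>

lemma separating_radius:
  assumes F: "finite F" "F \<subseteq> X" "open (X :: complex set)"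
  obtains \<rho> where "0 < \<rho>" "\<And>a. a \<in> F \<Longrightarrow> cball a (2 * \<rho>) \<subseteq> X"
    "\<And>a b. a \<in> F \<Longrightarrow> b \<in> F \<Longrightarrow> a \<noteq> b \<Longrightarrow> 4 * \<rho> \<le> dist a b"
proof -
  have "\<exists>e>0. \<forall>w\<in>ball a e. w \<in> X \<and> (w \<noteq> a \<longrightarrow> w \<notin> F)" if "a \<in> F" for a
    using finite_ball_avoid[OF F(3,1), of a] that F(2) by blast
  then obtain e where e: "\<And>a. a \<in> F \<Longrightarrow> 0 < e a"
    "\<And>a w. a \<in> F \<Longrightarrow> w \<in> ball a (e a) \<Longrightarrow> w \<in> X \<and> (w \<noteq> a \<longrightarrow> w \<notin> F)" by metis
  \<comment> \<open>The extra 1 keeps the minimum defined when \<open>F\<close> is empty.\<close>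
  define \<rho> where "\<rho> = Min (insert 1 (e ` F)) / 4"
  have pos: "0 < \<rho>" using F(1) e(1) by (simp add: \<rho>_def)
  have le: "4 * \<rho> \<le> e a" if "a \<in> F" for a using F(1) that by (simp add: \<rho>_def)
  show thesis
  proof (rule that[OF pos])
    show "cball a (2 * \<rho>) \<subseteq> X" if "a \<in> F" for a
    proof
      fix w assume "w \<in> cball a (2 * \<rho>)"
      then have "w \<in> ball a (e a)" using le[OF that] pos by auto
      then show "w \<in> X" using e(2)[OF that] by blast
    qed
    show "4 * \<rho> \<le> dist a b" if "a \<in> F" "b \<in> F" "a \<noteq> b" for a b
    proof (rule ccontr)
      assume "\<not> 4 * \<rho> \<le> dist a b"
      then have "b \<in> ball a (e a)" using le[OF that(1)] by auto
      then show False using e(2)[OF that(1)] that by blast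
    qed
  qed
qed

lemma root_prod_lower_bound:
  assumes "0 \<le> \<rho>" "\<And>a. a \<in> set L \<Longrightarrow> \<rho> \<le> cmod (z - a)"
  shows "\<rho> ^ length L \<le> cmod (poly (root_prod L) z)"
  using assms(2)
proof (induction L)
  case (Cons a L)
  have "\<rho> * \<rho> ^ length L \<le> cmod (z - a) * cmod (poly (root_prod L) z)"
    using Cons assms(1) by (intro mult_mono) auto
  also have "\<dots> = cmod (poly (root_prod (a # L)) z)" by (simp add: norm_mult[symmetric] algebra_simps)
  finally show ?case by (simp del: root_prod_simps)
qed simp

text \<open>An eigenvector for \<open>k\<close> shows that the modulus of \<open>p(k)\<close> is at
  most the norm of \<open>p(A)\<close>, whereas far from all roots it is at least
  \<open>\<rho> ^ length L\<close>.\<close>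

lemma spectrum_near_roots:
  assumes A: "A \<in> carrier_mat n n" and k: "k \<in> spectrum A"
    and \<rho>: "0 \<le> \<rho>" and le: "op_norm (poly_mat (root_prod L) A) < \<rho> ^ length L"
  shows "\<exists>a\<in>set L. cmod (k - a) < \<rho>"
proof (rule ccontr)
  assume "\<not> (\<exists>a\<in>set L. cmod (k - a) < \<rho>)"
  then have "\<rho> ^ length L \<le> cmod (poly (root_prod L) k)"
    using \<rho> by (intro root_prod_lower_bound) (auto simp: not_less)
  moreover obtain v where v: "v \<in> carrier_vec n" "v \<noteq> 0\<^sub>v n" "A *\<^sub>v v = k \<cdot>\<^sub>v v"
    using k spectrum_iff[OF A] by blast
  have "cmod (poly (root_prod L) k) * vnorm v \<le> op_norm (poly_mat (root_prod L) A) * vnorm v"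
    using op_norm_mult_vec[of v "poly_mat (root_prod L) A"] poly_mat_eigenvector[OF A v(1,3), of "root_prod L"] A v
    by simp
  moreover have "0 < vnorm v" using v vnorm_eq_0_iff by (simp add: order_less_le)
  ultimately show False using le by (simp add: mult_le_cancel_right)
qed

lemma cauchy_schwarz_vec:
  assumes "u \<in> carrier_vec n" "v \<in> carrier_vec n"
  shows "cmod (\<Sum>i<n. cnj (u $ i) * v $ i) \<le> vnorm u * vnorm v"
proof -
  have "cmod (\<Sum>i<n. cnj (u $ i) * v $ i) \<le> (\<Sum>i<n. \<bar>cmod (u $ i)\<bar> * \<bar>cmod (v $ i)\<bar>)"
    by (rule order_trans[OF norm_sum]) (simp add: norm_mult)
  also have "\<dots> \<le> vnorm u * vnorm v"
    unfolding vnorm_def using assms L2_set_mult_ineq[of "\<lambda>i. cmod (u $ i)" "\<lambda>i. cmod (v $ i)" "{..<n}"] by simp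
  finally show ?thesis .
qed

text \<open>Once \<open>p(A)\<close> is small, the eigenvalues lie in small discs about the roots,
  and the lower bound for the pencil controls the resolvent on the circles. With
  \<open>u = g(A) v\<close>, the square of the norm of \<open>u\<close> is a sum of residues of the
  scalar function \<open>g(z)\<close> times the inner product of \<open>u\<close> and
  \<open>R(z) v\<close>. The number of circles depends on \<open>p\<close> alone.\<close>

theorem hol_calculus_uniform_bound:
  assumes X: "open X" "set L \<subseteq> X" and g: "g holomorphic_on X" and C: "0 \<le> C"
  shows "\<exists>\<epsilon>>0. \<exists>B\<ge>0. \<forall>n A. A \<in> carrier_mat n n \<longrightarrow> op_norm A \<le> C \<longrightarrow>
    op_norm (poly_mat (root_prod L) A) \<le> \<epsilon> \<longrightarrow> spectrum A \<subseteq> X \<and> op_norm (hol_calculus g A) \<le> B"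
proof -
  obtain \<rho> where \<rho>: "0 < \<rho>" "\<And>a. a \<in> set L \<Longrightarrow> cball a (2 * \<rho>) \<subseteq> X"
    "\<And>a b. a \<in> set L \<Longrightarrow> b \<in> set L \<Longrightarrow> a \<noteq> b \<Longrightarrow> 4 * \<rho> \<le> dist a b"
    using separating_radius[OF _ X(2,1)] by auto
  \<comment> \<open>On the circles the modulus of \<open>p(z)\<close> is at least \<open>m\<close>.
    Allowing \<open>p(A)\<close> the norm \<open>m / 2\<close> leaves half of it for the resolvent
    estimate, whence \<open>K = 2 * b / m\<close>.\<close>
  define m where "m = \<rho> ^ length L"
  have m: "0 < m" using \<rho> by (simp add: m_def)
  define Y where "Y = (\<Union>a\<in>set L. cball a \<rho>)"
  have Y: "compact Y" by (auto simp: Y_def)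
  have YX: "Y \<subseteq> X" using \<rho>(1,2) by (fastforce simp: Y_def)
  have "continuous_on Y g" using g YX holomorphic_on_imp_continuous_on holomorphic_on_subset by blast
  then have "bounded (g ` Y)" using Y compact_continuous_image compact_imp_bounded by blast
  then obtain G where G: "0 < G" "\<And>z. z \<in> Y \<Longrightarrow> cmod (g z) \<le> G"
    unfolding bounded_pos by auto
  obtain Z where Z: "0 < Z" "\<And>z. z \<in> Y \<Longrightarrow> cmod z \<le> Z"
    using compact_imp_bounded[OF Y] unfolding bounded_pos by auto
  obtain b where b: "0 \<le> b" "\<And>n A y z. A \<in> carrier_mat n n \<Longrightarrow> op_norm A \<le> C \<Longrightarrow> cmod z \<le> Z \<Longrightarrow>
      y \<in> carrier_vec n \<Longrightarrow> cmod (poly (root_prod L) z) * vnorm y \<le>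
        vnorm (poly_mat (root_prod L) A *\<^sub>v y) + b * vnorm (pencil A z *\<^sub>v y)"
    using pencil_lower_bound[OF C, of Z L] Z(1) by (meson less_imp_le)
  define \<epsilon> where "\<epsilon> = m / 2"
  define K where "K = 2 * b / m"
  \<comment> \<open>One circle of radius \<open>\<rho>\<close> per distinct root, with
    \<open>G\<close> bounding \<open>g\<close> and \<open>K\<close> the resolvent.\<close>
  define B where "B = card (set L) * (G * K * \<rho>)"
  have K: "0 \<le> K" and B: "0 \<le> B" using b m G \<rho> by (auto simp: K_def B_def)
  have "spectrum A \<subseteq> X \<and> op_norm (hol_calculus g A) \<le> B"
    if A: "A \<in> carrier_mat n n" and AC: "op_norm A \<le> C" and p: "op_norm (poly_mat (root_prod L) A) \<le> \<epsilon>" for n A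
  proof -
    have near: "\<exists>a\<in>set L. cmod (k - a) < \<rho>" if "k \<in> spectrum A" for k
    proof (rule spectrum_near_roots[OF A that])
      have "m / 2 < m" using m by simp
      then show "op_norm (poly_mat (root_prod L) A) < \<rho> ^ length L"
        using p by (simp add: \<epsilon>_def m_def)
    qed (use \<rho>(1) in simp)
    have specY: "spectrum A \<subseteq> Y" using near by (force simp: Y_def dist_norm norm_minus_commute)
    let ?R = "resolvent A"
    let ?D = "\<lambda>a. spectrum A \<inter> ball a \<rho>"
    have far: "\<rho> \<le> cmod (z - a')" if "a \<in> set L" "a' \<in> set L" "cmod (z - a) \<le> 2 * \<rho>" "a \<noteq> a'" for z a a'
    proof -
      have "dist a a' \<le> dist a z + dist z a'" by (rule dist_triangle)
      then show ?thesis using \<rho>(1) \<rho>(3)[OF that(1,2,4)] that(3) by (simp add: dist_norm norm_minus_commute)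
    qed
    have Rbound: "z \<notin> spectrum A \<and> vnorm (?R z *\<^sub>v v) \<le> K * vnorm v"
      if a: "a \<in> set L" and z: "cmod (z - a) = \<rho>" and v: "v \<in> carrier_vec n" for a z v
    proof -
      have rho_le: "\<rho> \<le> cmod (z - a')" if "a' \<in> set L" for a'
        using far[OF a that] z \<rho>(1) by (cases "a = a'") auto
      then have nz: "z \<notin> spectrum A" using near by (meson not_le)
      note R = resolvent_inverse[OF A nz]
      let ?y = "?R z *\<^sub>v v"
      have y: "?y \<in> carrier_vec n" using R v by auto
      have pen: "pencil A z \<in> carrier_mat n n" using A by auto
      have My: "pencil A z *\<^sub>v ?y = v" using assoc_mult_mat_vec[OF pen R(1) v] R(2) v by simp
      have "z \<in> Y" using a z by (auto simp: Y_def dist_norm norm_minus_commute)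
      have "m \<le> cmod (poly (root_prod L) z)" unfolding m_def
        using \<rho>(1) rho_le by (intro root_prod_lower_bound) auto
      then have "m * vnorm ?y \<le> cmod (poly (root_prod L) z) * vnorm ?y" by (intro mult_right_mono) auto
      also have "\<dots> \<le> vnorm (poly_mat (root_prod L) A *\<^sub>v ?y) + b * vnorm v"
        using b(2)[OF A AC Z(2)[OF \<open>z \<in> Y\<close>] y] unfolding My .
      also have "vnorm (poly_mat (root_prod L) A *\<^sub>v ?y) \<le> m / 2 * vnorm ?y"
        using op_norm_mult_vec_le[OF poly_mat_carrier[OF A] y p] by (simp add: \<epsilon>_def)
      finally have "m / 2 * vnorm ?y \<le> b * vnorm v" by simp
      then have "vnorm ?y \<le> K * vnorm v" using m by (simp add: K_def field_simps)
      then show ?thesis using nz by blast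
    qed
    let ?S = "hol_calculus g A"
    have S: "?S \<in> carrier_mat n n" using A by simp
    have "op_norm ?S \<le> B"
    proof (rule op_norm_leI[OF _ B])
      fix v :: "complex vec" assume "v \<in> carrier_vec (dim_col ?S)"
      then have v: "v \<in> carrier_vec n" using S by auto
      define u where "u = ?S *\<^sub>v v"
      have u: "u \<in> carrier_vec n" using S v by (auto simp: u_def)
      let ?f = "\<lambda>p z. g z * ?R z $$ p * (cnj (u $ fst p) * v $ snd p)"
      let ?I = "{..<n} \<times> {..<n}"
      \<comment> \<open>This is \<open>g z\<close> times the inner product of \<open>u\<close> with
        \<open>R(z) v\<close>, spelled out over the entries so that it matches the entrywise
        residues in \<open>hol_calculus\<close>.\<close>
      let ?F = "\<lambda>z. \<Sum>p\<in>?I. ?f p z"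
      have Rh: "(\<lambda>z. ?R z $$ p) holomorphic_on - spectrum A" if "p \<in> ?I" for p
        using resolvent_entry_holomorphic[OF A, of "fst p" "snd p"] that by auto
      have gR: "(\<lambda>z. g z * ?R z $$ p) holomorphic_on X - spectrum A" if "p \<in> ?I" for p
        by (intro holomorphic_intros holomorphic_on_subset[OF g] holomorphic_on_subset[OF Rh[OF that]]) auto
      have fh: "?f p holomorphic_on X - spectrum A" if "p \<in> ?I" for p
        by (rule holomorphic_on_mult[OF gR[OF that] holomorphic_on_const])
      have Feq: "?F z = g z * (\<Sum>i<n. cnj (u $ i) * (?R z *\<^sub>v v) $ i)" if "z \<notin> spectrum A" for z
      proof -
        have R: "?R z \<in> carrier_mat n n" using resolvent_inverse[OF A that] by blast
        have "?F z = (\<Sum>i<n. \<Sum>j<n. g z * (cnj (u $ i) * (?R z $$ (i, j) * v $ j)))"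
          by (simp add: sum.cartesian_product' mult_ac)
        also have "\<dots> = (\<Sum>i<n. g z * (cnj (u $ i) * (?R z *\<^sub>v v) $ i))"
          using R v by (intro sum.cong refl)
            (auto simp: scalar_prod_def atLeast0LessThan sum_distrib_left)
        finally show ?thesis by (simp add: sum_distrib_left)
      qed
      have resF: "residue ?F \<mu> = (\<Sum>p\<in>?I. residue (\<lambda>z. g z * ?R z $$ p) \<mu> * (cnj (u $ fst p) * v $ snd p))"
        if \<mu>: "\<mu> \<in> spectrum A" for \<mu>
      proof -
        define s where "s = X - (spectrum A - {\<mu>})"
        have s: "open s" "\<mu> \<in> s" "s - {\<mu>} \<subseteq> X - spectrum A"
          using X(1) \<mu> A specY YX by (auto simp: s_def intro!: open_Diff finite_imp_closed)
        have "residue ?F \<mu> = (\<Sum>p\<in>?I. residue (?f p) \<mu>)"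
          using s fh by (intro residue_sum[of _ s]) (auto intro: holomorphic_on_subset)
        also have "\<dots> = (\<Sum>p\<in>?I. residue (\<lambda>z. g z * ?R z $$ p) \<mu> * (cnj (u $ fst p) * v $ snd p))"
          using s gR by (intro sum.cong refl residue_rmul[of s]) (auto intro: holomorphic_on_subset)
        finally show ?thesis .
      qed
      have "complex_of_real ((vnorm u)\<^sup>2) = (\<Sum>i<n. cnj (u $ i) * u $ i)"
        using u unfolding vnorm_sq by (simp add: complex_norm_square mult.commute del: of_real_power)
      also have "\<dots> = (\<Sum>p\<in>?I. ?S $$ p * (cnj (u $ fst p) * v $ snd p))"
      proof -
        have "u $ i = (\<Sum>j<n. ?S $$ (i, j) * v $ j)" if "i < n" for i
          using that S v by (auto simp: u_def scalar_prod_def atLeast0LessThan intro!: sum.cong)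
        then have "(\<Sum>i<n. cnj (u $ i) * u $ i) = (\<Sum>i<n. cnj (u $ i) * (\<Sum>j<n. ?S $$ (i, j) * v $ j))"
          by (intro sum.cong refl) (metis lessThan_iff)
        then show ?thesis by (simp add: sum.cartesian_product' sum_distrib_left mult_ac)
      qed
      also have "\<dots> = (\<Sum>p\<in>?I. \<Sum>\<mu>\<in>spectrum A. residue (\<lambda>z. g z * ?R z $$ p) \<mu> * (cnj (u $ fst p) * v $ snd p))"
        using A by (intro sum.cong refl) (auto simp: hol_calculus_def sum_distrib_right)
      also have "\<dots> = (\<Sum>\<mu>\<in>spectrum A. residue ?F \<mu>)"
        by (subst sum.swap) (simp add: resF)
      \<comment> \<open>The eigenvalues are grouped by the root next to them; the discs are
        disjoint, so none is counted twice.\<close>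
      also have "spectrum A = (\<Union>a\<in>set L. ?D a)"
        using near by (fastforce simp: dist_norm norm_minus_commute)
      also have "(\<Sum>\<mu>\<in>\<dots>. residue ?F \<mu>) = (\<Sum>a\<in>set L. \<Sum>\<mu>\<in>?D a. residue ?F \<mu>)"
      proof (rule sum.UNION_disjoint)
        show "\<forall>a\<in>set L. \<forall>a'\<in>set L. a \<noteq> a' \<longrightarrow> ?D a \<inter> ?D a' = {}"
        proof (intro ballI impI)
          fix a a' assume *: "a \<in> set L" "a' \<in> set L" "a \<noteq> a'"
          have "\<mu> \<notin> ball a' \<rho>" if "\<mu> \<in> ball a \<rho>" for \<mu>
            using far[OF *(1,2), of \<mu>] that *(3) \<rho>(1) by (auto simp: dist_norm norm_minus_commute)
          then show "?D a \<inter> ?D a' = {}" by blast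
        qed
      qed (use A in auto)
      finally have eq: "complex_of_real ((vnorm u)\<^sup>2) = (\<Sum>a\<in>set L. \<Sum>\<mu>\<in>?D a. residue ?F \<mu>)" .
      have circ: "cmod (\<Sum>\<mu>\<in>?D a. residue ?F \<mu>) \<le> (G * (vnorm u * (K * vnorm v))) * \<rho>" if a: "a \<in> set L" for a
      proof (rule residue_sum_circle_bound[of \<rho> "2 * \<rho>"])
        have "ball a (2 * \<rho>) - ?D a \<subseteq> X - spectrum A"
        proof
          fix z assume z: "z \<in> ball a (2 * \<rho>) - ?D a"
          then have "z \<in> X" using \<rho>(2)[OF a] ball_subset_cball by blast
          moreover have "z \<notin> spectrum A"
          proof
            assume zs: "z \<in> spectrum A"
            then obtain a' where a': "a' \<in> set L" "cmod (z - a') < \<rho>" using near by blast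
            then have "a' \<noteq> a" using z zs by (auto simp: dist_norm norm_minus_commute)
            then show False using far[OF a a'(1), of z] a'(2) z by (auto simp: dist_norm norm_minus_commute)
          qed
          ultimately show "z \<in> X - spectrum A" by blast
        qed
        then show "?F holomorphic_on ball a (2 * \<rho>) - ?D a"
          using fh by (intro holomorphic_on_sum) (auto intro: holomorphic_on_subset)
        fix z assume z: "cmod (z - a) = \<rho>"
        note Rz = Rbound[OF a z v]
        have Rc: "?R z \<in> carrier_mat n n" using resolvent_inverse[OF A] Rz by blast
        have "z \<in> Y" using a z by (auto simp: Y_def dist_norm norm_minus_commute)
        have "cmod (\<Sum>i<n. cnj (u $ i) * (?R z *\<^sub>v v) $ i) \<le> vnorm u * vnorm (?R z *\<^sub>v v)"
          using u Rc v by (intro cauchy_schwarz_vec) auto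
        also have "\<dots> \<le> vnorm u * (K * vnorm v)" using Rz by (intro mult_left_mono) auto
        finally have "cmod (g z) * cmod (\<Sum>i<n. cnj (u $ i) * (?R z *\<^sub>v v) $ i) \<le> G * (vnorm u * (K * vnorm v))"
          using G(2)[OF \<open>z \<in> Y\<close>] G(1) by (intro mult_mono) auto
        then show "cmod (?F z) \<le> G * (vnorm u * (K * vnorm v))"
          using Feq Rz by (simp add: norm_mult)
      qed (use \<rho>(1) A G(1) K in auto)
      have "(vnorm u)\<^sup>2 = cmod (complex_of_real ((vnorm u)\<^sup>2))" by (simp del: of_real_power)
      also have "\<dots> \<le> (\<Sum>a\<in>set L. cmod (\<Sum>\<mu>\<in>?D a. residue ?F \<mu>))" unfolding eq by (rule norm_sum)
      also have "\<dots> \<le> (\<Sum>a\<in>set L. (G * (vnorm u * (K * vnorm v))) * \<rho>)" by (intro sum_mono circ)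
      also have "\<dots> = vnorm u * (B * vnorm v)" by (simp add: B_def)
      finally have "vnorm u * vnorm u \<le> vnorm u * (B * vnorm v)" by (simp add: power2_eq_square)
      then have "vnorm u \<le> B * vnorm v"
        using B by (cases "vnorm u = 0") (auto simp: order_less_le)
      then show "vnorm (?S *\<^sub>v v) \<le> B * vnorm v" by (simp add: u_def)
    qed
    then show ?thesis using specY YX by blast
  qed
  moreover have "0 < \<epsilon>" using m by (simp add: \<epsilon>_def)
  ultimately show ?thesis using B by blast
qed

text \<open>The error at \<open>A\<close> is a product of \<open>p(A)\<close> with a bounded factor,
  so \<open>p\<close> and \<open>h\<close> can be fixed before \<open>C\<close> and
  \<open>\<eta>\<close>: the same polynomial works for every accuracy, and only the neighbourhood
  shrinks.\<close>

theorem hol_calculus_uniform_approximation: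
  assumes A0: "A0 \<in> carrier_mat k k" and X: "open X" "spectrum A0 \<subseteq> X" and f: "f holomorphic_on X"
  obtains p h where "poly_mat p A0 = 0\<^sub>m k k" "hol_calculus f A0 = poly_mat h A0"
    "\<And>C \<eta>. 0 \<le> C \<Longrightarrow> 0 < \<eta> \<Longrightarrow> \<exists>\<epsilon>>0. \<forall>n A. A \<in> carrier_mat n n \<longrightarrow> op_norm A \<le> C \<longrightarrow>
      op_norm (poly_mat p A) \<le> \<epsilon> \<longrightarrow> spectrum A \<subseteq> X \<and> op_norm (hol_calculus f A - poly_mat h A) \<le> \<eta>"
proof -
  obtain L where L: "set L = spectrum A0" "poly_mat (root_prod L) A0 = 0\<^sub>m k k"
    using annihilating_root_prod[OF A0] by blast
  obtain h g where g: "g holomorphic_on X" and hg: "\<And>z. z \<in> X \<Longrightarrow> f z = poly h z + poly (root_prod L) z * g z"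
    using newton_interpolation[OF X(1) f] by blast
  show thesis
  proof (rule that[OF L(2)])
    show "hol_calculus f A0 = poly_mat h A0" by (rule hol_calculus_eq_poly_mat[OF A0 X hg g L(2)])
    fix C \<eta> :: real assume C: "0 \<le> C" and \<eta>: "0 < \<eta>"
    obtain \<epsilon> B where \<epsilon>: "0 < \<epsilon>" and B: "0 \<le> B" and bound: "\<And>n A. A \<in> carrier_mat n n \<Longrightarrow> op_norm A \<le> C \<Longrightarrow>
        op_norm (poly_mat (root_prod L) A) \<le> \<epsilon> \<Longrightarrow> spectrum A \<subseteq> X \<and> op_norm (hol_calculus g A) \<le> B"
      using hol_calculus_uniform_bound[OF X(1) _ g C, of L] X(2) L(1) by auto
    \<comment> \<open>\<open>B + 1\<close> avoids a division by zero.\<close>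
    define \<epsilon>' where "\<epsilon>' = min \<epsilon> (\<eta> / (B + 1))"
    have "spectrum A \<subseteq> X \<and> op_norm (hol_calculus f A - poly_mat h A) \<le> \<eta>"
      if A: "A \<in> carrier_mat n n" "op_norm A \<le> C" "op_norm (poly_mat (root_prod L) A) \<le> \<epsilon>'" for n A
    proof -
      let ?P = "poly_mat (root_prod L) A" and ?g = "hol_calculus g A"
      have b: "spectrum A \<subseteq> X" "op_norm ?g \<le> B" using bound[of A n] A by (auto simp: \<epsilon>'_def)
      have "hol_calculus f A = poly_mat h A + ?P * ?g"
        by (rule hol_calculus_add_mult[OF A(1) X(1) b(1) g hg])
      then have "hol_calculus f A - poly_mat h A = ?P * ?g" using A(1) by (intro eq_matI) auto
      then have "op_norm (hol_calculus f A - poly_mat h A) \<le> op_norm ?P * op_norm ?g"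
        using op_norm_mult[of ?P n n ?g n] A(1) by simp
      also have "\<dots> \<le> \<eta> / (B + 1) * (B + 1)"
        using A(3) b(2) B \<eta> by (intro mult_mono) (auto simp: \<epsilon>'_def)
      also have "\<dots> = \<eta>" using B by simp
      finally show ?thesis using b by blast
    qed
    moreover have "0 < \<epsilon>'" using \<epsilon> \<eta> B by (simp add: \<epsilon>'_def)
    ultimately show "\<exists>\<epsilon>>0. \<forall>n A. A \<in> carrier_mat n n \<longrightarrow> op_norm A \<le> C \<longrightarrow>
      op_norm (poly_mat (root_prod L) A) \<le> \<epsilon> \<longrightarrow> spectrum A \<subseteq> X \<and> op_norm (hol_calculus f A - poly_mat h A) \<le> \<eta>"
      by blast
  qed
qed

section \<open>Free nc-maps\<close>

lemma nc_functionI: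
  assumes W: "nc_set d W"
    and carrier: "\<And>n x. 1 \<le> n \<Longrightarrow> x \<in> W \<Longrightarrow> x \<in> nc_level d n \<Longrightarrow> f x \<in> carrier_mat n n"
    and sum: "\<And>n m x y. 1 \<le> n \<Longrightarrow> 1 \<le> m \<Longrightarrow> x \<in> W \<Longrightarrow> y \<in> W \<Longrightarrow> x \<in> nc_level d n \<Longrightarrow> y \<in> nc_level d m \<Longrightarrow>
      f (map2 direct_sum x y) = direct_sum (f x) (f y)"
    and sim: "\<And>n x s t. 1 \<le> n \<Longrightarrow> x \<in> W \<Longrightarrow> x \<in> nc_level d n \<Longrightarrow> s \<in> carrier_mat n n \<Longrightarrow> t \<in> carrier_mat n n \<Longrightarrow>
      s * t = 1\<^sub>m n \<Longrightarrow> t * s = 1\<^sub>m n \<Longrightarrow> map (\<lambda>A. t * A * s) x \<in> W \<Longrightarrow>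
      f (map (\<lambda>A. t * A * s) x) = t * f x * s"
  shows "nc_function d W f"
  unfolding nc_function_def
proof (intro conjI ballI allI impI)
  show "graded d W f" using carrier by (auto simp: graded_def)
  fix x y assume x: "x \<in> W" and y: "y \<in> W"
  then obtain n m where "1 \<le> n" "x \<in> nc_level d n" "1 \<le> m" "y \<in> nc_level d m"
    using W unfolding nc_set_def nc_space_iff[abs_def] by (meson nc_space_iff subsetD)
  then show "f (map2 direct_sum x y) = direct_sum (f x) (f y)" using sum x y by blast
next
  fix n x s t
  assume *: "1 \<le> n" "x \<in> W \<inter> nc_level d n" "s \<in> carrier_mat n n" "t \<in> carrier_mat n n"
    "inverts_mat s t" "inverts_mat t s" "map (\<lambda>A. t * A * s) x \<in> W"
  then have "s * t = 1\<^sub>m n" "t * s = 1\<^sub>m n" by (auto simp: inverts_mat_def)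
  with * show "f (map (\<lambda>A. t * A * s) x) = t * f x * s" using sim by blast
qed (rule W)

lemma nc_functionD:
  assumes "nc_function d W f"
  shows "nc_set d W"
    "\<And>n x. 1 \<le> n \<Longrightarrow> x \<in> W \<Longrightarrow> x \<in> nc_level d n \<Longrightarrow> f x \<in> carrier_mat n n"
    "\<And>x y. x \<in> W \<Longrightarrow> y \<in> W \<Longrightarrow> f (map2 direct_sum x y) = direct_sum (f x) (f y)"
    "\<And>n x s t. 1 \<le> n \<Longrightarrow> x \<in> W \<Longrightarrow> x \<in> nc_level d n \<Longrightarrow> s \<in> carrier_mat n n \<Longrightarrow> t \<in> carrier_mat n n \<Longrightarrow>
      s * t = 1\<^sub>m n \<Longrightarrow> t * s = 1\<^sub>m n \<Longrightarrow> map (\<lambda>A. t * A * s) x \<in> W \<Longrightarrow>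
      f (map (\<lambda>A. t * A * s) x) = t * f x * s"
  using assms by (auto simp: nc_function_def graded_def inverts_mat_def)

lemma nc_function_coord:
  assumes "nc_set d W" "i < d"
  shows "nc_function d W (\<lambda>x. x ! i)"
  using assms(2) by (intro nc_functionI[OF assms(1)]) (auto simp: nc_level_def)

lemma nc_function_add:
  assumes f: "nc_function d W f" and g: "nc_function d W g"
  shows "nc_function d W (\<lambda>x. f x + g x)"
proof (rule nc_functionI[OF nc_functionD(1)[OF f]])
  fix n x assume "1 \<le> n" "x \<in> W" "x \<in> nc_level d n"
  then show "f x + g x \<in> carrier_mat n n" using nc_functionD(2)[OF f] nc_functionD(2)[OF g] by auto
next
  fix n m x y assume *: "1 \<le> n" "1 \<le> m" "x \<in> W" "y \<in> W" "x \<in> nc_level d n" "y \<in> nc_level d m"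
  then show "f (map2 direct_sum x y) + g (map2 direct_sum x y) = direct_sum (f x + g x) (f y + g y)"
    using nc_functionD(2)[OF f] nc_functionD(2)[OF g]
    by (simp add: nc_functionD(3)[OF f] nc_functionD(3)[OF g] direct_sum_add[of _ n _ _ m])
next
  fix n x s t assume *: "1 \<le> n" "x \<in> W" "x \<in> nc_level d n" "s \<in> carrier_mat n n" "t \<in> carrier_mat n n"
    "s * t = 1\<^sub>m n" "t * s = 1\<^sub>m n" "map (\<lambda>A. t * A * s) x \<in> W"
  have c: "f x \<in> carrier_mat n n" "g x \<in> carrier_mat n n"
    using * nc_functionD(2)[OF f] nc_functionD(2)[OF g] by auto
  have "t * (f x + g x) * s = (t * f x + t * g x) * s"
    using * c by (simp add: mult_add_distrib_mat[of _ n n _ n])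
  also have "\<dots> = t * f x * s + t * g x * s"
    using * c by (intro add_mult_distrib_mat[of _ n n]) auto
  finally show "f (map (\<lambda>A. t * A * s) x) + g (map (\<lambda>A. t * A * s) x) = t * (f x + g x) * s"
    using nc_functionD(4)[OF f *] nc_functionD(4)[OF g *] by simp
qed

lemma nc_function_smult:
  assumes f: "nc_function d W f"
  shows "nc_function d W (\<lambda>x. c \<cdot>\<^sub>m f x)"
proof (rule nc_functionI[OF nc_functionD(1)[OF f]])
  fix n x assume "1 \<le> n" "x \<in> W" "x \<in> nc_level d n"
  then show "c \<cdot>\<^sub>m f x \<in> carrier_mat n n" using nc_functionD(2)[OF f] by auto
next
  fix n m x y assume *: "1 \<le> n" "1 \<le> m" "x \<in> W" "y \<in> W" "x \<in> nc_level d n" "y \<in> nc_level d m"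
  then show "c \<cdot>\<^sub>m f (map2 direct_sum x y) = direct_sum (c \<cdot>\<^sub>m f x) (c \<cdot>\<^sub>m f y)"
    using nc_functionD(2)[OF f] by (simp add: nc_functionD(3)[OF f] direct_sum_smult[of _ n _ m])
next
  fix n x s t assume *: "1 \<le> n" "x \<in> W" "x \<in> nc_level d n" "s \<in> carrier_mat n n" "t \<in> carrier_mat n n"
    "s * t = 1\<^sub>m n" "t * s = 1\<^sub>m n" "map (\<lambda>A. t * A * s) x \<in> W"
  have c: "f x \<in> carrier_mat n n" using * nc_functionD(2)[OF f] by auto
  show "c \<cdot>\<^sub>m f (map (\<lambda>A. t * A * s) x) = t * (c \<cdot>\<^sub>m f x) * s"
    unfolding nc_functionD(4)[OF f *] using * c by (simp add: square_mat_simps[where n = n])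
qed

lemma nc_function_minus:
  assumes f: "nc_function d W f" and g: "nc_function d W g"
  shows "nc_function d W (\<lambda>x. f x - g x)"
proof (rule nc_function_cong[OF nc_function_add[OF f nc_function_smult[OF g, of "-1"]]])
  fix x assume x: "x \<in> W"
  then obtain n where "1 \<le> n" "x \<in> nc_level d n"
    using nc_functionD(1)[OF f] unfolding nc_set_def by (meson nc_space_iff subsetD)
  then have "f x \<in> carrier_mat n n" "g x \<in> carrier_mat n n"
    using x nc_functionD(2)[OF f] nc_functionD(2)[OF g] by auto
  then show "f x - g x = f x + -1 \<cdot>\<^sub>m g x" by (intro eq_matI) auto
qed

lemma nc_function_mult:
  assumes f: "nc_function d W f" and g: "nc_function d W g"
  shows "nc_function d W (\<lambda>x. f x * g x)"
proof (rule nc_functionI[OF nc_functionD(1)[OF f]])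
  fix n x assume "1 \<le> n" "x \<in> W" "x \<in> nc_level d n"
  then show "f x * g x \<in> carrier_mat n n"
    using nc_functionD(2)[OF f] nc_functionD(2)[OF g] by (intro mult_carrier_mat[of _ n n]) auto
next
  fix n m x y assume *: "1 \<le> n" "1 \<le> m" "x \<in> W" "y \<in> W" "x \<in> nc_level d n" "y \<in> nc_level d m"
  then show "f (map2 direct_sum x y) * g (map2 direct_sum x y) = direct_sum (f x * g x) (f y * g y)"
    using nc_functionD(2)[OF f] nc_functionD(2)[OF g]
    by (simp add: nc_functionD(3)[OF f] nc_functionD(3)[OF g] direct_sum_mult[of _ n _ _ m])
next
  fix n x s t assume *: "1 \<le> n" "x \<in> W" "x \<in> nc_level d n" "s \<in> carrier_mat n n" "t \<in> carrier_mat n n"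
    "s * t = 1\<^sub>m n" "t * s = 1\<^sub>m n" "map (\<lambda>A. t * A * s) x \<in> W"
  have c: "f x \<in> carrier_mat n n" "g x \<in> carrier_mat n n"
    using * nc_functionD(2)[OF f] nc_functionD(2)[OF g] by auto
  have "t * f x * s * (t * g x * s) = t * f x * (s * t) * g x * s"
    using *(4,5) c by (simp add: assoc_mult_mat[of _ n n _ n _ n] square_mat_simps[where n = n])
  also have "\<dots> = t * (f x * g x) * s"
    using * c by (simp add: assoc_mult_mat[of _ n n _ n _ n] square_mat_simps[where n = n])
  finally show "f (map (\<lambda>A. t * A * s) x) * g (map (\<lambda>A. t * A * s) x) = t * (f x * g x) * s"
    using nc_functionD(4)[OF f *] nc_functionD(4)[OF g *] by simp
qed

section \<open>The calculus as an nc-function of one coordinate\<close>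

definition spectral_domain :: "nat \<Rightarrow> nat \<Rightarrow> complex set \<Rightarrow> complex mat list set" where
  "spectral_domain d i X = {x \<in> nc_space d. spectrum (x ! i) \<subseteq> X}"

lemma nc_set_nc_space: "nc_set d (nc_space d)"
proof -
  have "map2 direct_sum x y \<in> nc_space d" if xy: "x \<in> nc_space d" "y \<in> nc_space d" for x y
  proof -
    obtain n m where "1 \<le> n" "x \<in> nc_level d n" "1 \<le> m" "y \<in> nc_level d m"
      using xy unfolding nc_space_iff by blast
    then show ?thesis using nc_level_direct_sum[of x d n y m] unfolding nc_space_iff
      by (intro exI[of _ "n + m"]) auto
  qed
  then show ?thesis by (auto simp: nc_set_def)
qed

lemma map2_direct_sum_nth:
  "x \<in> nc_level d n \<Longrightarrow> y \<in> nc_level d m \<Longrightarrow> i < d \<Longrightarrow> map2 direct_sum x y ! i = direct_sum (x ! i) (y ! i)"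
  by (simp add: nc_level_def)

lemma nc_set_spectral_domain:
  assumes i: "i < d"
  shows "nc_set d (spectral_domain d i X)"
proof -
  have "map2 direct_sum x y \<in> spectral_domain d i X"
    if x: "x \<in> spectral_domain d i X" and y: "y \<in> spectral_domain d i X" for x y
  proof -
    obtain n m where nm: "x \<in> nc_level d n" "y \<in> nc_level d m"
      using x y unfolding spectral_domain_def nc_space_iff by blast
    have "map2 direct_sum x y \<in> nc_space d"
      using nc_set_nc_space x y unfolding nc_set_def spectral_domain_def by blast
    moreover have "spectrum (map2 direct_sum x y ! i) \<subseteq> spectrum (x ! i) \<union> spectrum (y ! i)"
      unfolding map2_direct_sum_nth[OF nm i]
      using nm i by (intro spectrum_direct_sum) (auto intro: nc_level_nth)
    ultimately show ?thesis using x y unfolding spectral_domain_def by blast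
  qed
  then show ?thesis by (auto simp: nc_set_def spectral_domain_def)
qed

lemma nc_function_hol_calculus:
  assumes i: "i < d" and X: "open X" and f: "f holomorphic_on X"
  shows "nc_function d (spectral_domain d i X) (\<lambda>x. hol_calculus f (x ! i))"
proof (rule nc_functionI[OF nc_set_spectral_domain[OF i]])
  fix n x assume "x \<in> nc_level d n"
  then show "hol_calculus f (x ! i) \<in> carrier_mat n n" using i by (intro hol_calculus_carrier nc_level_nth)
next
  fix n m x y
  assume *: "x \<in> spectral_domain d i X" "y \<in> spectral_domain d i X" "x \<in> nc_level d n" "y \<in> nc_level d m"
  then show "hol_calculus f (map2 direct_sum x y ! i) = direct_sum (hol_calculus f (x ! i)) (hol_calculus f (y ! i))"
    unfolding map2_direct_sum_nth[OF *(3,4) i]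
    using i by (intro hol_calculus_direct_sum[OF _ _ X _ _ f]) (auto simp: spectral_domain_def intro: nc_level_nth)
next
  fix n x and s t :: "complex mat"
  assume *: "x \<in> spectral_domain d i X" "x \<in> nc_level d n" "s \<in> carrier_mat n n" "t \<in> carrier_mat n n"
    "s * t = 1\<^sub>m n" "t * s = 1\<^sub>m n"
  have "map (\<lambda>A. t * A * s) x ! i = t * (x ! i) * s" using *(2) i by (simp add: nc_level_def)
  then show "hol_calculus f (map (\<lambda>A. t * A * s) x ! i) = t * hol_calculus f (x ! i) * s"
    using hol_calculus_similar[OF nc_level_nth[OF *(2) i] *(3-6) X _ f] *(1)
    by (simp add: spectral_domain_def)
qed

text \<open>Requiring the exact value \<open>P x = g x\<close> as well lets \<open>P\<close> replace \<open>g\<close> in a strict norm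
  inequality at \<open>x\<close>, which is what makes preimages of free open sets freely open.\<close>

definition approx_at :: "nat \<Rightarrow> complex mat list \<Rightarrow> (complex mat list \<Rightarrow> complex mat) \<Rightarrow> bool" where
  "approx_at d x g \<longleftrightarrow> (\<exists>P. is_free_poly d P \<and> P x = g x \<and>
     (\<forall>\<eta>>0. \<exists>W\<in>free_opens d. x \<in> W \<and>
        (\<forall>n. \<forall>w \<in> W \<inter> nc_level d n. g w \<in> carrier_mat n n \<and> op_norm (g w - P w) \<le> \<eta>)))"

section \<open>Arithmetic of functions with local polynomial approximation\<close>

lemma nc_space_open:
  assumes d: "0 < d"
  shows "nc_space d \<in> free_opens d"
proof -
  have "{x \<in> nc_space d. op_norm (0 \<cdot>\<^sub>m 1\<^sub>m (dim_row (x ! 0))) < 1} \<in> free_opens d"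
    by (rule free_open_norm_less[OF d is_free_poly_const[OF d]]) simp
  moreover have "{x \<in> nc_space d. op_norm (0 \<cdot>\<^sub>m 1\<^sub>m (dim_row (x ! 0))) < 1} = nc_space d"
    by (simp add: op_norm_smult)
  ultimately show ?thesis by simp
qed

lemma approx_at_poly:
  assumes d: "0 < d" and x: "x \<in> nc_space d" and g: "is_free_poly d g"
  shows "approx_at d x g"
proof -
  have "g w \<in> carrier_mat n n \<and> op_norm (g w - g w) \<le> \<eta>" if "w \<in> nc_level d n" "0 < \<eta>" for w n and \<eta> :: real
  proof -
    have c: "g w \<in> carrier_mat n n" using is_free_poly_carrier[OF g that(1)] .
    then have "g w - g w = 0\<^sub>m n n" by (intro eq_matI) auto
    then show ?thesis using c that(2) by simp
  qed
  then show ?thesis unfolding approx_at_def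
    using g x nc_space_open[OF d] by (intro exI[of _ g] conjI allI impI bexI[of _ "nc_space d"]) auto
qed

lemma approx_at_cong:
  assumes d: "0 < d" and g: "approx_at d x g" and V: "V \<in> free_opens d" "x \<in> V"
    and eq: "\<And>w. w \<in> V \<Longrightarrow> h w = g w"
  shows "approx_at d x h"
proof -
  obtain P where P: "is_free_poly d P" "P x = g x"
    "\<And>\<eta>. 0 < \<eta> \<Longrightarrow> \<exists>W\<in>free_opens d. x \<in> W \<and>
        (\<forall>n. \<forall>w \<in> W \<inter> nc_level d n. g w \<in> carrier_mat n n \<and> op_norm (g w - P w) \<le> \<eta>)"
    using g unfolding approx_at_def by blast
  have "\<exists>W\<in>free_opens d. x \<in> W \<and>
      (\<forall>n. \<forall>w \<in> W \<inter> nc_level d n. h w \<in> carrier_mat n n \<and> op_norm (h w - P w) \<le> \<eta>)" if \<eta>: "0 < \<eta>" for \<eta>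
  proof -
    obtain W where W: "W \<in> free_opens d" "x \<in> W"
      "\<forall>n. \<forall>w \<in> W \<inter> nc_level d n. g w \<in> carrier_mat n n \<and> op_norm (g w - P w) \<le> \<eta>"
      using P(3)[OF \<eta>] by blast
    show ?thesis using W V eq free_opens_Int[OF d W(1) V(1)]
      by (intro bexI[of _ "W \<inter> V"]) auto
  qed
  then show ?thesis unfolding approx_at_def using P(1,2) eq[OF V(2)] by (intro exI[of _ P]) simp
qed

text \<open>Besides closeness it records a bound \<open>M\<close> for both \<open>g\<close> and
  \<open>P\<close> near \<open>x\<close>, which does not shrink with \<open>\<eta>\<close>; products
  and local boundedness need it.\<close>

definition approximates ::
    "nat \<Rightarrow> complex mat list \<Rightarrow> (complex mat list \<Rightarrow> complex mat) \<Rightarrow>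
      (complex mat list \<Rightarrow> complex mat) \<Rightarrow> real \<Rightarrow> bool" where
  "approximates d x P g M \<longleftrightarrow> is_free_poly d P \<and> P x = g x \<and> 0 < M \<and>
     (\<forall>\<eta>>0. \<exists>W\<in>free_opens d. x \<in> W \<and>
        (\<forall>n. \<forall>w \<in> W \<inter> nc_level d n. g w \<in> carrier_mat n n \<and> op_norm (g w - P w) \<le> \<eta> \<and>
           op_norm (g w) \<le> M \<and> op_norm (P w) \<le> M))"

lemma approximatesD:
  assumes "approximates d x P g M"
  shows "is_free_poly d P" "P x = g x" "0 < M"
    "\<And>\<eta>. 0 < \<eta> \<Longrightarrow> \<exists>W\<in>free_opens d. x \<in> W \<and>
        (\<forall>n. \<forall>w \<in> W \<inter> nc_level d n. g w \<in> carrier_mat n n \<and> op_norm (g w - P w) \<le> \<eta> \<and>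
           op_norm (g w) \<le> M \<and> op_norm (P w) \<le> M)"
  using assms unfolding approximates_def by simp_all

lemma approx_at_approximates:
  assumes d: "0 < d" and x: "x \<in> nc_space d" and g: "approx_at d x g"
  shows "\<exists>P M. approximates d x P g M"
proof -
  obtain P where P: "is_free_poly d P" "P x = g x"
    "\<And>\<eta>. 0 < \<eta> \<Longrightarrow> \<exists>W\<in>free_opens d. x \<in> W \<and>
        (\<forall>n. \<forall>w \<in> W \<inter> nc_level d n. g w \<in> carrier_mat n n \<and> op_norm (g w - P w) \<le> \<eta>)"
    using g unfolding approx_at_def by blast
  \<comment> \<open>One unit of the surplus makes \<open>op_norm (P w) < M - 1\<close> a strict
    condition that holds at \<open>x\<close>; the other absorbs the difference of \<open>g\<close>
    and \<open>P\<close>, kept at most 1.\<close>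
  define M where "M = op_norm (P x) + 2"
  have M: "0 < M" "op_norm (P x) < M - 1" using op_norm_nonneg[of "P x"] by (auto simp: M_def simp del: op_norm_nonneg)
  have "\<exists>W\<in>free_opens d. x \<in> W \<and>
      (\<forall>n. \<forall>w \<in> W \<inter> nc_level d n. g w \<in> carrier_mat n n \<and> op_norm (g w - P w) \<le> \<eta> \<and>
         op_norm (g w) \<le> M \<and> op_norm (P w) \<le> M)" if \<eta>: "0 < \<eta>" for \<eta>
  proof -
    have m: "0 < min \<eta> 1" using \<eta> by simp
    obtain W where W: "W \<in> free_opens d" "x \<in> W"
      "\<And>n w. w \<in> W \<inter> nc_level d n \<Longrightarrow> g w \<in> carrier_mat n n \<and> op_norm (g w - P w) \<le> min \<eta> 1"
      using P(3)[OF m] by blast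
    let ?V = "{w \<in> nc_space d. op_norm (P w) < M - 1}"
    have V: "?V \<in> free_opens d" "x \<in> ?V"
      using free_open_norm_less[OF d P(1)] M(2) x op_norm_nonneg[of "P x"] by (auto simp del: op_norm_nonneg)
    have "g w \<in> carrier_mat n n \<and> op_norm (g w - P w) \<le> \<eta> \<and> op_norm (g w) \<le> M \<and> op_norm (P w) \<le> M"
      if w: "w \<in> (W \<inter> ?V) \<inter> nc_level d n" for n w
    proof -
      have gw: "g w \<in> carrier_mat n n" "op_norm (g w - P w) \<le> min \<eta> 1" using W(3)[of w n] w by auto
      have Pw: "P w \<in> carrier_mat n n" using w is_free_poly_carrier[OF P(1)] by blast
      have "g w = (g w - P w) + P w" using gw Pw by (intro eq_matI) auto
      then have "op_norm (g w) \<le> op_norm (g w - P w) + op_norm (P w)"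
        using op_norm_add[OF minus_carrier_mat[OF Pw] Pw, of "g w"] by simp
      then show ?thesis using gw w by auto
    qed
    then show ?thesis using W V free_opens_Int[OF d W(1) V(1)]
      by (intro bexI[of _ "W \<inter> ?V"]) auto
  qed
  then have "approximates d x P g M" unfolding approximates_def using P(1,2) M(1) by simp
  then show ?thesis by blast
qed

lemma approx_at_add:
  assumes d: "0 < d" and x: "x \<in> nc_space d" and g: "approx_at d x g" and h: "approx_at d x h"
  shows "approx_at d x (\<lambda>w. g w + h w)"
proof -
  obtain P where P: "is_free_poly d P" "P x = g x"
    "\<And>\<eta>. 0 < \<eta> \<Longrightarrow> \<exists>W\<in>free_opens d. x \<in> W \<and>
        (\<forall>n. \<forall>w \<in> W \<inter> nc_level d n. g w \<in> carrier_mat n n \<and> op_norm (g w - P w) \<le> \<eta>)"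
    using g unfolding approx_at_def by blast
  obtain Q where Q: "is_free_poly d Q" "Q x = h x"
    "\<And>\<eta>. 0 < \<eta> \<Longrightarrow> \<exists>W\<in>free_opens d. x \<in> W \<and>
        (\<forall>n. \<forall>w \<in> W \<inter> nc_level d n. h w \<in> carrier_mat n n \<and> op_norm (h w - Q w) \<le> \<eta>)"
    using h unfolding approx_at_def by blast
  have "\<exists>W\<in>free_opens d. x \<in> W \<and> (\<forall>n. \<forall>w \<in> W \<inter> nc_level d n. g w + h w \<in> carrier_mat n n \<and>
      op_norm (g w + h w - (P w + Q w)) \<le> \<eta>)" if \<eta>: "0 < \<eta>" for \<eta>
  proof -
    have \<eta>2: "0 < \<eta> / 2" using \<eta> by simp
    obtain V where V: "V \<in> free_opens d" "x \<in> V"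
      "\<And>n w. w \<in> V \<inter> nc_level d n \<Longrightarrow> g w \<in> carrier_mat n n \<and> op_norm (g w - P w) \<le> \<eta> / 2"
      using P(3)[OF \<eta>2] by blast
    obtain W where W: "W \<in> free_opens d" "x \<in> W"
      "\<And>n w. w \<in> W \<inter> nc_level d n \<Longrightarrow> h w \<in> carrier_mat n n \<and> op_norm (h w - Q w) \<le> \<eta> / 2"
      using Q(3)[OF \<eta>2] by blast
    have "g w + h w \<in> carrier_mat n n \<and> op_norm (g w + h w - (P w + Q w)) \<le> \<eta>"
      if w: "w \<in> (V \<inter> W) \<inter> nc_level d n" for n w
    proof -
      have c: "g w \<in> carrier_mat n n" "h w \<in> carrier_mat n n" "P w \<in> carrier_mat n n" "Q w \<in> carrier_mat n n"
        using V(3)[of w n] W(3)[of w n] w is_free_poly_carrier[OF P(1)] is_free_poly_carrier[OF Q(1)] by auto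
      have "g w + h w - (P w + Q w) = (g w - P w) + (h w - Q w)" using c by (intro eq_matI) auto
      then have "op_norm (g w + h w - (P w + Q w)) \<le> op_norm (g w - P w) + op_norm (h w - Q w)"
        using op_norm_add[OF minus_carrier_mat[OF c(3)] minus_carrier_mat[OF c(4)]] by simp
      then show ?thesis using V(3)[of w n] W(3)[of w n] w c by auto
    qed
    then show ?thesis using V W free_opens_Int[OF d V(1) W(1)] by (intro bexI[of _ "V \<inter> W"]) auto
  qed
  then show ?thesis unfolding approx_at_def
    using is_free_poly_add[OF P(1) Q(1)] P(2) Q(2) by (intro exI[of _ "\<lambda>w. P w + Q w"]) simp
qed

lemma approx_at_mult:
  assumes d: "0 < d" and x: "x \<in> nc_space d" and g: "approx_at d x g" and h: "approx_at d x h"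
  shows "approx_at d x (\<lambda>w. g w * h w)"
proof -
  obtain P M where PM: "approximates d x P g M" using approx_at_approximates[OF d x g] by blast
  obtain Q N where QN: "approximates d x Q h N" using approx_at_approximates[OF d x h] by blast
  note P = approximatesD[OF PM] and Q = approximatesD[OF QN]
  have "\<exists>W\<in>free_opens d. x \<in> W \<and> (\<forall>n. \<forall>w \<in> W \<inter> nc_level d n. g w * h w \<in> carrier_mat n n \<and>
      op_norm (g w * h w - P w * Q w) \<le> \<eta>)" if \<eta>: "0 < \<eta>" for \<eta>
  proof -
    \<comment> \<open>The error is split as \<open>g h - P Q = g (h - Q) + (g - P) Q\<close>, where
      \<open>g\<close> is bounded by \<open>M\<close> and \<open>Q\<close> by
      \<open>N\<close>.\<close>
    define \<epsilon> where "\<epsilon> = \<eta> / (M + N)"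
    have \<epsilon>: "0 < \<epsilon>" using \<eta> P(3) Q(3) by (simp add: \<epsilon>_def)
    obtain V where V: "V \<in> free_opens d" "x \<in> V"
      "\<And>n w. w \<in> V \<inter> nc_level d n \<Longrightarrow> g w \<in> carrier_mat n n \<and> op_norm (g w - P w) \<le> \<epsilon> \<and>
           op_norm (g w) \<le> M \<and> op_norm (P w) \<le> M"
      using P(4)[OF \<epsilon>] by blast
    obtain W where W: "W \<in> free_opens d" "x \<in> W"
      "\<And>n w. w \<in> W \<inter> nc_level d n \<Longrightarrow> h w \<in> carrier_mat n n \<and> op_norm (h w - Q w) \<le> \<epsilon> \<and>
           op_norm (h w) \<le> N \<and> op_norm (Q w) \<le> N"
      using Q(4)[OF \<epsilon>] by blast
    have "g w * h w \<in> carrier_mat n n \<and> op_norm (g w * h w - P w * Q w) \<le> \<eta>"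
      if w: "w \<in> (V \<inter> W) \<inter> nc_level d n" for n w
    proof -
      have c: "g w \<in> carrier_mat n n" "h w \<in> carrier_mat n n" "P w \<in> carrier_mat n n" "Q w \<in> carrier_mat n n"
        using V(3)[of w n] W(3)[of w n] w is_free_poly_carrier[OF P(1)] is_free_poly_carrier[OF Q(1)] by auto
      have b: "op_norm (g w - P w) \<le> \<epsilon>" "op_norm (g w) \<le> M" "op_norm (h w - Q w) \<le> \<epsilon>" "op_norm (Q w) \<le> N"
        using V(3)[of w n] W(3)[of w n] w by auto
      have m: "g w * h w \<in> carrier_mat n n" "g w * Q w \<in> carrier_mat n n" "P w * Q w \<in> carrier_mat n n"
        using c by (auto intro: mult_carrier_mat[of _ n n])
      have "g w * (h w - Q w) = g w * h w - g w * Q w" "(g w - P w) * Q w = g w * Q w - P w * Q w"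
        using c by (auto intro: mult_minus_distrib_mat[of _ n n _ n] minus_mult_distrib_mat[of _ n n _ _ n])
      moreover have "X - Z = (X - Y) + (Y - Z)"
        if "X \<in> carrier_mat n n" "Y \<in> carrier_mat n n" "Z \<in> carrier_mat n n" for X Y Z :: "complex mat"
        using that by (intro eq_matI) auto
      ultimately have "g w * h w - P w * Q w = g w * (h w - Q w) + (g w - P w) * Q w"
        using m by metis
      also have "op_norm \<dots> \<le> op_norm (g w * (h w - Q w)) + op_norm ((g w - P w) * Q w)"
        using c by (intro op_norm_add[of _ n n] mult_carrier_mat[of _ n n]) auto
      also have "\<dots> \<le> op_norm (g w) * op_norm (h w - Q w) + op_norm (g w - P w) * op_norm (Q w)"
        using c by (intro add_mono op_norm_mult[of _ n n _ n]) auto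
      also have "\<dots> \<le> M * \<epsilon> + \<epsilon> * N"
        using b P(3) \<epsilon> by (intro add_mono mult_mono) auto
      also have "\<dots> = \<epsilon> * (M + N)" by (simp add: algebra_simps)
      also have "\<dots> = \<eta>" using P(3) Q(3) by (simp add: \<epsilon>_def)
      finally show ?thesis using m by blast
    qed
    then show ?thesis using V W free_opens_Int[OF d V(1) W(1)] by (intro bexI[of _ "V \<inter> W"]) auto
  qed
  then show ?thesis unfolding approx_at_def
    using is_free_poly_mult[OF P(1) Q(1)] P(2) Q(2) by (intro exI[of _ "\<lambda>w. P w * Q w"]) simp
qed

lemma approx_at_carrier:
  assumes "approx_at d x g"
  shows "\<exists>W\<in>free_opens d. x \<in> W \<and> (\<forall>n. \<forall>w \<in> W \<inter> nc_level d n. g w \<in> carrier_mat n n)"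
proof -
  obtain P where "\<forall>\<eta>>0. \<exists>W\<in>free_opens d. x \<in> W \<and>
        (\<forall>n. \<forall>w \<in> W \<inter> nc_level d n. g w \<in> carrier_mat n n \<and> op_norm (g w - P w) \<le> \<eta>)"
    using assms unfolding approx_at_def by blast
  from this[rule_format, of 1] show ?thesis by auto
qed

lemma approx_at_smult:
  assumes d: "0 < d" and x: "x \<in> nc_space d" and g: "approx_at d x g"
  shows "approx_at d x (\<lambda>w. c \<cdot>\<^sub>m g w)"
proof -
  obtain W where W: "W \<in> free_opens d" "x \<in> W" "\<forall>n. \<forall>w \<in> W \<inter> nc_level d n. g w \<in> carrier_mat n n"
    using approx_at_carrier[OF g] by blast
  show ?thesis
  proof (rule approx_at_cong[OF d approx_at_mult[OF d x approx_at_poly[OF d x is_free_poly_const[OF d, of c]] g] W(1,2)])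
    fix w assume w: "w \<in> W"
    then obtain n where n: "w \<in> nc_level d n"
      using free_opens_subset_nc_space[OF W(1)] nc_space_iff by blast
    then have "g w \<in> carrier_mat n n" "w ! 0 \<in> carrier_mat n n" using W(3) w nc_level_nth[OF n d] by auto
    then show "c \<cdot>\<^sub>m g w = c \<cdot>\<^sub>m 1\<^sub>m (dim_row (w ! 0)) * g w"
      by (simp add: square_mat_simps[where n = n])
  qed
qed

lemma approx_at_minus:
  assumes d: "0 < d" and x: "x \<in> nc_space d" and g: "approx_at d x g" and h: "approx_at d x h"
  shows "approx_at d x (\<lambda>w. g w - h w)"
proof -
  obtain V where V: "V \<in> free_opens d" "x \<in> V" "\<forall>n. \<forall>w \<in> V \<inter> nc_level d n. g w \<in> carrier_mat n n"
    using approx_at_carrier[OF g] by blast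
  obtain W where W: "W \<in> free_opens d" "x \<in> W" "\<forall>n. \<forall>w \<in> W \<inter> nc_level d n. h w \<in> carrier_mat n n"
    using approx_at_carrier[OF h] by blast
  show ?thesis
  proof (rule approx_at_cong[OF d approx_at_add[OF d x g approx_at_smult[OF d x h, of "-1"]]
        free_opens_Int[OF d V(1) W(1)]])
    fix w assume w: "w \<in> V \<inter> W"
    then obtain n where n: "w \<in> nc_level d n"
      using free_opens_subset_nc_space[OF W(1)] nc_space_iff by blast
    then have "g w \<in> carrier_mat n n" "h w \<in> carrier_mat n n" using W(3) V(3) w by auto
    then show "g w - h w = g w + -1 \<cdot>\<^sub>m h w" by (intro eq_matI) auto
  qed (use V W in auto)
qed

text \<open>A bound on \<open>w ! i\<close> and smallness of \<open>p\<close> at it become, with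
  strict inequalities, norm conditions on free polynomials, so they cut out a free neighbourhood. It
  contains \<open>x\<close> because \<open>p\<close> annihilates \<open>x ! i\<close>.\<close>

lemma approx_at_hol_calculus:
  assumes i: "i < d" and x: "x \<in> spectral_domain d i X" and X: "open X" and f: "f holomorphic_on X"
  shows "approx_at d x (\<lambda>w. hol_calculus f (w ! i))"
    "\<exists>W\<in>free_opens d. x \<in> W \<and> W \<subseteq> spectral_domain d i X"
proof -
  have d: "0 < d" using i by simp
  obtain k where k: "x \<in> nc_level d k" "x \<in> nc_space d" using x unfolding spectral_domain_def nc_space_iff by blast
  have xi: "x ! i \<in> carrier_mat k k" "spectrum (x ! i) \<subseteq> X"
    using k i x by (auto simp: spectral_domain_def intro: nc_level_nth)
  obtain p h where p: "poly_mat p (x ! i) = 0\<^sub>m k k" and h: "hol_calculus f (x ! i) = poly_mat h (x ! i)"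
    and ap: "\<And>C \<eta>. 0 \<le> C \<Longrightarrow> 0 < \<eta> \<Longrightarrow> \<exists>\<epsilon>>0. \<forall>n A. A \<in> carrier_mat n n \<longrightarrow> op_norm A \<le> C \<longrightarrow>
      op_norm (poly_mat p A) \<le> \<epsilon> \<longrightarrow> spectrum A \<subseteq> X \<and> op_norm (hol_calculus f A - poly_mat h A) \<le> \<eta>"
    using hol_calculus_uniform_approximation[OF xi(1) X xi(2) f] by metis
  define C where "C = op_norm (x ! i) + 1"
  have C: "0 < C" "op_norm (x ! i) < C" using op_norm_nonneg[of "x ! i"] by (auto simp: C_def simp del: op_norm_nonneg)
  have main: "\<exists>W\<in>free_opens d. x \<in> W \<and> W \<subseteq> spectral_domain d i X \<and>
      (\<forall>n. \<forall>w \<in> W \<inter> nc_level d n. op_norm (hol_calculus f (w ! i) - poly_mat h (w ! i)) \<le> \<eta>)"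
    if \<eta>: "0 < \<eta>" for \<eta>
  proof -
    obtain \<epsilon> where \<epsilon>: "0 < \<epsilon>" "\<And>n A. A \<in> carrier_mat n n \<Longrightarrow> op_norm A \<le> C \<Longrightarrow> op_norm (poly_mat p A) \<le> \<epsilon> \<Longrightarrow>
        spectrum A \<subseteq> X \<and> op_norm (hol_calculus f A - poly_mat h A) \<le> \<eta>"
      using ap[of C \<eta>] C(1) \<eta> by auto
    define W where "W = {w \<in> nc_space d. op_norm (w ! i) < C} \<inter> {w \<in> nc_space d. op_norm (poly_mat p (w ! i)) < \<epsilon>}"
    have "W \<in> free_opens d" unfolding W_def
      by (intro free_opens_Int[OF d] free_open_norm_less[OF d] is_free_poly_coord[OF i]
          is_free_poly_poly_mat[OF i] C \<epsilon>)
    moreover have "x \<in> W" using k(2) C(2) p \<epsilon>(1) by (simp add: W_def)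
    moreover have "spectrum (w ! i) \<subseteq> X \<and> op_norm (hol_calculus f (w ! i) - poly_mat h (w ! i)) \<le> \<eta>"
      if w: "w \<in> W" for w
    proof -
      obtain n where n: "w \<in> nc_level d n" using w unfolding W_def nc_space_iff by blast
      show ?thesis using w by (intro \<epsilon>(2)[OF nc_level_nth[OF n i]]) (auto simp: W_def)
    qed
    ultimately show ?thesis by (intro bexI[of _ W]) (auto simp: spectral_domain_def W_def)
  qed
  show "\<exists>W\<in>free_opens d. x \<in> W \<and> W \<subseteq> spectral_domain d i X"
    using main[of 1] by auto
  have "\<exists>W\<in>free_opens d. x \<in> W \<and> (\<forall>n. \<forall>w \<in> W \<inter> nc_level d n. hol_calculus f (w ! i) \<in> carrier_mat n n \<and>
      op_norm (hol_calculus f (w ! i) - poly_mat h (w ! i)) \<le> \<eta>)" if \<eta>: "0 < \<eta>" for \<eta>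
    using main[OF \<eta>] hol_calculus_carrier nc_level_nth[OF _ i] by (meson IntD2)
  then show "approx_at d x (\<lambda>w. hol_calculus f (w ! i))"
    unfolding approx_at_def using is_free_poly_poly_mat[OF i, of h] h
    by (intro exI[of _ "\<lambda>w. poly_mat h (w ! i)"]) simp
qed

text \<open>The neighbourhood found for the calculus already lies in the spectral domain; the
  identity function serves as the holomorphic function.\<close>

lemma spectral_domain_open:
  assumes "i < d" "open X"
  shows "spectral_domain d i X \<in> free_opens d"
  using approx_at_hol_calculus(2)[OF assms(1) _ assms(2), of _ "\<lambda>z. z"]
  by (intro free_opens_localI) (auto intro: holomorphic_intros)

section \<open>Free maps and their continuity\<close>

definition free_map ::
    "nat \<Rightarrow> nat \<Rightarrow> complex mat list set \<Rightarrow> (complex mat list \<Rightarrow> complex mat list) \<Rightarrow> bool" where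
  "free_map d e W \<theta> \<longleftrightarrow> W \<in> free_opens d \<and> nc_map d e W \<theta> \<and> (\<forall>x\<in>W. \<forall>i<e. approx_at d x (\<lambda>w. \<theta> w ! i))"

text \<open>Local boundedness is inherited from the approximating polynomial.\<close>

lemma free_holomorphicI:
  assumes d: "0 < d" and W: "W \<in> free_opens d" and g: "nc_function d W g" and a: "\<And>x. x \<in> W \<Longrightarrow> approx_at d x g"
  shows "tau_holomorphic d (free_opens d) W g"
  unfolding tau_holomorphic_def
proof (intro conjI ballI)
  show "graded d W g" using g by (simp add: nc_function_def)
  fix x assume x: "x \<in> W"
  then have xs: "x \<in> nc_space d" using free_opens_subset_nc_space[OF W] by blast
  show "\<exists>U\<in>free_opens d. x \<in> U \<and> U \<subseteq> W \<and> nc_function d U g" using W x g by blast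
  obtain P M where PM: "approximates d x P g M" using approx_at_approximates[OF d xs a[OF x]] by blast
  note M = approximatesD(4)[OF PM]
  obtain V where V: "V \<in> free_opens d" "x \<in> V" "\<And>n w. w \<in> V \<inter> nc_level d n \<Longrightarrow> op_norm (g w) \<le> M"
    using M[of 1] by auto
  have "op_norm (g w) \<le> M" if "w \<in> V \<inter> W" for w
    using V(3) that free_opens_subset_nc_space[OF W] nc_space_iff by blast
  then show "\<exists>U\<in>free_opens d. x \<in> U \<and> U \<subseteq> W \<and> (\<exists>M. \<forall>y\<in>U. op_norm (g y) \<le> M)"
    using x V(2) free_opens_Int[OF d V(1) W] by (intro bexI[of _ "V \<inter> W"]) auto
qed (rule W)

lemma free_map_level:
  assumes \<theta>: "free_map d e W \<theta>" and w: "w \<in> W"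
  obtains n where "1 \<le> n" "w \<in> nc_level d n" "\<theta> w \<in> nc_level e n"
proof -
  have "w \<in> nc_space d" using \<theta> w free_opens_subset_nc_space unfolding free_map_def by blast
  then obtain n where "1 \<le> n" "w \<in> nc_level d n" unfolding nc_space_iff by blast
  then show thesis using \<theta> w that[of n] unfolding free_map_def nc_map_def by blast
qed

lemma free_map_approx_word:
  assumes d: "0 < d" and \<theta>: "free_map d e W \<theta>" and x: "x \<in> W"
  shows "set u \<subseteq> {..<e} \<Longrightarrow> approx_at d x (\<lambda>w. word_eval (dim_row (w ! 0)) (\<theta> w) u)"
proof (induction u)
  have xs: "x \<in> nc_space d" using \<theta> x free_opens_subset_nc_space unfolding free_map_def by blast
  {
    case Nil
    have "approx_at d x (\<lambda>w. 1 \<cdot>\<^sub>m 1\<^sub>m (dim_row (w ! 0)))"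
      by (rule approx_at_poly[OF d xs is_free_poly_const[OF d]])
    then have "approx_at d x (\<lambda>w. 1\<^sub>m (dim_row (w ! 0)))"
      by (rule approx_at_cong[OF d _ nc_space_open[OF d] xs]) (auto intro!: eq_matI)
    then show ?case by (simp add: word_eval_def)
  next
    case (Cons i u)
    then have "approx_at d x (\<lambda>w. \<theta> w ! i * word_eval (dim_row (w ! 0)) (\<theta> w) u)"
      using \<theta> x unfolding free_map_def by (intro approx_at_mult[OF d xs]) auto
    then show ?case by (simp add: word_eval_def)
  }
qed

lemma free_map_approx_poly:
  assumes d: "0 < d" and \<theta>: "free_map d e W \<theta>" and x: "x \<in> W" and p: "p \<in> free_polys e"
  shows "approx_at d x (\<lambda>w. free_poly_eval (dim_row (w ! 0)) (\<theta> w) p)"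
proof -
  have W: "W \<in> free_opens d" using \<theta> unfolding free_map_def by blast
  have xs: "x \<in> nc_space d" using W x free_opens_subset_nc_space by blast
  \<comment> \<open>With \<open>K\<close> a finite set of words, the support of \<open>p\<close> can
    be built up one word at a time.\<close>
  let ?E = "\<lambda>K w. Matrix.mat (dim_row (w ! 0)) (dim_row (w ! 0))
    (\<lambda>ij. \<Sum>u\<in>K. Poly_Mapping.lookup p u * word_eval (dim_row (w ! 0)) (\<theta> w) u $$ ij)"
  have "approx_at d x (?E K)" if "finite K" "\<And>u. u \<in> K \<Longrightarrow> set u \<subseteq> {..<e}" for K
    using that
  proof (induction K rule: finite_induct)
    case empty
    show ?case
      by (rule approx_at_cong[OF d approx_at_poly[OF d xs is_free_poly_const[OF d, of 0]] nc_space_open[OF d] xs])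
        (auto intro!: eq_matI)
  next
    case (insert u K)
    have "approx_at d x (\<lambda>w. Poly_Mapping.lookup p u \<cdot>\<^sub>m word_eval (dim_row (w ! 0)) (\<theta> w) u + ?E K w)"
      using insert by (intro approx_at_add[OF d xs] approx_at_smult[OF d xs] free_map_approx_word[OF d \<theta> x]) auto
    then show ?case
    proof (rule approx_at_cong[OF d _ W x])
      fix w assume "w \<in> W"
      then obtain n where n: "w \<in> nc_level d n" "\<theta> w \<in> nc_level e n" using free_map_level[OF \<theta>] by metis
      have "dim_row (w ! 0) = n" using nc_level_nth[OF n(1) d] by auto
      moreover have "word_eval n (\<theta> w) u \<in> carrier_mat n n" using n(2) insert.prems by (intro word_eval_carrier) auto
      ultimately show "?E (insert u K) w =
          Poly_Mapping.lookup p u \<cdot>\<^sub>m word_eval (dim_row (w ! 0)) (\<theta> w) u + ?E K w"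
        using insert.hyps by (intro eq_matI) auto
    qed
  qed
  from this[of "Poly_Mapping.keys p"] show ?thesis
    using p by (simp add: free_poly_eval_def[abs_def] free_polys_def)
qed

text \<open>Meant for the finitely many entries of a polynomial matrix, each of which comes with its
  own neighbourhood.\<close>

lemma finite_free_neighbourhood:
  assumes d: "0 < d" and x: "x \<in> nc_space d" and "finite I"
    and "\<And>k. k \<in> I \<Longrightarrow> \<exists>W\<in>free_opens d. x \<in> W \<and> (\<forall>w\<in>W. Q k w)"
  shows "\<exists>W\<in>free_opens d. x \<in> W \<and> (\<forall>w\<in>W. \<forall>k\<in>I. Q k w)"
  using assms(3,4)
proof (induction I rule: finite_induct)
  case empty
  then show ?case using nc_space_open[OF d] x by blast
next
  case (insert k I)
  have "\<exists>W\<in>free_opens d. x \<in> W \<and> (\<forall>w\<in>W. \<forall>k\<in>I. Q k w)"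
    by (rule insert.IH[OF insert.prems[OF insertI2]])
  then obtain V where "V \<in> free_opens d" "x \<in> V" "\<forall>w\<in>V. \<forall>k\<in>I. Q k w" by blast
  moreover obtain W where "W \<in> free_opens d" "x \<in> W" "\<forall>w\<in>W. Q k w"
    using insert.prems[OF insertI1] by blast
  ultimately show ?case using free_opens_Int[OF d, of V W] by (intro bexI[of _ "V \<inter> W"]) auto
qed

text \<open>The preimage of a basic set is given by a norm inequality between functions that are not
  polynomials. Near \<open>x\<close> they are replaced by free polynomials \<open>P i j\<close> with
  the same values at \<open>x\<close>; the strict inequality at \<open>x\<close> then survives, and
  the finitely many errors fit into the remaining slack.\<close>

theorem free_opens_pullback:
  assumes d: "0 < d" and e: "0 < e" and \<theta>: "free_map d e W \<theta>" and V: "V \<in> free_opens e"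
  shows "{x \<in> W. \<theta> x \<in> V} \<in> free_opens d"
proof (rule free_opens_localI)
  fix x assume "x \<in> {x \<in> W. \<theta> x \<in> V}"
  then have x: "x \<in> W" "\<theta> x \<in> V" by auto
  have W: "W \<in> free_opens d" using \<theta> unfolding free_map_def by blast
  have xs: "x \<in> nc_space d" using W x free_opens_subset_nc_space by blast
  obtain \<delta> where \<delta>: "elements_mat \<delta> \<subseteq> free_polys e" "\<theta> x \<in> free_basic e \<delta>" "free_basic e \<delta> \<subseteq> V"
    using free_opensE[OF V x(2)] by blast
  let ?r = "dim_row \<delta>" and ?c = "dim_col \<delta>"
  let ?E = "\<lambda>i j w. free_poly_eval (dim_row (w ! 0)) (\<theta> w) (\<delta> $$ (i, j))"
  have "approx_at d x (?E i j)" if "i < ?r" "j < ?c" for i j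
    using elements_mat_nth[OF that] \<delta>(1) by (intro free_map_approx_poly[OF d \<theta> x(1)]) auto
  then have "\<exists>P M. approximates d x P (?E i j) M" if "i < ?r" "j < ?c" for i j
    using that approx_at_approximates[OF d xs] by blast
  then obtain P M where PM: "\<And>i j. i < ?r \<Longrightarrow> j < ?c \<Longrightarrow> approximates d x (P i j) (?E i j) (M i j)" by metis
  note P = approximatesD(1,2,4)[OF PM]
  obtain n where n: "1 \<le> n" "x \<in> nc_level d n" "\<theta> x \<in> nc_level e n" by (rule free_map_level[OF \<theta> x(1)])
  define \<kappa> where "\<kappa> = op_norm (free_poly_mat_eval n (\<theta> x) \<delta>)"
  have \<kappa>: "\<kappa> < 1"
  proof -
    obtain m where m: "\<theta> x \<in> nc_level e m" "op_norm (free_poly_mat_eval m (\<theta> x) \<delta>) < 1"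
      using \<delta>(2) unfolding free_basic_def by blast
    show ?thesis using m n(3) nc_level_unique[OF e] by (metis \<kappa>_def)
  qed
  \<comment> \<open>Half of the slack \<open>1 - \<kappa>\<close> is left to the polynomials and
    half to the approximation errors.\<close>
  define \<rho> where "\<rho> = (\<kappa> + 1) / 2"
  have \<rho>: "\<kappa> < \<rho>" "\<rho> < 1" "0 < \<rho>" using \<kappa> by (auto simp: \<rho>_def \<kappa>_def intro: add_nonneg_pos)
  \<comment> \<open>Each of the \<open>?r * ?c\<close> blocks may be off by \<open>\<eta>\<close>;
    the \<open>+ 1\<close> covers an empty matrix.\<close>
  define \<eta> where "\<eta> = (1 - \<rho>) / (real ?r * real ?c + 1)"
  have \<eta>: "0 < \<eta>" "real ?r * real ?c * \<eta> \<le> 1 - \<rho>"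
  proof -
    show "0 < \<eta>" using \<rho> by (simp add: \<eta>_def add_nonneg_pos)
    have "real ?r * real ?c * \<eta> \<le> (real ?r * real ?c + 1) * \<eta>" using \<open>0 < \<eta>\<close> by (simp add: algebra_simps)
    also have "\<dots> = 1 - \<rho>"
      using add_nonneg_pos[of "real ?r * real ?c" 1] by (simp add: \<eta>_def)
    finally show "real ?r * real ?c * \<eta> \<le> 1 - \<rho>" .
  qed
  let ?U = "{w. \<exists>n\<ge>1. w \<in> nc_level d n \<and> op_norm (block_mat ?r ?c n (\<lambda>i j. P i j w)) < \<rho>}"
  have U: "?U \<in> free_opens d" by (rule free_open_block_norm_less[OF d P(1) \<rho>(3)])
  have xU: "x \<in> ?U"
  proof -
    have "dim_row (x ! 0) = n" using nc_level_nth[OF n(2) d] by auto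
    then have "block_mat ?r ?c n (\<lambda>i j. P i j x) = free_poly_mat_eval n (\<theta> x) \<delta>"
      unfolding free_poly_mat_eval_eq_block_mat by (intro block_mat_cong) (simp add: P(2))
    then show ?thesis using n \<rho>(1) by (auto simp: \<kappa>_def)
  qed
  let ?Q = "\<lambda>k w. \<forall>n. w \<in> nc_level d n \<longrightarrow> op_norm (?E (fst k) (snd k) w - P (fst k) (snd k) w) \<le> \<eta>"
  have "\<exists>W\<in>free_opens d. x \<in> W \<and> (\<forall>w\<in>W. \<forall>k\<in>{..<?r} \<times> {..<?c}. ?Q k w)"
  proof (rule finite_free_neighbourhood[OF d xs])
    fix k assume "k \<in> {..<?r} \<times> {..<?c}"
    then have k: "fst k < ?r" "snd k < ?c" by auto
    obtain T where T: "T \<in> free_opens d" "x \<in> T"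
      "\<And>n w. w \<in> T \<inter> nc_level d n \<Longrightarrow> op_norm (?E (fst k) (snd k) w - P (fst k) (snd k) w) \<le> \<eta>"
      using P(3)[OF k \<eta>(1)] by blast
    have "?Q k w" if "w \<in> T" for w using T(3) that by blast
    then show "\<exists>W\<in>free_opens d. x \<in> W \<and> (\<forall>w\<in>W. ?Q k w)" using T(1,2) by blast
  qed simp
  then obtain T where T: "T \<in> free_opens d" "x \<in> T" "\<And>w k. w \<in> T \<Longrightarrow> k \<in> {..<?r} \<times> {..<?c} \<Longrightarrow> ?Q k w"
    by blast
  have "\<theta> w \<in> V" if w: "w \<in> W \<inter> (?U \<inter> T)" for w
  proof -
    have wW: "w \<in> W" using w by blast
    obtain n where n: "1 \<le> n" "w \<in> nc_level d n" "\<theta> w \<in> nc_level e n" by (rule free_map_level[OF \<theta> wW])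
    have dim: "dim_row (w ! 0) = n" using nc_level_nth[OF n(2) d] by auto
    obtain m where "w \<in> nc_level d m" "op_norm (block_mat ?r ?c m (\<lambda>i j. P i j w)) < \<rho>" using w by blast
    then have Pn: "op_norm (block_mat ?r ?c n (\<lambda>i j. P i j w)) < \<rho>" using n(2) nc_level_unique[OF d] by metis
    have Pc: "P i j w \<in> carrier_mat n n" if "i < ?r" "j < ?c" for i j
      using is_free_poly_carrier[OF P(1)[OF that] n(2)] .
    have "free_poly_mat_eval n (\<theta> w) \<delta> = block_mat ?r ?c n (\<lambda>i j. P i j w) + block_mat ?r ?c n (\<lambda>i j. ?E i j w - P i j w)"
      unfolding free_poly_mat_eval_eq_block_mat dim
    proof (rule eq_matI)
      fix i j assume "i < dim_row (block_mat ?r ?c n (\<lambda>i j. P i j w) +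
          block_mat ?r ?c n (\<lambda>i j. free_poly_eval n (\<theta> w) (\<delta> $$ (i, j)) - P i j w))"
        "j < dim_col (block_mat ?r ?c n (\<lambda>i j. P i j w) +
          block_mat ?r ?c n (\<lambda>i j. free_poly_eval n (\<theta> w) (\<delta> $$ (i, j)) - P i j w))"
      then have ij: "i < ?r * n" "j < ?c * n" by (auto simp: block_mat_def)
      have "P (i div n) (j div n) w \<in> carrier_mat n n"
        using ij by (intro Pc) (auto simp: less_mult_imp_div_less)
      then show "block_mat ?r ?c n (\<lambda>i j. free_poly_eval n (\<theta> w) (\<delta> $$ (i, j))) $$ (i, j) =
          (block_mat ?r ?c n (\<lambda>i j. P i j w) +
           block_mat ?r ?c n (\<lambda>i j. free_poly_eval n (\<theta> w) (\<delta> $$ (i, j)) - P i j w)) $$ (i, j)"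
        using ij n(1) by (simp add: block_mat_def)
    qed (auto simp: block_mat_def)
    then have "op_norm (free_poly_mat_eval n (\<theta> w) \<delta>) \<le> op_norm (block_mat ?r ?c n (\<lambda>i j. P i j w)) +
        op_norm (block_mat ?r ?c n (\<lambda>i j. ?E i j w - P i j w))"
      using op_norm_add[OF block_mat_carrier block_mat_carrier] by simp
    also have "op_norm (block_mat ?r ?c n (\<lambda>i j. ?E i j w - P i j w)) \<le>
        (\<Sum>i<?r. \<Sum>j<?c. op_norm (?E i j w - P i j w))"
      using n(1) by (intro op_norm_block_mat_le_sum minus_carrier_mat Pc) auto
    also have "\<dots> \<le> (\<Sum>i<?r. \<Sum>j<?c. \<eta>)"
    proof (intro sum_mono)
      fix i j assume "i \<in> {..<?r}" "j \<in> {..<?c}"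
      then show "op_norm (?E i j w - P i j w) \<le> \<eta>" using T(3)[of w "(i, j)"] w n(2) by auto
    qed
    also have "\<dots> = real ?r * real ?c * \<eta>" by simp
    also have "op_norm (block_mat ?r ?c n (\<lambda>i j. P i j w)) + real ?r * real ?c * \<eta> < 1" using Pn \<eta>(2) by simp
    finally have "\<theta> w \<in> free_basic e \<delta>" using n unfolding free_basic_def by auto
    then show ?thesis using \<delta>(3) by blast
  qed
  then show "\<exists>U\<in>free_opens d. x \<in> U \<and> U \<subseteq> {x \<in> W. \<theta> x \<in> V}"
    using x(1) xU T(2) free_opens_Int[OF d W free_opens_Int[OF d U T(1)]]
    by (intro bexI[of _ "W \<inter> (?U \<inter> T)"]) auto
qed

section \<open>The manifold and its covering\<close>

lemma nc_level_2: "x \<in> nc_level 2 n \<longleftrightarrow>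
    (\<exists>a b. x = [a, b] \<and> a \<in> carrier_mat n n \<and> b \<in> carrier_mat n n)"
proof
  assume x: "x \<in> nc_level 2 n"
  then have "length x = 2" by (simp add: nc_level_def)
  then have "x = [x ! 0, x ! 1]" by (auto simp: numeral_2_eq_2 length_Suc_conv)
  then show "\<exists>a b. x = [a, b] \<and> a \<in> carrier_mat n n \<and> b \<in> carrier_mat n n"
    using nc_level_nth[OF x, of 0] nc_level_nth[OF x, of 1] by auto
qed (auto simp: nc_level_def less_2_cases_iff)

lemma nc_space_2E:
  assumes "x \<in> nc_space 2"
  obtains n a b where "1 \<le> n" "x = [a, b]" "a \<in> carrier_mat n n" "b \<in> carrier_mat n n" "x \<in> nc_level 2 n"
  using assms unfolding nc_space_iff nc_level_2 by blast

lemma nc_space_2I: "1 \<le> n \<Longrightarrow> a \<in> carrier_mat n n \<Longrightarrow> b \<in> carrier_mat n n \<Longrightarrow> [a, b] \<in> nc_space 2"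
  unfolding nc_space_iff nc_level_2 by blast

section \<open>Polynomial coordinates on pairs\<close>

definition mean_diff :: "complex mat list \<Rightarrow> complex mat list" where
  "mean_diff w = [(1/2) \<cdot>\<^sub>m (w ! 0 + w ! 1), (1/2) \<cdot>\<^sub>m (w ! 0 - w ! 1)]"

text \<open>The first two components of \<open>cover\<close>. On every sheet this one polynomial map
  inverts \<open>omega\<close>, whatever \<open>\<gamma>\<close> and \<open>\<tau>\<close>.\<close>

definition mean_square :: "complex mat list \<Rightarrow> complex mat list" where
  "mean_square w = [(1/2) \<cdot>\<^sub>m (w ! 0 + w ! 1), (1/4) \<cdot>\<^sub>m ((w ! 0 - w ! 1) * (w ! 0 - w ! 1))]"

lemma free_map_pairI:
  assumes W: "W \<in> free_opens d" and g: "nc_function d W g" and h: "nc_function d W h"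
    and ag: "\<And>x. x \<in> W \<Longrightarrow> approx_at d x g" and ah: "\<And>x. x \<in> W \<Longrightarrow> approx_at d x h"
  shows "free_map d 2 W (\<lambda>x. [g x, h x])"
  unfolding free_map_def
proof (intro conjI ballI allI impI)
  show "nc_map d 2 W (\<lambda>x. [g x, h x])" by (rule nc_map_pair[OF g h])
  fix x i assume "x \<in> W" "i < (2::nat)"
  then show "approx_at d x (\<lambda>w. [g w, h w] ! i)" using ag ah by (auto simp: less_2_cases_iff)
qed (rule W)

lemma nc_functions_mean:
  assumes W: "nc_set 2 W"
  shows "nc_function 2 W (\<lambda>w. (1/2) \<cdot>\<^sub>m (w ! 0 + w ! 1))" "nc_function 2 W (\<lambda>w. (1/2) \<cdot>\<^sub>m (w ! 0 - w ! 1))"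
    "nc_function 2 W (\<lambda>w. (1/4) \<cdot>\<^sub>m ((w ! 0 - w ! 1) * (w ! 0 - w ! 1)))"
  by (intro nc_function_smult nc_function_mult nc_function_add nc_function_minus nc_function_coord[OF W]; simp)+

lemma free_map_mean_diff: "free_map 2 2 (nc_space 2) mean_diff"
  unfolding mean_diff_def[abs_def]
  by (rule free_map_pairI[OF nc_space_open nc_functions_mean(1,2)[OF nc_set_nc_space]])
    (auto intro!: approx_at_poly is_free_poly_smult is_free_poly_add is_free_poly_minus is_free_poly_coord)

lemma free_map_mean_square: "free_map 2 2 (nc_space 2) mean_square"
  unfolding mean_square_def[abs_def]
  by (rule free_map_pairI[OF nc_space_open nc_functions_mean(1,3)[OF nc_set_nc_space]])
    (auto intro!: approx_at_poly is_free_poly_smult is_free_poly_mult is_free_poly_add is_free_poly_minus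
      is_free_poly_coord)

lemma free_map_subset:
  assumes "free_map d e W \<theta>" "V \<in> free_opens d" "nc_set d V" "V \<subseteq> W"
  shows "free_map d e V \<theta>"
  using assms nc_map_subset[of d e W \<theta> V] unfolding free_map_def by auto

text \<open>Exchanging the components negates their difference, which enters \<open>cover\<close>
  twice or not at all in each component.\<close>

lemma cover_flip:
  assumes "w \<in> nc_space 2"
  shows "cover (flip w) = cover w"
proof -
  obtain n a b where w: "w = [a, b]" and c: "a \<in> carrier_mat n n" "b \<in> carrier_mat n n"
    using assms by (rule nc_space_2E)
  have add: "b + a = a + b" using c by (intro eq_matI) auto
  have neg: "b - a = (-1) \<cdot>\<^sub>m (a - b)" using c by (intro eq_matI) auto
  have d: "a - b \<in> carrier_mat n n" "a + b \<in> carrier_mat n n" using c by auto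
  have mm: "((-1) \<cdot>\<^sub>m X) * Y = (-1) \<cdot>\<^sub>m (X * Y)" "X * ((-1) \<cdot>\<^sub>m Y) = (-1) \<cdot>\<^sub>m (X * Y)"
    if "X \<in> carrier_mat n n" "Y \<in> carrier_mat n n" for X Y :: "complex mat"
    using that by (simp_all add: square_mat_simps[where n = n])
  have nn: "(-1) \<cdot>\<^sub>m ((-1) \<cdot>\<^sub>m X) = X" for X :: "complex mat" by (intro eq_matI) auto
  have sq: "X ^\<^sub>m 2 = X * X" if "X \<in> carrier_mat n n" for X :: "complex mat"
    using that by (simp add: numeral_2_eq_2)
  have "(b - a) ^\<^sub>m 2 = (a - b) ^\<^sub>m 2"
    unfolding neg using d by (simp add: sq mm nn mult_carrier_mat[of _ n n _ n])
  moreover have "(b - a) * (b + a) * (b - a) = (a - b) * (a + b) * (a - b)"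
    unfolding neg add using d by (simp add: mm nn mult_carrier_mat[of _ n n _ n])
  ultimately show ?thesis by (simp add: cover_def flip_def w add)
qed

section \<open>Branches of the square root and the chart domains\<close>

locale sqrt_branches =
  fixes r :: "complex set \<Rightarrow> real" and s :: "complex set \<Rightarrow> complex \<Rightarrow> complex"
  assumes choice: "branch_choice r s"
begin

definition branch :: "complex set \<Rightarrow> (complex \<Rightarrow> complex) \<Rightarrow> complex \<Rightarrow> complex" where
  "branch \<gamma> \<tau> z = s \<gamma> z * iota r \<gamma> \<tau> z"

lemma
  assumes "\<gamma> \<in> Gam"
  shows radius_pos: "0 < r \<gamma>" and radius_less: "c \<in> \<gamma> \<Longrightarrow> r \<gamma> < cmod c"
    and radius_dist: "c \<in> \<gamma> \<Longrightarrow> d \<in> \<gamma> \<Longrightarrow> c \<noteq> d \<Longrightarrow> 4 * r \<gamma> < dist c d"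
    and s_holomorphic: "s \<gamma> holomorphic_on Disc r \<gamma>" and s_square: "z \<in> Disc r \<gamma> \<Longrightarrow> (s \<gamma> z)\<^sup>2 = z"
  using choice assms by (force simp: branch_choice_def dist_norm)+

lemma Disc_eq: "Disc r \<gamma> = (\<Union>c\<in>\<gamma>. ball c (r \<gamma>))"
  by (auto simp: Disc_def dist_norm norm_minus_commute)

lemma Disc_open: "open (Disc r \<gamma>)"
  unfolding Disc_eq by auto

lemma iota_eq:
  assumes \<gamma>: "\<gamma> \<in> Gam" and c: "c \<in> \<gamma>" and z: "z \<in> ball c (r \<gamma>)"
  shows "iota r \<gamma> \<tau> z = \<tau> c"
proof -
  have "(THE c. c \<in> \<gamma> \<and> cmod (z - c) < r \<gamma>) = c"
  proof (rule the_equality)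
    fix d assume d: "d \<in> \<gamma> \<and> cmod (z - d) < r \<gamma>"
    show "d = c"
    proof (rule ccontr)
      assume "d \<noteq> c"
      then have "4 * r \<gamma> < dist c d" using radius_dist[OF \<gamma> c] d by auto
      moreover have "dist c d \<le> dist c z + dist z d" by (rule dist_triangle)
      ultimately show False using z d radius_pos[OF \<gamma>] by (simp add: dist_norm norm_minus_commute)
    qed
  qed (use c z in \<open>auto simp: dist_norm norm_minus_commute\<close>)
  then show ?thesis by (simp add: iota_def)
qed

lemma iota_holomorphic:
  assumes \<gamma>: "\<gamma> \<in> Gam"
  shows "iota r \<gamma> \<tau> holomorphic_on Disc r \<gamma>"
  unfolding Disc_eq
proof (rule holomorphic_on_UN_open)
  fix c assume c: "c \<in> \<gamma>"
  have "(\<lambda>_. \<tau> c) holomorphic_on ball c (r \<gamma>)" by (rule holomorphic_on_const)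
  then show "iota r \<gamma> \<tau> holomorphic_on ball c (r \<gamma>)"
    by (rule holomorphic_transform) (simp add: iota_eq[OF \<gamma> c])
qed auto

lemma iota_square:
  assumes \<gamma>: "\<gamma> \<in> Gam" and \<tau>: "\<tau> \<in> signs \<gamma>" and z: "z \<in> Disc r \<gamma>"
  shows "iota r \<gamma> \<tau> z * iota r \<gamma> \<tau> z = 1"
proof -
  obtain c where c: "c \<in> \<gamma>" "z \<in> ball c (r \<gamma>)" using z unfolding Disc_eq by blast
  then have "\<tau> c = -1 \<or> \<tau> c = 1" using \<tau> by (auto simp: signs_def)
  then show ?thesis unfolding iota_eq[OF \<gamma> c] by auto
qed

lemma branch_holomorphic: "\<gamma> \<in> Gam \<Longrightarrow> branch \<gamma> \<tau> holomorphic_on Disc r \<gamma>"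
  unfolding branch_def[abs_def] by (intro holomorphic_on_mult s_holomorphic iota_holomorphic)

lemma branch_square:
  assumes "\<gamma> \<in> Gam" "\<tau> \<in> signs \<gamma>" "z \<in> Disc r \<gamma>"
  shows "branch \<gamma> \<tau> z * branch \<gamma> \<tau> z = z"
proof -
  have "branch \<gamma> \<tau> z * branch \<gamma> \<tau> z = (s \<gamma> z)\<^sup>2 * (iota r \<gamma> \<tau> z * iota r \<gamma> \<tau> z)"
    by (simp add: branch_def power2_eq_square mult_ac)
  then show ?thesis using assms by (simp add: iota_square s_square)
qed

lemma zero_notin_Disc: "\<gamma> \<in> Gam \<Longrightarrow> 0 \<notin> Disc r \<gamma>"
  using radius_less unfolding Disc_def by force

lemma branch_nonzero:
  assumes "\<gamma> \<in> Gam" "\<tau> \<in> signs \<gamma>" "z \<in> Disc r \<gamma>"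
  shows "branch \<gamma> \<tau> z \<noteq> 0"
  using branch_square[OF assms] zero_notin_Disc[OF assms(1)] assms(3) by auto

lemma S_mat_eq: "S_mat r s \<gamma> \<tau> x = hol_calculus (branch \<gamma> \<tau>) x"
  by (simp add: S_mat_def branch_def[abs_def])

lemma S_mat_square:
  assumes \<gamma>: "\<gamma> \<in> Gam" "\<tau> \<in> signs \<gamma>" and x: "x \<in> carrier_mat n n" "spectrum x \<subseteq> Disc r \<gamma>"
  shows "S_mat r s \<gamma> \<tau> x * S_mat r s \<gamma> \<tau> x = x"
proof -
  note b = branch_holomorphic[OF \<gamma>(1), of \<tau>]
  have "S_mat r s \<gamma> \<tau> x * S_mat r s \<gamma> \<tau> x = hol_calculus (\<lambda>z. branch \<gamma> \<tau> z * branch \<gamma> \<tau> z) x"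
    unfolding S_mat_eq by (rule hol_calculus_mult[OF x(1) Disc_open x(2) b b, symmetric])
  also have "\<dots> = poly_mat [:0, 1:] x"
    by (rule hol_calculus_poly[OF x(1) Disc_open x(2)]) (simp add: branch_square[OF \<gamma>])
  finally show ?thesis using poly_mat_X[OF x(1)] by simp
qed

lemma I_mat_square:
  assumes \<gamma>: "\<gamma> \<in> Gam" "\<tau> \<in> signs \<gamma>" and x: "x \<in> carrier_mat n n" "spectrum x \<subseteq> Disc r \<gamma>"
  shows "I_mat r \<gamma> \<tau> x * I_mat r \<gamma> \<tau> x = 1\<^sub>m n"
proof -
  note b = iota_holomorphic[OF \<gamma>(1), of \<tau>]
  have "I_mat r \<gamma> \<tau> x * I_mat r \<gamma> \<tau> x = hol_calculus (\<lambda>z. iota r \<gamma> \<tau> z * iota r \<gamma> \<tau> z) x"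
    unfolding I_mat_def by (rule hol_calculus_mult[OF x(1) Disc_open x(2) b b, symmetric])
  also have "\<dots> = poly_mat 1 x"
    by (rule hol_calculus_poly[OF x(1) Disc_open x(2)]) (simp add: iota_square[OF \<gamma>])
  finally show ?thesis using poly_mat_1[OF x(1)] by simp
qed

lemma hol_calculus_uminus:
  assumes x: "x \<in> carrier_mat n n" "open X" "spectrum x \<subseteq> X" and f: "f holomorphic_on X"
    and eq: "\<And>z. z \<in> X \<Longrightarrow> g z = - f z"
  shows "hol_calculus g x = (-1) \<cdot>\<^sub>m hol_calculus f x"
proof -
  have "hol_calculus g x = hol_calculus (\<lambda>z. (-1) * f z) x"
    by (rule hol_calculus_cong[OF x]) (simp add: eq)
  also have "\<dots> = hol_calculus (\<lambda>_. -1) x * hol_calculus f x"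
    by (rule hol_calculus_mult[OF x _ f]) (rule holomorphic_on_const)
  also have "hol_calculus (\<lambda>_. -1) x = (-1) \<cdot>\<^sub>m 1\<^sub>m n"
    using hol_calculus_poly[OF x, of "\<lambda>_. -1" "[:-1:]"] poly_mat_const[OF x(1), of "-1"] by simp
  finally show ?thesis using x(1) by (simp add: square_mat_simps[where n = n])
qed

text \<open>\<open>U_gam\<close> without the noncommutation conditions. This larger set is freely
  open, and \<open>omega\<close> is already a free map on it; \<open>U_gam\<close> is obtained from
  it by removing varieties.\<close>

definition chart_domain :: "complex set \<Rightarrow> complex mat list set" where
  "chart_domain \<gamma> = spectral_domain 2 1 (Disc r \<gamma>)"

lemma chart_domain_open: "chart_domain \<gamma> \<in> free_opens 2"
  unfolding chart_domain_def by (rule spectral_domain_open[OF _ Disc_open]) simp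

lemma chart_domain_iff: "p \<in> chart_domain \<gamma> \<longleftrightarrow> p \<in> nc_space 2 \<and> spectrum (p ! 1) \<subseteq> Disc r \<gamma>"
  by (simp add: chart_domain_def spectral_domain_def)

lemma chart_domainE:
  assumes "p \<in> chart_domain \<gamma>"
  obtains n u x where "1 \<le> n" "p = [u, x]" "u \<in> carrier_mat n n" "x \<in> carrier_mat n n"
    "spectrum x \<subseteq> Disc r \<gamma>" "p \<in> nc_level 2 n"
proof -
  have "p \<in> nc_space 2" "spectrum (p ! 1) \<subseteq> Disc r \<gamma>" using assms by (auto simp: chart_domain_iff)
  moreover obtain n u x where "1 \<le> n" "p = [u, x]" "u \<in> carrier_mat n n" "x \<in> carrier_mat n n" "p \<in> nc_level 2 n"
    using calculation(1) by (rule nc_space_2E)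
  ultimately show thesis using that by simp
qed

lemma chart_domain_nc: "nc_set 2 (chart_domain \<gamma>)"
  unfolding chart_domain_def by (rule nc_set_spectral_domain) simp

lemma nc_function_calculus:
  assumes "f holomorphic_on Disc r \<gamma>"
  shows "nc_function 2 (chart_domain \<gamma>) (\<lambda>p. hol_calculus f (p ! 1))"
  unfolding chart_domain_def by (rule nc_function_hol_calculus[OF _ Disc_open assms]) simp

lemma approx_at_calculus:
  assumes "f holomorphic_on Disc r \<gamma>" "p \<in> chart_domain \<gamma>"
  shows "approx_at 2 p (\<lambda>p. hol_calculus f (p ! 1))"
  using assms unfolding chart_domain_def by (intro approx_at_hol_calculus(1)[OF _ _ Disc_open]) auto

lemma approx_at_coord: "i < 2 \<Longrightarrow> p \<in> chart_domain \<gamma> \<Longrightarrow> approx_at 2 p (\<lambda>p. p ! i)"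
  by (intro approx_at_poly is_free_poly_coord) (auto simp: chart_domain_iff)

lemma free_map_omega:
  assumes \<gamma>: "\<gamma> \<in> Gam"
  shows "free_map 2 2 (chart_domain \<gamma>) (omega r s \<gamma> \<tau>)"
proof -
  note b = branch_holomorphic[OF \<gamma>, of \<tau>]
  have ns: "nc_function 2 (chart_domain \<gamma>) (\<lambda>p. S_mat r s \<gamma> \<tau> (p ! 1))"
    unfolding S_mat_eq by (rule nc_function_calculus[OF b])
  have as: "approx_at 2 p (\<lambda>p. S_mat r s \<gamma> \<tau> (p ! 1))" if "p \<in> chart_domain \<gamma>" for p
    unfolding S_mat_eq by (rule approx_at_calculus[OF b that])
  have n0: "nc_function 2 (chart_domain \<gamma>) (\<lambda>p. p ! 0)" by (rule nc_function_coord[OF chart_domain_nc]) simp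
  show ?thesis unfolding omega_def[abs_def]
  proof (rule free_map_pairI[OF chart_domain_open nc_function_add[OF n0 ns] nc_function_minus[OF n0 ns]])
    fix p assume p: "p \<in> chart_domain \<gamma>"
    then have ps: "p \<in> nc_space 2" by (simp add: chart_domain_iff)
    show "approx_at 2 p (\<lambda>p. p ! 0 + S_mat r s \<gamma> \<tau> (p ! 1))"
      using p by (intro approx_at_add[OF _ ps] as approx_at_coord) auto
    show "approx_at 2 p (\<lambda>p. p ! 0 - S_mat r s \<gamma> \<tau> (p ! 1))"
      using p by (intro approx_at_minus[OF _ ps] as approx_at_coord) auto
  qed
qed

abbreviation nonconstant_signs :: "complex set \<Rightarrow> (complex \<Rightarrow> complex) set" where
  "nonconstant_signs \<gamma> \<equiv> {\<tau> \<in> signs \<gamma>. \<not> \<tau> constant_on \<gamma>}"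

lemma U_gam_iff:
  "p \<in> U_gam r \<gamma> \<longleftrightarrow> p \<in> chart_domain \<gamma> \<and>
    (\<forall>\<tau>\<in>nonconstant_signs \<gamma>. p ! 0 * I_mat r \<gamma> \<tau> (p ! 1) \<noteq> I_mat r \<gamma> \<tau> (p ! 1) * p ! 0)"
proof -
  have "p ! 1 \<in> Dom r \<gamma> \<longleftrightarrow> spectrum (p ! 1) \<subseteq> Disc r \<gamma>" if ps: "p \<in> nc_space 2"
  proof -
    obtain n where "1 \<le> n" "p ! 1 \<in> carrier_mat n n" using ps by (auto elim: nc_space_2E)
    then show ?thesis by (auto simp: Dom_def)
  qed
  then show ?thesis by (auto simp: U_gam_def chart_domain_iff)
qed

lemma U_gam_subset: "U_gam r \<gamma> \<subseteq> chart_domain \<gamma>"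
  by (auto simp: U_gam_iff)

lemma nc_function_products:
  assumes \<gamma>: "\<gamma> \<in> Gam"
  shows "nc_function 2 (chart_domain \<gamma>) (\<lambda>p. p ! 0 * I_mat r \<gamma> \<tau> (p ! 1))"
    "nc_function 2 (chart_domain \<gamma>) (\<lambda>p. I_mat r \<gamma> \<tau> (p ! 1) * p ! 0)"
proof -
  have I: "nc_function 2 (chart_domain \<gamma>) (\<lambda>p. I_mat r \<gamma> \<tau> (p ! 1))"
    unfolding I_mat_def by (rule nc_function_calculus[OF iota_holomorphic[OF \<gamma>]])
  have u: "nc_function 2 (chart_domain \<gamma>) (\<lambda>p. p ! 0)" by (rule nc_function_coord[OF chart_domain_nc]) simp
  show "nc_function 2 (chart_domain \<gamma>) (\<lambda>p. p ! 0 * I_mat r \<gamma> \<tau> (p ! 1))"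
    by (rule nc_function_mult[OF u I])
  show "nc_function 2 (chart_domain \<gamma>) (\<lambda>p. I_mat r \<gamma> \<tau> (p ! 1) * p ! 0)"
    by (rule nc_function_mult[OF I u])
qed

text \<open>If a direct sum commutes with an involution, each summand does, so noncommutation of one
  summand is enough.\<close>

lemma U_gam_nc:
  assumes \<gamma>: "\<gamma> \<in> Gam"
  shows "nc_set 2 (U_gam r \<gamma>)"
proof -
  have "map2 direct_sum p q \<in> U_gam r \<gamma>" if p: "p \<in> U_gam r \<gamma>" and q: "q \<in> U_gam r \<gamma>" for p q
    unfolding U_gam_iff
  proof (intro conjI ballI notI)
    have pW: "p \<in> chart_domain \<gamma>" and qW: "q \<in> chart_domain \<gamma>" using p q U_gam_subset by auto
    then show "map2 direct_sum p q \<in> chart_domain \<gamma>" using chart_domain_nc by (simp add: nc_set_def)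
    fix \<tau> assume \<tau>: "\<tau> \<in> nonconstant_signs \<gamma>"
    let ?a = "\<lambda>p. p ! 0 * I_mat r \<gamma> \<tau> (p ! 1)" and ?b = "\<lambda>p. I_mat r \<gamma> \<tau> (p ! 1) * p ! 0"
    note fa = nc_functionD[OF nc_function_products(1)[OF \<gamma>, of \<tau>]]
      and fb = nc_functionD[OF nc_function_products(2)[OF \<gamma>, of \<tau>]]
    assume "?a (map2 direct_sum p q) = ?b (map2 direct_sum p q)"
    then have eq: "direct_sum (?a p) (?a q) = direct_sum (?b p) (?b q)"
      using fa(3)[OF pW qW] fb(3)[OF pW qW] by simp
    obtain n where n: "1 \<le> n" "p \<in> nc_level 2 n" using pW by (rule chart_domainE)
    obtain m where m: "1 \<le> m" "q \<in> nc_level 2 m" using qW by (rule chart_domainE)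
    have "?a p = ?b p"
      by (rule direct_sum_inject(1)[OF fa(2)[OF n(1) pW n(2)] fb(2)[OF n(1) pW n(2)]
            fa(2)[OF m(1) qW m(2)] fb(2)[OF m(1) qW m(2)] eq])
    then show False using p \<tau> unfolding U_gam_iff by blast
  qed
  moreover have "U_gam r \<gamma> \<subseteq> nc_space 2" by (auto simp: U_gam_iff chart_domain_iff)
  ultimately show ?thesis by (simp add: nc_set_def)
qed

text \<open>Each nonconstant sign function removes the variety where one commutator vanishes. There
  are finitely many of them, because \<open>\<gamma>\<close> is finite and \<open>signs\<close>
  contains extensional functions only.\<close>

lemma U_gam_open:
  assumes \<gamma>: "\<gamma> \<in> Gam"
  shows "U_gam r \<gamma> \<in> zariski_free_opens 2"
proof -
  let ?g = "\<lambda>\<tau> p. p ! 0 * I_mat r \<gamma> \<tau> (p ! 1) - I_mat r \<gamma> \<tau> (p ! 1) * p ! 0"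
  let ?V = "(\<lambda>\<tau>. zero_set (chart_domain \<gamma>) {?g \<tau>}) ` nonconstant_signs \<gamma>"
  have "tau_holomorphic 2 (free_opens 2) (chart_domain \<gamma>) (?g \<tau>)" for \<tau>
  proof (rule free_holomorphicI[OF _ chart_domain_open])
    show "nc_function 2 (chart_domain \<gamma>) (?g \<tau>)" by (rule nc_function_minus[OF nc_function_products[OF \<gamma>]])
    fix p assume p: "p \<in> chart_domain \<gamma>"
    then have ps: "p \<in> nc_space 2" by (simp add: chart_domain_iff)
    have "approx_at 2 p (\<lambda>p. I_mat r \<gamma> \<tau> (p ! 1))"
      unfolding I_mat_def by (rule approx_at_calculus[OF iota_holomorphic[OF \<gamma>] p])
    then show "approx_at 2 p (?g \<tau>)"
      using p by (intro approx_at_minus[OF _ ps] approx_at_mult[OF _ ps] approx_at_coord) auto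
  qed simp
  then have "zero_set (chart_domain \<gamma>) {?g \<tau>} \<in> free_varieties 2 (chart_domain \<gamma>)" for \<tau>
    unfolding free_varieties_def by (intro CollectI exI[of _ "{?g \<tau>}"]) simp
  then have sub: "?V \<subseteq> free_varieties 2 (chart_domain \<gamma>)" by blast
  have fin: "finite ?V"
    using \<gamma> by (auto simp: signs_def Gam_def intro!: finite_imageI finite_Collect_conjI finite_PiE)
  have zero_iff: "?g \<tau> p = 0\<^sub>m (dim_row (?g \<tau> p)) (dim_col (?g \<tau> p)) \<longleftrightarrow>
      p ! 0 * I_mat r \<gamma> \<tau> (p ! 1) = I_mat r \<gamma> \<tau> (p ! 1) * p ! 0" if p: "p \<in> chart_domain \<gamma>" for p \<tau>
  proof -
    obtain n where n: "1 \<le> n" "p \<in> nc_level 2 n" using p by (rule chart_domainE)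
    have c: "p ! 0 * I_mat r \<gamma> \<tau> (p ! 1) \<in> carrier_mat n n" "I_mat r \<gamma> \<tau> (p ! 1) * p ! 0 \<in> carrier_mat n n"
      using nc_functionD(2)[OF nc_function_products(1)[OF \<gamma>] n(1) p n(2)]
        nc_functionD(2)[OF nc_function_products(2)[OF \<gamma>] n(1) p n(2)] by auto
    have "A - B = 0\<^sub>m (dim_row (A - B)) (dim_col (A - B)) \<longleftrightarrow> A = B"
      if "A \<in> carrier_mat n n" "B \<in> carrier_mat n n" for A B :: "complex mat"
    proof
      assume eq: "A - B = 0\<^sub>m (dim_row (A - B)) (dim_col (A - B))"
      show "A = B"
      proof (rule eq_matI)
        fix i j assume "i < dim_row B" "j < dim_col B"
        then show "A $$ (i, j) = B $$ (i, j)"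
          using arg_cong[OF eq, of "\<lambda>M. M $$ (i, j)"] that by auto
      qed (use that in auto)
    qed (use that in \<open>auto intro!: eq_matI\<close>)
    from this[OF c] show ?thesis .
  qed
  have "U_gam r \<gamma> = chart_domain \<gamma> - \<Union>?V"
  proof (intro equalityI subsetI)
    fix p assume "p \<in> U_gam r \<gamma>"
    then show "p \<in> chart_domain \<gamma> - \<Union>?V" using zero_iff unfolding U_gam_iff by auto
  next
    fix p assume "p \<in> chart_domain \<gamma> - \<Union>?V"
    then show "p \<in> U_gam r \<gamma>" using zero_iff unfolding U_gam_iff by auto
  qed
  then show ?thesis using zariski_base_open[OF zariski_baseI[OF chart_domain_open fin sub]] by simp
qed

section \<open>The range of a branch and the sheet over a chart\<close>

definition branch_range :: "complex set \<Rightarrow> (complex \<Rightarrow> complex) \<Rightarrow> complex set" where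
  "branch_range \<gamma> \<tau> = {z. z\<^sup>2 \<in> Disc r \<gamma> \<and> branch \<gamma> \<tau> (z\<^sup>2) = z}"

text \<open>At \<open>z^2\<close> the branch takes the value \<open>z\<close> or \<open>-z\<close>,
  and \<open>z\<close> is nonzero. So the equation that selects \<open>z\<close> is equivalent to
  the open condition that the value is closer to \<open>z\<close> than
  \<open>cmod z\<close>.\<close>

lemma branch_range_open:
  assumes \<gamma>: "\<gamma> \<in> Gam" "\<tau> \<in> signs \<gamma>"
  shows "open (branch_range \<gamma> \<tau>)"
proof -
  let ?Q = "(\<lambda>z. z\<^sup>2) -` Disc r \<gamma>" and ?b = "branch \<gamma> \<tau>"
  have Q: "open ?Q" by (intro open_vimage Disc_open continuous_intros)
  have "continuous_on ?Q (?b \<circ> (\<lambda>z. z\<^sup>2))"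
    using holomorphic_on_imp_continuous_on[OF branch_holomorphic[OF \<gamma>(1), of \<tau>]]
    by (intro continuous_on_compose continuous_intros) (auto intro: continuous_on_subset)
  then have "continuous_on ?Q (\<lambda>z. cmod z - cmod (?b (z\<^sup>2) - z))"
    unfolding o_def by (intro continuous_intros)
  then have "open ((\<lambda>z. cmod z - cmod (?b (z\<^sup>2) - z)) -` {0<..} \<inter> ?Q)"
    using Q by (simp add: continuous_on_open_vimage)
  also have "(\<lambda>z. cmod z - cmod (?b (z\<^sup>2) - z)) -` {0<..} \<inter> ?Q = branch_range \<gamma> \<tau>"
  proof (intro equalityI subsetI)
    fix z assume z: "z \<in> (\<lambda>z. cmod z - cmod (?b (z\<^sup>2) - z)) -` {0<..} \<inter> ?Q"
    then have zd: "z\<^sup>2 \<in> Disc r \<gamma>" "cmod (?b (z\<^sup>2) - z) < cmod z" by auto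
    have "(?b (z\<^sup>2))\<^sup>2 = z\<^sup>2" using branch_square[OF \<gamma> zd(1)] by (simp add: power2_eq_square)
    then have "?b (z\<^sup>2) = z \<or> ?b (z\<^sup>2) = - z" by (simp add: power2_eq_iff)
    moreover have "?b (z\<^sup>2) \<noteq> - z"
    proof
      assume "?b (z\<^sup>2) = - z"
      then have "cmod (?b (z\<^sup>2) - z) = 2 * cmod z" by (simp add: norm_mult flip: mult_2)
      then show False using zd(2) norm_ge_zero[of z] by linarith
    qed
    ultimately show "z \<in> branch_range \<gamma> \<tau>" using zd by (simp add: branch_range_def)
  next
    fix z assume z: "z \<in> branch_range \<gamma> \<tau>"
    then have "z \<noteq> 0" using zero_notin_Disc[OF \<gamma>(1)] by (auto simp: branch_range_def)
    then show "z \<in> (\<lambda>z. cmod z - cmod (?b (z\<^sup>2) - z)) -` {0<..} \<inter> ?Q" using z by (simp add: branch_range_def)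
  qed
  finally show ?thesis .
qed

text \<open>A description through the spectrum of half the difference, without \<open>omega\<close>,
  from which free openness follows by pullback. It turns out to be the image of
  \<open>chart_domain\<close> under \<open>omega\<close>.\<close>

definition sheet_domain :: "complex set \<Rightarrow> (complex \<Rightarrow> complex) \<Rightarrow> complex mat list set" where
  "sheet_domain \<gamma> \<tau> = {w \<in> nc_space 2. mean_diff w \<in> spectral_domain 2 1 (branch_range \<gamma> \<tau>)}"

lemma sheet_domain_open:
  assumes "\<gamma> \<in> Gam" "\<tau> \<in> signs \<gamma>"
  shows "sheet_domain \<gamma> \<tau> \<in> free_opens 2"
  unfolding sheet_domain_def
  by (rule free_opens_pullback[OF _ _ free_map_mean_diff spectral_domain_open[OF _ branch_range_open[OF assms]]]) auto

lemma sheet_domain_nc: "nc_set 2 (sheet_domain \<gamma> \<tau>)"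
proof -
  have m: "nc_map 2 2 (nc_space 2) mean_diff" using free_map_mean_diff by (simp add: free_map_def)
  have n: "nc_set 2 (spectral_domain 2 1 (branch_range \<gamma> \<tau>))" by (rule nc_set_spectral_domain) simp
  show ?thesis
    unfolding sheet_domain_def by (rule nc_functionD(1)[OF nc_function_comp[OF m nc_function_coord[OF n, of 0]]]) simp
qed

lemma free_map_mean_square_sheet:
  assumes "\<gamma> \<in> Gam" "\<tau> \<in> signs \<gamma>"
  shows "free_map 2 2 (sheet_domain \<gamma> \<tau>) mean_square"
  by (rule free_map_subset[OF free_map_mean_square sheet_domain_open[OF assms] sheet_domain_nc]) (auto simp: sheet_domain_def)

text \<open>The spectrum of the root lies in the range of the branch by spectral mapping; both
  identities then come from the fact that the root squares to \<open>x\<close>.\<close>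

lemma omega_in_sheet_domain:
  assumes \<gamma>: "\<gamma> \<in> Gam" "\<tau> \<in> signs \<gamma>" and p: "p \<in> chart_domain \<gamma>"
  shows "omega r s \<gamma> \<tau> p \<in> sheet_domain \<gamma> \<tau>" "mean_square (omega r s \<gamma> \<tau> p) = p"
    "cover (omega r s \<gamma> \<tau> p) = Phi r s \<gamma> \<tau> p"
proof -
  obtain n u x where n: "1 \<le> n" "p = [u, x]" "u \<in> carrier_mat n n" "x \<in> carrier_mat n n" "spectrum x \<subseteq> Disc r \<gamma>"
    using p by (rule chart_domainE)
  let ?S = "S_mat r s \<gamma> \<tau> x"
  have S: "?S \<in> carrier_mat n n" using n(4) by (simp add: S_mat_eq)
  note SS = S_mat_square[OF \<gamma> n(4,5)]
  have om: "omega r s \<gamma> \<tau> p = [u + ?S, u - ?S]" by (simp add: omega_def n(2))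
  have a: "u + ?S + (u - ?S) = 2 \<cdot>\<^sub>m u" "u + ?S - (u - ?S) = 2 \<cdot>\<^sub>m ?S"
    using n(3) S by (auto intro!: eq_matI)
  have sm: "c \<cdot>\<^sub>m (c' \<cdot>\<^sub>m X) = (c * c') \<cdot>\<^sub>m X" "1 \<cdot>\<^sub>m X = X" for c c' and X :: "complex mat"
    by (auto intro!: eq_matI)
  have om_space: "omega r s \<gamma> \<tau> p \<in> nc_space 2"
    unfolding om using n(1,3) S by (intro nc_space_2I[of n]) auto
  have md: "mean_diff (omega r s \<gamma> \<tau> p) = [u, ?S]" by (simp add: om mean_diff_def a sm)
  have "spectrum ?S \<subseteq> branch_range \<gamma> \<tau>"
  proof
    fix k assume "k \<in> spectrum ?S"
    then obtain l where l: "l \<in> spectrum x" "k = branch \<gamma> \<tau> l"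
      using spectrum_hol_calculus[OF n(4) Disc_open n(5) branch_holomorphic[OF \<gamma>(1), of \<tau>]]
      unfolding S_mat_eq by blast
    then have "k\<^sup>2 = l" using branch_square[OF \<gamma>, of l] n(5) by (auto simp: power2_eq_square)
    then show "k \<in> branch_range \<gamma> \<tau>" using l n(5) by (auto simp: branch_range_def)
  qed
  then show "omega r s \<gamma> \<tau> p \<in> sheet_domain \<gamma> \<tau>"
    using om_space nc_space_2I[OF n(1,3) S] by (simp add: sheet_domain_def md spectral_domain_def)
  have SS2: "(2 \<cdot>\<^sub>m ?S) * (2 \<cdot>\<^sub>m ?S) = 4 \<cdot>\<^sub>m x"
    using S SS by (simp add: square_mat_simps[where n = n] sm)
  show "mean_square (omega r s \<gamma> \<tau> p) = p"
    unfolding om by (simp add: mean_square_def a SS2 sm n(2))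
  have "(2 \<cdot>\<^sub>m ?S) ^\<^sub>m 2 = 4 \<cdot>\<^sub>m x" using S SS2 by (simp add: numeral_2_eq_2)
  moreover have "(2 \<cdot>\<^sub>m ?S) * (2 \<cdot>\<^sub>m u) * (2 \<cdot>\<^sub>m ?S) = 8 \<cdot>\<^sub>m (?S * u * ?S)"
    using S n(3) by (simp add: square_mat_simps[where n = n] sm)
  ultimately show "cover (omega r s \<gamma> \<tau> p) = Phi r s \<gamma> \<tau> p"
    unfolding om by (simp add: cover_def Phi_def a sm n(2))
qed

text \<open>Half the difference is the chosen root of its own square, because the branch inverts
  squaring on an open set around its spectrum.\<close>

lemma mean_square_in_chart_domain:
  assumes \<gamma>: "\<gamma> \<in> Gam" "\<tau> \<in> signs \<gamma>" and w: "w \<in> sheet_domain \<gamma> \<tau>"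
  shows "mean_square w \<in> chart_domain \<gamma>" "omega r s \<gamma> \<tau> (mean_square w) = w"
proof -
  have ws: "w \<in> nc_space 2" using w by (simp add: sheet_domain_def)
  obtain n a b where n: "1 \<le> n" "w = [a, b]" "a \<in> carrier_mat n n" "b \<in> carrier_mat n n"
    using ws by (rule nc_space_2E)
  define v where "v = (1/2) \<cdot>\<^sub>m (a - b)"
  have v: "v \<in> carrier_mat n n" using n by (auto simp: v_def)
  have vs: "spectrum v \<subseteq> branch_range \<gamma> \<tau>" using w by (simp add: sheet_domain_def spectral_domain_def mean_diff_def n(2) v_def)
  have vv: "v * v \<in> carrier_mat n n" using v by auto
  have ab: "a - b \<in> carrier_mat n n" using n by auto
  have ms: "mean_square w = [(1/2) \<cdot>\<^sub>m (a + b), v * v]"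
    using ab by (simp add: mean_square_def n(2) v_def square_mat_simps[where n = n]) (intro eq_matI; simp)
  have vvs: "spectrum (v * v) \<subseteq> Disc r \<gamma>"
  proof
    fix k assume "k \<in> spectrum (v * v)"
    then obtain l where "l \<in> spectrum v" "k = poly [:0, 0, 1:] l"
      using spectrum_poly_mat[OF v, of k "[:0, 0, 1:]"] unfolding poly_mat_square[OF v] by blast
    then show "k \<in> Disc r \<gamma>" using vs by (auto simp: branch_range_def power2_eq_square)
  qed
  show "mean_square w \<in> chart_domain \<gamma>"
    unfolding ms chart_domain_iff using n vv vvs by (auto intro!: nc_space_2I[of n])
  have "S_mat r s \<gamma> \<tau> (v * v) = v"
    unfolding S_mat_eq
    by (rule hol_calculus_of_square[OF v Disc_open vvs branch_holomorphic[OF \<gamma>(1)] branch_range_open[OF \<gamma>] vs])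
      (auto simp: branch_range_def)
  moreover have "(1/2) \<cdot>\<^sub>m (a + b) + v = a" "(1/2) \<cdot>\<^sub>m (a + b) - v = b"
    using n by (auto simp: v_def field_simps intro!: eq_matI)
  ultimately show "omega r s \<gamma> \<tau> (mean_square w) = w"
    unfolding ms by (simp add: omega_def n(2))
qed

lemma omega_image_iff:
  assumes \<gamma>: "\<gamma> \<in> Gam" "\<tau> \<in> signs \<gamma>" and V: "V \<subseteq> chart_domain \<gamma>"
  shows "omega r s \<gamma> \<tau> ` V = {w \<in> sheet_domain \<gamma> \<tau>. mean_square w \<in> V}"
proof (intro equalityI subsetI)
  fix w assume "w \<in> omega r s \<gamma> \<tau> ` V"
  then show "w \<in> {w \<in> sheet_domain \<gamma> \<tau>. mean_square w \<in> V}"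
    using omega_in_sheet_domain[OF \<gamma>] V by auto
next
  fix w assume "w \<in> {w \<in> sheet_domain \<gamma> \<tau>. mean_square w \<in> V}"
  then show "w \<in> omega r s \<gamma> \<tau> ` V" using mean_square_in_chart_domain(2)[OF \<gamma>] by force
qed

text \<open>The branches for \<open>\<gamma>\<close> and \<open>\<gamma>'\<close> differ by a locally constant sign on the intersection of their
  domains. Since \<open>r \<gamma>' \<le> r \<gamma>\<close>, a disc of \<open>\<gamma>'\<close> meets at most one disc of \<open>\<gamma>\<close>, so this sign comes from
  a sign function on \<open>\<gamma>'\<close>.\<close>

lemma branch_quotient:
  assumes \<gamma>: "\<gamma> \<in> Gam" "\<tau> \<in> signs \<gamma>" and \<gamma>': "\<gamma>' \<in> Gam" "\<tau>' \<in> signs \<gamma>'" and le: "r \<gamma>' \<le> r \<gamma>"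
  obtains \<kappa> where "\<kappa> \<in> signs \<gamma>'"
    "\<And>z. z \<in> Disc r \<gamma> \<inter> Disc r \<gamma>' \<Longrightarrow> branch \<gamma>' \<tau>' z = branch \<gamma> \<tau> z * iota r \<gamma>' \<kappa> z"
proof -
  let ?q = "\<lambda>z. branch \<gamma>' \<tau>' z / branch \<gamma> \<tau> z"
  have q: "?q z \<in> {-1, 1}" if "z \<in> Disc r \<gamma> \<inter> Disc r \<gamma>'" for z
  proof -
    have "(branch \<gamma>' \<tau>' z)\<^sup>2 = (branch \<gamma> \<tau> z)\<^sup>2"
      using that branch_square[OF \<gamma>, of z] branch_square[OF \<gamma>', of z] by (simp add: power2_eq_square)
    then have "branch \<gamma>' \<tau>' z = branch \<gamma> \<tau> z \<or> branch \<gamma>' \<tau>' z = - branch \<gamma> \<tau> z"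
      by (simp add: power2_eq_iff)
    then show ?thesis using branch_nonzero[OF \<gamma>, of z] that by auto
  qed
  have "\<exists>e\<in>{-1, 1}. \<forall>z\<in>Disc r \<gamma> \<inter> ball c' (r \<gamma>'). ?q z = e" if c': "c' \<in> \<gamma>'" for c'
  proof (cases "Disc r \<gamma> \<inter> ball c' (r \<gamma>') = {}")
    case True
    then show ?thesis by auto
  next
    case False
    then obtain z0 c where z0: "z0 \<in> ball c' (r \<gamma>')" "c \<in> \<gamma>" "z0 \<in> ball c (r \<gamma>)"
      unfolding Disc_eq by blast
    have sub': "ball c' (r \<gamma>') \<subseteq> Disc r \<gamma>'" using c' unfolding Disc_eq by blast
    have eq: "Disc r \<gamma> \<inter> ball c' (r \<gamma>') = ball c (r \<gamma>) \<inter> ball c' (r \<gamma>')"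
    proof (intro equalityI subsetI)
      fix z assume z: "z \<in> Disc r \<gamma> \<inter> ball c' (r \<gamma>')"
      then obtain d where d: "d \<in> \<gamma>" "z \<in> ball d (r \<gamma>)" unfolding Disc_eq by blast
      have "d = c"
      proof (rule ccontr)
        assume "d \<noteq> c"
        then have "4 * r \<gamma> < dist d c" using radius_dist[OF \<gamma>(1) d(1) z0(2)] by blast
        \<comment> \<open>The path through \<open>z\<close>, \<open>c'\<close> and \<open>z0\<close>
          is shorter than \<open>2 * r \<gamma> + 2 * r \<gamma>'\<close>, hence than
          \<open>4 * r \<gamma>\<close>. This is where the factor 1/4 in the choice of the radii
          enters.\<close>
        moreover have "dist d c \<le> dist d z + dist z c'+ dist c' z0 + dist z0 c"
          using dist_triangle[of d c z] dist_triangle[of z c c'] dist_triangle[of c' c z0] by linarith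
        moreover have "dist d z < r \<gamma>" "dist z c' < r \<gamma>'" "dist c' z0 < r \<gamma>'" "dist z0 c < r \<gamma>"
          using z d z0 by (auto simp: dist_commute)
        ultimately show False using le by linarith
      qed
      then show "z \<in> ball c (r \<gamma>) \<inter> ball c' (r \<gamma>')" using z d by blast
    qed (use z0(2) in \<open>auto simp: Disc_eq\<close>)
    \<comment> \<open>An intersection of two balls is convex, hence connected, and a continuous
      quotient with values in \<open>{-1, 1}\<close> is constant on it.\<close>
    let ?Y = "ball c (r \<gamma>) \<inter> ball c' (r \<gamma>')"
    have Yq: "?Y \<subseteq> Disc r \<gamma> \<inter> Disc r \<gamma>'" using eq sub' by blast
    have "connected ?Y" by (intro convex_connected convex_Int convex_ball)
    moreover have "continuous_on ?Y ?q"
      using Yq branch_nonzero[OF \<gamma>]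
      by (intro continuous_on_divide)
        (auto intro: continuous_on_subset[OF holomorphic_on_imp_continuous_on[OF branch_holomorphic[OF \<gamma>(1)]]]
          continuous_on_subset[OF holomorphic_on_imp_continuous_on[OF branch_holomorphic[OF \<gamma>'(1)]]])
    moreover have "finite (?q ` ?Y)" by (rule finite_subset[of _ "{-1, 1}"]) (use q Yq in blast)+
    ultimately have "?q constant_on ?Y" by (rule continuous_finite_range_constant)
    then obtain e where e: "\<And>z. z \<in> ?Y \<Longrightarrow> ?q z = e" unfolding constant_on_def by blast
    have "z0 \<in> ?Y" using z0 by blast
    then have "e \<in> {-1, 1}" using e[of z0] q[of z0] Yq by blast
    then show ?thesis unfolding eq using e by blast
  qed
  then obtain k where k: "\<And>c'. c' \<in> \<gamma>' \<Longrightarrow> k c' \<in> {-1, 1}"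
    "\<And>c' z. c' \<in> \<gamma>' \<Longrightarrow> z \<in> Disc r \<gamma> \<inter> ball c' (r \<gamma>') \<Longrightarrow> ?q z = k c'"
    by metis
  show thesis
  proof (rule that[of "restrict k \<gamma>'"])
    show "restrict k \<gamma>' \<in> signs \<gamma>'" unfolding signs_def using k(1) by (rule restrict_PiE_iff[THEN iffD2, rule_format])
    fix z assume z: "z \<in> Disc r \<gamma> \<inter> Disc r \<gamma>'"
    then obtain c' where c': "c' \<in> \<gamma>'" "z \<in> ball c' (r \<gamma>')" unfolding Disc_eq[of \<gamma>'] by blast
    have "?q z = iota r \<gamma>' (restrict k \<gamma>') z" using k(2)[OF c'(1)] z c' by (simp add: iota_eq[OF \<gamma>'(1) c'])
    then show "branch \<gamma>' \<tau>' z = branch \<gamma> \<tau> z * iota r \<gamma>' (restrict k \<gamma>') z"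
      using branch_nonzero[OF \<gamma>, of z] z by (simp add: field_simps)
  qed
qed

text \<open>The order of the radii decides where the comparing sign function \<open>\<kappa>\<close>
  lives: on \<open>\<gamma>'\<close>. So it is the noncommutation in
  \<open>U_gam r \<gamma>'\<close> that applies to it, and a constant sign 1 or -1 gives the same
  point or its flip.\<close>

lemma fibre_aux:
  assumes \<gamma>: "\<gamma> \<in> Gam" "\<tau> \<in> signs \<gamma>" and \<gamma>': "\<gamma>' \<in> Gam" "\<tau>' \<in> signs \<gamma>'" and le: "r \<gamma>' \<le> r \<gamma>"
    and p: "p \<in> chart_domain \<gamma>" "p \<in> U_gam r \<gamma>'" and eq: "Phi r s \<gamma> \<tau> p = Phi r s \<gamma>' \<tau>' p"
  shows "omega r s \<gamma>' \<tau>' p = omega r s \<gamma> \<tau> p \<or> omega r s \<gamma>' \<tau>' p = flip (omega r s \<gamma> \<tau> p)"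
proof -
  obtain n u x where n: "1 \<le> n" "p = [u, x]" "u \<in> carrier_mat n n" "x \<in> carrier_mat n n" "spectrum x \<subseteq> Disc r \<gamma>"
    using p(1) by (rule chart_domainE)
  have sx': "spectrum x \<subseteq> Disc r \<gamma>'" using p(2) by (simp add: U_gam_iff chart_domain_iff n(2))
  let ?X = "Disc r \<gamma> \<inter> Disc r \<gamma>'"
  let ?S = "S_mat r s \<gamma> \<tau> x" and ?S' = "S_mat r s \<gamma>' \<tau>' x"
  have X: "open ?X" "spectrum x \<subseteq> ?X" using Disc_open n(5) sx' by auto
  obtain \<kappa> where \<kappa>: "\<kappa> \<in> signs \<gamma>'"
    "\<And>z. z \<in> ?X \<Longrightarrow> branch \<gamma>' \<tau>' z = branch \<gamma> \<tau> z * iota r \<gamma>' \<kappa> z"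
    using branch_quotient[OF \<gamma> \<gamma>' le] by blast
  let ?J = "I_mat r \<gamma>' \<kappa> x"
  have bh: "branch \<gamma> \<tau> holomorphic_on ?X" and ih: "iota r \<gamma>' \<kappa> holomorphic_on ?X"
    by (rule holomorphic_on_subset[OF branch_holomorphic[OF \<gamma>(1)]], simp,
        rule holomorphic_on_subset[OF iota_holomorphic[OF \<gamma>'(1)]], simp)
  have c: "?S \<in> carrier_mat n n" "?J \<in> carrier_mat n n" using n(4) by (simp_all add: S_mat_eq I_mat_def)
  have SJ: "?S' = ?S * ?J" and JS: "?S' = ?J * ?S"
    unfolding S_mat_eq I_mat_def hol_calculus_mult[OF n(4) X bh ih, symmetric]
      hol_calculus_mult[OF n(4) X ih bh, symmetric]
    by (rule hol_calculus_cong[OF n(4) X]; simp add: \<kappa>(2) mult.commute)+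
  show ?thesis
  proof (cases "\<kappa> constant_on \<gamma>'")
    case True
    then obtain e where e: "\<And>c. c \<in> \<gamma>' \<Longrightarrow> \<kappa> c = e" unfolding constant_on_def by blast
    \<comment> \<open>A matrix of positive size has an eigenvalue, so \<open>\<gamma>'\<close> is
      nonempty and the constant \<open>e\<close> is really a sign.\<close>
    have "spectrum x \<noteq> {}" using spectrum_non_empty[OF n(4)] n(1) by simp
    then obtain c0 where c0: "c0 \<in> \<gamma>'" using sx' unfolding Disc_eq by blast
    then have "e = -1 \<or> e = 1" using e[OF c0] \<kappa>(1) by (auto simp: signs_def)
    moreover have ie: "iota r \<gamma>' \<kappa> z = e" if z: "z \<in> ?X" for z
    proof -
      obtain c' where c': "c' \<in> \<gamma>'" "z \<in> ball c' (r \<gamma>')" using z unfolding Disc_eq[of \<gamma>'] by blast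
      show ?thesis unfolding iota_eq[OF \<gamma>'(1) c'] by (rule e[OF c'(1)])
    qed
    ultimately consider "\<And>z. z \<in> ?X \<Longrightarrow> branch \<gamma>' \<tau>' z = branch \<gamma> \<tau> z"
      | "\<And>z. z \<in> ?X \<Longrightarrow> branch \<gamma>' \<tau>' z = - branch \<gamma> \<tau> z"
      using \<kappa>(2) by fastforce
    then show ?thesis
    proof cases
      case 1
      have "?S' = ?S" unfolding S_mat_eq by (rule hol_calculus_cong[OF n(4) X 1])
      then show ?thesis by (simp add: omega_def n(2))
    next
      case 2
      have "?S' = (-1) \<cdot>\<^sub>m ?S" unfolding S_mat_eq by (rule hol_calculus_uminus[OF n(4) X bh 2])
      then have "u + ?S' = u - ?S" "u - ?S' = u + ?S" using n(3) c by (auto intro!: eq_matI)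
      then show ?thesis by (simp add: omega_def flip_def n(2))
    qed
  next
    case False
    have Tc: "(\<lambda>z. 1 / branch \<gamma> \<tau> z) holomorphic_on ?X"
      using bh branch_nonzero[OF \<gamma>] by (intro holomorphic_on_divide holomorphic_on_const) auto
    \<comment> \<open>The inverse of the root \<open>S\<close>. It strips \<open>S\<close> from both
      sides of \<open>S u S = S J u J S\<close> and leaves \<open>u = J u J\<close>, that is,
      \<open>u\<close> commutes with the involution \<open>J\<close>.\<close>
    let ?T = "hol_calculus (\<lambda>z. 1 / branch \<gamma> \<tau> z) x"
    have T: "?T \<in> carrier_mat n n" using n(4) by simp
    have TS: "?T * ?S = 1\<^sub>m n" "?S * ?T = 1\<^sub>m n"
      unfolding S_mat_eq hol_calculus_mult[OF n(4) X Tc bh, symmetric] hol_calculus_mult[OF n(4) X bh Tc, symmetric]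
        poly_mat_1[OF n(4), symmetric]
      by (rule hol_calculus_poly[OF n(4) X]; simp add: branch_nonzero[OF \<gamma>])+
    have JJ: "?J * ?J = 1\<^sub>m n" by (rule I_mat_square[OF \<gamma>'(1) \<kappa>(1) n(4) sx'])
    have "?S * u * ?S = ?S' * u * ?S'" using eq by (simp add: Phi_def n(2))
    also have "\<dots> = (?S * ?J) * u * (?J * ?S)" using SJ JS by metis
    finally have "?T * (?S * u * ?S) * ?T = ?T * ((?S * ?J) * u * (?J * ?S)) * ?T" by simp
    moreover have "?T * (?S * u * ?S) * ?T = (?T * ?S) * u * (?S * ?T)"
      using T c n(3) by (simp add: assoc_mult_mat[of _ n n _ n _ n] square_mat_simps[where n = n])
    moreover have "?T * ((?S * ?J) * u * (?J * ?S)) * ?T = (?T * ?S) * (?J * u * ?J) * (?S * ?T)"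
      using T c n(3) by (simp add: assoc_mult_mat[of _ n n _ n _ n] square_mat_simps[where n = n])
    ultimately have uJ: "u = ?J * u * ?J"
      unfolding TS using c n(3) by (simp add: square_mat_simps[where n = n])
    have "u * ?J = ?J * u * ?J * ?J" by (subst (1) uJ) simp
    also have "\<dots> = ?J * u * (?J * ?J)"
      using c n(3) by (simp add: assoc_mult_mat[of _ n n _ n _ n] square_mat_simps[where n = n])
    also have "\<dots> = ?J * u" unfolding JJ using c n(3) by (simp add: square_mat_simps[where n = n])
    finally show ?thesis using p(2) \<kappa>(1) False unfolding U_gam_iff by (auto simp: n(2))
  qed
qed

text \<open>The first two components of \<open>Phi\<close> already force \<open>p = p'\<close>.
  Being equal up to a flip is a symmetric relation, so the chart with the smaller radius can take
  the second place.\<close>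

lemma fibre:
  assumes \<gamma>: "\<gamma> \<in> Gam" "\<tau> \<in> signs \<gamma>" and \<gamma>': "\<gamma>' \<in> Gam" "\<tau>' \<in> signs \<gamma>'"
    and p: "p \<in> U_gam r \<gamma>" "p' \<in> U_gam r \<gamma>'"
    and eq: "cover (omega r s \<gamma> \<tau> p) = cover (omega r s \<gamma>' \<tau>' p')"
  shows "omega r s \<gamma>' \<tau>' p' = omega r s \<gamma> \<tau> p \<or> omega r s \<gamma>' \<tau>' p' = flip (omega r s \<gamma> \<tau> p)"
proof -
  have pW: "p \<in> chart_domain \<gamma>" "p' \<in> chart_domain \<gamma>'" using p U_gam_subset by blast+
  have Phi_eq: "Phi r s \<gamma> \<tau> p = Phi r s \<gamma>' \<tau>' p'"
    using eq omega_in_sheet_domain(3)[OF \<gamma> pW(1)] omega_in_sheet_domain(3)[OF \<gamma>' pW(2)] by simp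
  obtain n u x where 1: "p = [u, x]" using pW(1) by (rule chart_domainE)
  obtain n' u' x' where 2: "p' = [u', x']" using pW(2) by (rule chart_domainE)
  have pp: "p' = p" using Phi_eq by (simp add: Phi_def 1 2)
  show ?thesis
  proof (cases "r \<gamma>' \<le> r \<gamma>")
    case True
    then show ?thesis using fibre_aux[OF \<gamma> \<gamma>' True pW(1)] p Phi_eq unfolding pp by blast
  next
    case False
    then have "r \<gamma> \<le> r \<gamma>'" by simp
    then have "omega r s \<gamma> \<tau> p = omega r s \<gamma>' \<tau>' p \<or> omega r s \<gamma> \<tau> p = flip (omega r s \<gamma>' \<tau>' p)"
      using fibre_aux[OF \<gamma>' \<gamma>, of p] pW p Phi_eq unfolding pp by simp
    then show ?thesis unfolding pp by (auto simp: flip_def omega_def)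
  qed
qed

section \<open>The flip and the symmetry of \<open>S_oo\<close>\<close>

definition neg_sign :: "complex set \<Rightarrow> (complex \<Rightarrow> complex) \<Rightarrow> complex \<Rightarrow> complex" where
  "neg_sign \<gamma> \<tau> = restrict (\<lambda>c. - \<tau> c) \<gamma>"

lemma neg_sign_signs: "\<tau> \<in> signs \<gamma> \<Longrightarrow> neg_sign \<gamma> \<tau> \<in> signs \<gamma>"
  by (auto simp: signs_def neg_sign_def PiE_iff)

text \<open>Changing all signs negates the root, which exchanges the two components; hence the flip
  permutes the sheets.\<close>

lemma omega_neg_sign:
  assumes \<gamma>: "\<gamma> \<in> Gam" "\<tau> \<in> signs \<gamma>" and p: "p \<in> chart_domain \<gamma>"
  shows "omega r s \<gamma> (neg_sign \<gamma> \<tau>) p = flip (omega r s \<gamma> \<tau> p)"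
proof -
  obtain n u x where n: "p = [u, x]" "u \<in> carrier_mat n n" "x \<in> carrier_mat n n" "spectrum x \<subseteq> Disc r \<gamma>"
    using p by (rule chart_domainE)
  have "branch \<gamma> (neg_sign \<gamma> \<tau>) z = - branch \<gamma> \<tau> z" if z: "z \<in> Disc r \<gamma>" for z
  proof -
    obtain c where c: "c \<in> \<gamma>" "z \<in> ball c (r \<gamma>)" using z unfolding Disc_eq by blast
    show ?thesis using c(1) by (simp add: branch_def iota_eq[OF \<gamma>(1) c] neg_sign_def)
  qed
  then have "S_mat r s \<gamma> (neg_sign \<gamma> \<tau>) x = (-1) \<cdot>\<^sub>m S_mat r s \<gamma> \<tau> x"
    unfolding S_mat_eq by (rule hol_calculus_uminus[OF n(3) Disc_open n(4) branch_holomorphic[OF \<gamma>(1)]])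
  moreover have "S_mat r s \<gamma> \<tau> x \<in> carrier_mat n n" using n(3) by (simp add: S_mat_eq)
  ultimately have "u + S_mat r s \<gamma> (neg_sign \<gamma> \<tau>) x = u - S_mat r s \<gamma> \<tau> x"
    "u - S_mat r s \<gamma> (neg_sign \<gamma> \<tau>) x = u + S_mat r s \<gamma> \<tau> x"
    using n(2) by (auto intro!: eq_matI)
  then show ?thesis by (simp add: omega_def flip_def n(1))
qed

lemma S_ooE:
  assumes "w \<in> S_oo r s S"
  obtains \<gamma> \<tau> p where "\<gamma> \<in> Gam" "\<tau> \<in> signs \<gamma>" "p \<in> U_gam r \<gamma>" "p \<in> chart_domain \<gamma>" "p \<in> U_chart r s S \<gamma> \<tau>"
    "w = omega r s \<gamma> \<tau> p" "w \<in> S"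
  using assms U_gam_subset unfolding S_oo_def U_chart_def by blast

lemma S_ooI:
  "\<gamma> \<in> Gam \<Longrightarrow> \<tau> \<in> signs \<gamma> \<Longrightarrow> p \<in> U_chart r s S \<gamma> \<tau> \<Longrightarrow> omega r s \<gamma> \<tau> p \<in> S_oo r s S"
  unfolding S_oo_def U_chart_def by blast

lemma flip_flip: "w \<in> nc_space 2 \<Longrightarrow> flip (flip w) = w"
  by (auto simp: flip_def elim: nc_space_2E)

lemma S_oo_nc_space: "w \<in> S_oo r s S \<Longrightarrow> w \<in> nc_space 2"
  using omega_in_sheet_domain(1) by (elim S_ooE) (auto simp: sheet_domain_def)

lemma symmetric_S_oo:
  assumes S: "symmetric_set S"
  shows "symmetric_set (S_oo r s S)"
proof -
  have flip: "flip w \<in> S_oo r s S" if w: "w \<in> S_oo r s S" for w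
  proof -
    obtain \<gamma> \<tau> p where p: "\<gamma> \<in> Gam" "\<tau> \<in> signs \<gamma>" "p \<in> U_gam r \<gamma>" "p \<in> chart_domain \<gamma>" "w = omega r s \<gamma> \<tau> p" "w \<in> S"
      using w by (rule S_ooE)
    have eq: "omega r s \<gamma> (neg_sign \<gamma> \<tau>) p = flip w"
      using omega_neg_sign[OF p(1,2,4)] p(5) by simp
    have "flip w \<in> S" using S p(6) unfolding symmetric_set_def by blast
    then have "p \<in> U_chart r s S \<gamma> (neg_sign \<gamma> \<tau>)" using p(3) eq by (simp add: U_chart_def)
    then show ?thesis using S_ooI[OF p(1) neg_sign_signs[OF p(2)]] eq by metis
  qed
  have "w \<in> flip ` S_oo r s S" if w: "w \<in> S_oo r s S" for w
    using flip[OF w] flip_flip[OF S_oo_nc_space[OF w]] by (metis imageI)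
  then show ?thesis unfolding symmetric_set_def using flip by blast
qed

section \<open>Open sets on charts and on sheets\<close>

lemma omega_pullback_open:
  assumes \<gamma>: "\<gamma> \<in> Gam" "\<tau> \<in> signs \<gamma>" and V: "V \<in> zariski_free_opens 2"
  shows "{p \<in> U_gam r \<gamma>. omega r s \<gamma> \<tau> p \<in> V} \<in> zariski_free_opens 2"
proof -
  note om = free_map_omega[OF \<gamma>(1), of \<tau>]
  have "{p \<in> chart_domain \<gamma>. omega r s \<gamma> \<tau> p \<in> V} \<in> zariski_free_opens 2"
  proof (rule zariski_free_opens_pullback[OF _ _ V])
    show "nc_map 2 2 (chart_domain \<gamma>) (omega r s \<gamma> \<tau>)" using om by (simp add: free_map_def)
    show "{p \<in> chart_domain \<gamma>. omega r s \<gamma> \<tau> p \<in> V} \<in> free_opens 2" if "V \<in> free_opens 2" for V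
      by (rule free_opens_pullback[OF _ _ om that]) simp_all
  qed
  \<comment> \<open>Continuity was obtained on the freely open \<open>chart_domain\<close>;
    restricting to \<open>U_gam\<close> is an intersection of Zariski-freely open sets.\<close>
  then have "U_gam r \<gamma> \<inter> {p \<in> chart_domain \<gamma>. omega r s \<gamma> \<tau> p \<in> V} \<in> zariski_free_opens 2"
    using U_gam_open[OF \<gamma>(1)] by (intro zariski_free_opens_Int) auto
  also have "U_gam r \<gamma> \<inter> {p \<in> chart_domain \<gamma>. omega r s \<gamma> \<tau> p \<in> V} = {p \<in> U_gam r \<gamma>. omega r s \<gamma> \<tau> p \<in> V}"
    using U_gam_subset by blast
  finally show ?thesis .
qed

lemma mean_square_pullback_open:
  assumes \<gamma>: "\<gamma> \<in> Gam" "\<tau> \<in> signs \<gamma>" and V: "V \<in> zariski_free_opens 2"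
  shows "{w \<in> sheet_domain \<gamma> \<tau>. mean_square w \<in> V} \<in> zariski_free_opens 2"
proof (rule zariski_free_opens_pullback[OF _ _ V])
  note ms = free_map_mean_square_sheet[OF \<gamma>]
  show "nc_map 2 2 (sheet_domain \<gamma> \<tau>) mean_square" using ms by (simp add: free_map_def)
  show "{w \<in> sheet_domain \<gamma> \<tau>. mean_square w \<in> V} \<in> free_opens 2" if "V \<in> free_opens 2" for V
    by (rule free_opens_pullback[OF _ _ ms that]) simp_all
qed

lemma U_chart_eq: "U_chart r s S \<gamma> \<tau> = {p \<in> U_gam r \<gamma>. omega r s \<gamma> \<tau> p \<in> S}"
  by (simp add: U_chart_def)

lemma U_chart_open:
  assumes "\<gamma> \<in> Gam" "\<tau> \<in> signs \<gamma>" "S \<in> free_opens 2"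
  shows "U_chart r s S \<gamma> \<tau> \<in> zariski_free_opens 2"
  unfolding U_chart_eq by (rule omega_pullback_open[OF assms(1,2) free_opens_imp_zariski[OF assms(3)]])

abbreviation sheet :: "complex mat list set \<Rightarrow> complex set \<times> (complex \<Rightarrow> complex) \<Rightarrow> complex mat list set" where
  "sheet S i \<equiv> {w \<in> sheet_domain (fst i) (snd i). mean_square w \<in> U_chart r s S (fst i) (snd i)}"

text \<open>Each piece is the preimage of a chart under the polynomial map
  \<open>mean_square\<close>, so openness and holomorphy can be checked piece by piece.\<close>

lemma S_oo_sheets: "S_oo r s S = (\<Union>i\<in>Sigma Gam signs. sheet S i)"
proof -
  have "omega r s \<gamma> \<tau> ` U_gam r \<gamma> \<inter> S = {w \<in> sheet_domain \<gamma> \<tau>. mean_square w \<in> U_chart r s S \<gamma> \<tau>}"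
    if \<gamma>: "\<gamma> \<in> Gam" "\<tau> \<in> signs \<gamma>" for \<gamma> \<tau>
    unfolding omega_image_iff[OF \<gamma> U_gam_subset] U_chart_def using mean_square_in_chart_domain(2)[OF \<gamma>] by auto
  then show ?thesis unfolding S_oo_def by fastforce
qed

lemma S_oo_open:
  assumes S: "S \<in> free_opens 2"
  shows "S_oo r s S \<in> zariski_free_opens 2"
  unfolding S_oo_sheets
proof (rule zariski_free_opens_Union, rule image_subsetI)
  fix i assume "i \<in> Sigma Gam signs"
  then have i: "fst i \<in> Gam" "snd i \<in> signs (fst i)" by auto
  show "sheet S i \<in> zariski_free_opens 2"
    by (rule mean_square_pullback_open[OF i U_chart_open[OF i S]])
qed

section \<open>Descent along the covering\<close>

lemma cover_on_sheet:
  assumes \<gamma>: "\<gamma> \<in> Gam" "\<tau> \<in> signs \<gamma>" and w: "w \<in> sheet_domain \<gamma> \<tau>"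
  shows "cover w = Phi r s \<gamma> \<tau> (mean_square w)"
  using omega_in_sheet_domain(3)[OF \<gamma> mean_square_in_chart_domain(1)[OF \<gamma> w]] mean_square_in_chart_domain(2)[OF \<gamma> w] by simp

text \<open>On each sheet \<open>cover\<close> is \<open>Phi\<close> after
  \<open>mean_square\<close>, so \<open>F \<circ> cover\<close> is the pullback of the chart
  function \<open>F \<circ> Phi\<close> under a polynomial map.\<close>

lemma holomorphic_descent_imp:
  assumes S: "S \<in> free_opens 2" "symmetric_set S" and F: "holomorphic_on_G_oo r s S F"
  shows "symmetric_function (S_oo r s S) (F \<circ> cover)"
    "tau_holomorphic 2 (zariski_free_opens 2) (S_oo r s S) (F \<circ> cover)"
proof -
  show "symmetric_function (S_oo r s S) (F \<circ> cover)"
    unfolding symmetric_function_def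
    using symmetric_S_oo[OF S(2)] cover_flip S_oo_nc_space by auto
  show "tau_holomorphic 2 (zariski_free_opens 2) (S_oo r s S) (F \<circ> cover)"
    unfolding S_oo_sheets
  proof (rule tau_holomorphic_Union)
    show "(\<Union>i\<in>Sigma Gam signs. sheet S i) \<in> zariski_free_opens 2"
      using S_oo_open[OF S(1)] unfolding S_oo_sheets .
    fix i assume "i \<in> Sigma Gam signs"
    then have i: "fst i \<in> Gam" "snd i \<in> signs (fst i)" by auto
    have "nc_map 2 2 (sheet_domain (fst i) (snd i)) mean_square"
      using free_map_mean_square_sheet[OF i] by (simp add: free_map_def)
    moreover have "tau_holomorphic 2 (zariski_free_opens 2) (U_chart r s S (fst i) (snd i)) (F \<circ> Phi r s (fst i) (snd i))"
      using F i unfolding holomorphic_on_G_oo_def by blast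
    ultimately have "tau_holomorphic 2 (zariski_free_opens 2) (sheet S i) ((F \<circ> Phi r s (fst i) (snd i)) \<circ> mean_square)"
      using mean_square_pullback_open[OF i] by (intro tau_holomorphic_pullback)
    then show "tau_holomorphic 2 (zariski_free_opens 2) (sheet S i) (F \<circ> cover)"
      by (rule tau_holomorphic_cong) (auto simp: cover_on_sheet[OF i])
  qed
qed

text \<open>Both inclusions come from \<open>cover\<close> after \<open>omega\<close> being
  \<open>Phi\<close>. Surjectivity of the covering is what makes the descended function
  unique.\<close>

lemma G_oo_eq: "G_oo r s S = cover ` S_oo r s S"
proof (intro equalityI subsetI)
  fix q assume "q \<in> G_oo r s S"
  then obtain \<gamma> \<tau> p where p: "\<gamma> \<in> Gam" "\<tau> \<in> signs \<gamma>" "p \<in> U_chart r s S \<gamma> \<tau>" "q = Phi r s \<gamma> \<tau> p"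
    unfolding G_oo_def by blast
  then have "p \<in> chart_domain \<gamma>" using U_gam_subset by (auto simp: U_chart_def)
  then have "q = cover (omega r s \<gamma> \<tau> p)" using omega_in_sheet_domain(3)[OF p(1,2)] p(4) by simp
  then show "q \<in> cover ` S_oo r s S" using S_ooI[OF p(1-3)] by blast
next
  fix q assume "q \<in> cover ` S_oo r s S"
  then obtain w where w: "w \<in> S_oo r s S" "q = cover w" by blast
  obtain \<gamma> \<tau> p where p: "\<gamma> \<in> Gam" "\<tau> \<in> signs \<gamma>" "p \<in> chart_domain \<gamma>" "p \<in> U_chart r s S \<gamma> \<tau>" "w = omega r s \<gamma> \<tau> p"
    using w(1) by (rule S_ooE)
  have "q = Phi r s \<gamma> \<tau> p" using omega_in_sheet_domain(3)[OF p(1-3)] w(2) p(5) by simp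
  then show "q \<in> G_oo r s S" unfolding G_oo_def using p by blast
qed

lemma symmetric_function_fibre:
  assumes f: "symmetric_function (S_oo r s S) f"
    and w: "w \<in> S_oo r s S" "w' \<in> S_oo r s S" "cover w = cover w'"
  shows "f w = f w'"
proof -
  obtain \<gamma> \<tau> p where p: "\<gamma> \<in> Gam" "\<tau> \<in> signs \<gamma>" "p \<in> U_gam r \<gamma>" "w = omega r s \<gamma> \<tau> p"
    using w(1) by (rule S_ooE)
  obtain \<gamma>' \<tau>' p' where p': "\<gamma>' \<in> Gam" "\<tau>' \<in> signs \<gamma>'" "p' \<in> U_gam r \<gamma>'" "w' = omega r s \<gamma>' \<tau>' p'"
    using w(2) by (rule S_ooE)
  have "w' = w \<or> w' = flip w"
    using fibre[OF p(1,2) p'(1,2) p(3) p'(3)] w(3) unfolding p(4) p'(4) by blast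
  then show ?thesis using f w(1) unfolding symmetric_function_def by auto
qed

text \<open>On a chart the descended function is \<open>f \<circ> omega\<close>, which is
  holomorphic by pullback along \<open>omega\<close>. Extensionality pins down the total function
  off \<open>G_oo\<close>, where the mathematical statement says nothing.\<close>

lemma holomorphic_descent_exists_unique:
  assumes S: "S \<in> free_opens 2" and f: "symmetric_function (S_oo r s S) f"
    "tau_holomorphic 2 (zariski_free_opens 2) (S_oo r s S) f"
  shows "\<exists>!F. F \<in> extensional (G_oo r s S) \<and> holomorphic_on_G_oo r s S F \<and>
    (\<forall>w \<in> S_oo r s S. f w = (F \<circ> cover) w)"
proof (rule ex1I)
  \<comment> \<open>The choice of \<open>w\<close> is immaterial because \<open>f\<close> is
    constant on the fibres of \<open>cover\<close>.\<close>
  define F where "F = restrict (\<lambda>q. f (SOME w. w \<in> S_oo r s S \<and> cover w = q)) (G_oo r s S)"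
  have F: "F (cover w) = f w" if w: "w \<in> S_oo r s S" for w
  proof -
    let ?w = "SOME w'. w' \<in> S_oo r s S \<and> cover w' = cover w"
    have "?w \<in> S_oo r s S \<and> cover ?w = cover w" by (rule someI[of _ w]) (use w in simp)
    then have "f ?w = f w" using symmetric_function_fibre[OF f(1)] w by blast
    moreover have "cover w \<in> G_oo r s S" using w unfolding G_oo_eq by blast
    ultimately show ?thesis by (simp add: F_def)
  qed
  have "holomorphic_on_G_oo r s S F"
    unfolding holomorphic_on_G_oo_def
  proof (intro ballI)
    fix \<gamma> \<tau> assume \<gamma>: "\<gamma> \<in> Gam" "\<tau> \<in> signs \<gamma>"
    have nc: "nc_map 2 2 (U_gam r \<gamma>) (omega r s \<gamma> \<tau>)"
      using free_map_omega[OF \<gamma>(1), of \<tau>] U_gam_nc[OF \<gamma>(1)] U_gam_subset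
      unfolding free_map_def by (blast intro: nc_map_subset)
    have "tau_holomorphic 2 (zariski_free_opens 2) {p \<in> U_gam r \<gamma>. omega r s \<gamma> \<tau> p \<in> S_oo r s S} (f \<circ> omega r s \<gamma> \<tau>)"
      by (rule tau_holomorphic_pullback[OF nc omega_pullback_open[OF \<gamma>] f(2)])
    also have "{p \<in> U_gam r \<gamma>. omega r s \<gamma> \<tau> p \<in> S_oo r s S} = U_chart r s S \<gamma> \<tau>"
      using S_ooI[OF \<gamma>] unfolding U_chart_def S_oo_def by blast
    finally show "tau_holomorphic 2 (zariski_free_opens 2) (U_chart r s S \<gamma> \<tau>) (F \<circ> Phi r s \<gamma> \<tau>)"
    proof (rule tau_holomorphic_cong)
      fix p assume p: "p \<in> U_chart r s S \<gamma> \<tau>"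
      then have "p \<in> chart_domain \<gamma>" using U_gam_subset by (auto simp: U_chart_def)
      then have "Phi r s \<gamma> \<tau> p = cover (omega r s \<gamma> \<tau> p)" using omega_in_sheet_domain(3)[OF \<gamma>] by simp
      then show "(F \<circ> Phi r s \<gamma> \<tau>) p = (f \<circ> omega r s \<gamma> \<tau>) p" using F[OF S_ooI[OF \<gamma> p]] by simp
    qed
  qed
  then show "F \<in> extensional (G_oo r s S) \<and> holomorphic_on_G_oo r s S F \<and>
      (\<forall>w \<in> S_oo r s S. f w = (F \<circ> cover) w)"
    using F by (simp add: F_def)
  fix F' assume F': "F' \<in> extensional (G_oo r s S) \<and> holomorphic_on_G_oo r s S F' \<and>
      (\<forall>w \<in> S_oo r s S. f w = (F' \<circ> cover) w)"
  show "F' = F"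
  proof (rule extensionalityI)
    show "F' \<in> extensional (G_oo r s S)" using F' by blast
    show "F \<in> extensional (G_oo r s S)" by (simp add: F_def)
    fix q assume "q \<in> G_oo r s S"
    then show "F' q = F q" using F F' unfolding G_oo_eq by auto
  qed
qed

end

theorem theorem9p15:
  fixes r :: "complex set \<Rightarrow> real"
    and s :: "complex set \<Rightarrow> complex \<Rightarrow> complex"
    and S :: "complex mat list set"
  assumes "branch_choice r s"
    and "S \<in> free_opens 2"
    and "symmetric_set S"
  shows "(\<forall>F. holomorphic_on_G_oo r s S F \<longrightarrow>
            symmetric_function (S_oo r s S) (F \<circ> cover) \<and>
            tau_holomorphic 2 (zariski_free_opens 2) (S_oo r s S) (F \<circ> cover)) \<and>
         (\<forall>f. symmetric_function (S_oo r s S) f \<and>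
              tau_holomorphic 2 (zariski_free_opens 2) (S_oo r s S) f \<longrightarrow>
              (\<exists>!F. F \<in> extensional (G_oo r s S) \<and> holomorphic_on_G_oo r s S F \<and>
                    (\<forall>w \<in> S_oo r s S. f w = (F \<circ> cover) w)))"
proof -
  interpret sqrt_branches r s by unfold_locales (rule assms(1))
  show ?thesis
    using holomorphic_descent_imp[OF assms(2,3)] holomorphic_descent_exists_unique[OF assms(2)] by simp
qed

end
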